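(* Let $DMF^{crit}_{graphs}$ denote the set of CM equivalence classes of discrete Morse functions with only critical cells on connected multigraphs, and let $gMLT$ denote the set of isomorphism classes of generalized Morse labeled merge trees (gML trees). Then the induced discrete Morse function $\Phi$ and the induced gML tree $M(\_,\_)$ define maps $$M(\_,\_)\colon DMF^{crit}_{graphs}\leftrightarrow gMLT\colon \Phi$$ that are inverse to each other in the sense that: (1) for any discrete Morse function $(X,f)$ with only critical cells, the discrete Morse function $\Phi(M(X,f),\lambda_f)$ is CM-equivalent to $(X,f)$; and (2) for any gML tree $(T,\lambda)$, writing $\Phi(T,\lambda)=(\Phi T,f_\lambda)$, one has $M(\Phi T,f_\lambda)\cong (T,\lambda)$ as gML trees.
   Context: **Graphs and discrete Morse functions.** A graph is a finite multigraph, possibly with multiple edges and self-loops (a finite CW complex of dimension $\le 1$); $X$ also denotes its set of cells (vertices and edges). A discrete Morse function (dMf) on $X$ is a function $f\colon X\to\mathbb R$ such that (i) $f(\sigma)\le f(\tau)$ whenever $\sigma\subset\tau$; (ii) $|f^{-1}(z)|\le 2$ for all $z\in\mathbb R$; (iii) if $f(\sigma)=f(\tau)$ then $\sigma\subseteq\tau$ or $\tau\subseteq\sigma$. A cell $\sigma$ is critical if it is the unique preimage of $f(\sigma)$, otherwise matched; self-loops are required to be critical. A dMf is called critical if all its cells are critical. Put $X_a=\{\sigma: f(\sigma)\le a\}$ and $X_{a-\varepsilon}=\{\sigma: f(\sigma)<a\}$; $X_a[\sigma]$ denotes the connected component of $X_a$ containing $\sigma$ (similarly for $X_{a-\varepsilon}$).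 A critical edge $\sigma$ is closing if there is a subcomplex $\Delta\subseteq X$ that is a subdivision of $S^1$, contains $\sigma$, and on which $f$ has maximum $f(\sigma)$. **Generalized merge trees.** A rooted tree is binary if every node has at most two children. It is chiral if every node carries a label L or R (its chirality), such that when a node has two children one is labeled L (the left child) and the other R (the right child). A generalized merge tree is a chiral binary tree such that every leaf has a sibling and every inner node without a sibling has the same chirality as its parent; the root always has chirality L and is never regarded as a leaf. For a node $p$, $T(p)$ is the subtree consisting of $p$ and all its descendants, with inherited chiralities; these are the generalized merge subtrees. A gML tree $(T,\lambda)$ is a generalized merge tree with an injective map $\lambda$ from the nodes of $T$ to $\mathbb R$ (a Morse labeling) such that for every node $p$: $\lambda|_{T(p)}$ attains its maximum at $p$, and the node at which $\lambda|_{T(p)}$ attains its minimum has the same chirality as $p$. Isomorphisms of gML trees are isomorphisms of rooted trees preserving chiralities and labels. A cycle node is a node with exactly one child; $C(T)$ is the set of cycle nodes. **Induced gML tree $M(X,f)$ with labeling $\lambda_f$** ($X$ connected). If $f$ has a single critical vertex $v$ and no critical edges, $M(X,f)$ is a single node with label $f(v)$ and chirality L. Otherwise let $\sigma_n>\dots>\sigma_0$ be the critical edges ordered by $f$-value. Start with a root $M(\sigma_n)$ with label $f(\sigma_n)$ and chirality L. For $i=n,\dots,0$, let $v,w$ be the endpoints of $\sigma_i$. If $\sigma_i$ is closing, $M(\sigma_i)$ gets one child, of the same chirality as $M(\sigma_i)$, labeled with the maximum of $f$ over critical cells of the component $X_{f(\sigma_i)-\varepsilon}[v]$. If $\sigma_i$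 is not closing, $M(\sigma_i)$ gets two children, labeled $\lambda_v=\max\{f(\sigma):\sigma\in X_{f(\sigma_i)-\varepsilon}[v]\text{ critical}\}$ and $\lambda_w=\max\{f(\sigma):\sigma\in X_{f(\sigma_i)-\varepsilon}[w]\text{ critical}\}$; the child belonging to the component on which $f$ has the smaller minimum gets the same chirality as $M(\sigma_i)$, the other child gets the opposite chirality. The node labeled $f(s)$, for a critical cell $s$, is denoted $M(s)$. **Induced dMf $\Phi(T,\lambda)=(\Phi T,f_\lambda)$.** Let $\bar T$ be obtained from $T$ by removing all cycle nodes, connecting their parents directly to their children; every node of $\bar T$ has 0 or 2 children. Let $P$ be a path with as many edges as $\bar T$ has inner nodes, its cells (vertices and edges) being ordered from left to right. Order the nodes of $\bar T$ from left to right (in-order: nodes of the subtree of the left child, then the node itself, then nodes of the subtree of the right child). Via the unique order-preserving bijection between cells of $P$ and nodes of $\bar T$, transport $\lambda$ to a function on $P$. Then for each cycle node $c\in C(T)$ add an edge with value $\lambda(c)$ parallel to the edge of $P$ corresponding to the oldest (closest to $c$) descendant of $c$ that has two children. **Symmetry equivalence.** For a dMf $f$ on $X$ and a nonempty connected component $X_c[v]$ of a sublevel complex ($c$ a critical value), $\widetilde{\operatorname{Aut}}(X_c[v])$ is the group of self-bijections of the set $X$ that restrict to a simplicial automorphism of $X_c[v]$ and to the identity outside it (elementary sublevel automorphisms, of level $c$). $\operatorname{Aut}_{sl}(X,f)$ is the quotient of the free product of these groups over all such components, in which products within one $\widetilde{\operatorname{Aut}}(X_c[v])$ are identified with compositions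 and elements belonging to different components commute. Two dMfs $f,g$ on $X$ are symmetry-equivalent if they have the same critical values and isomorphic sublevel complexes and $g=f\circ\xi$ for some $\xi\in\operatorname{Aut}_{sl}(X,f)$ (products of elementary ones acting successively); $\xi$ is then called a symmetry equivalence. DMfs $f$ on $X$ and $g$ on $Y$ are symmetry-equivalent if there is a simplicial isomorphism $\varphi\colon X\to Y$ with $f$ and $g\circ\varphi$ symmetry-equivalent. **CM equivalence.** Let $(X,f)$, $(X',f')$ be critical dMfs on connected graphs. A component-merge (CM) equivalence of level $a$ is a bijection $\varphi\colon X\to X'$ such that at least one of the following holds: (1) $\varphi$ is a symmetry equivalence involving only sublevel automorphisms of level at most $a$; (2) (recursively) $f'\circ\varphi=f$; $\varphi$ induces a bijection between the sets of connected components of sublevel complexes such that each restriction $X_{a-\varepsilon}[v]\to X'_{a-\varepsilon}[\varphi(v)]$ is a CM equivalence of a level $\le a$; and the edge $\sigma$ with $f(\sigma)=a$ merges two components $X_{a-\varepsilon}[v_1]$, $X_{a-\varepsilon}[v_2]$ in $X_a$ if and only if $\varphi(\sigma)$ merges the corresponding components $X'_{a-\varepsilon}[\varphi(v_1)]$, $X'_{a-\varepsilon}[\varphi(v_2)]$ in $X'_a$, while $\sigma$ closes a circle within $X_{a-\varepsilon}[v]$ if and only if $\varphi(\sigma)$ closes a circle within $X'_{a-\varepsilon}[\varphi(v)]$. $(X,f)$ and $(X',f')$ are CM-equivalent if there is a CM equivalence (of some level) between them.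
   Formalization: Excludes dMfs where a self-loop enters at a component that is a single vertex (M(X,f) then has a leaf without sibling and Φ is undefined); elements of Aut_sl act with lower levels first, since arbitrary products of sublevel automorphisms need not preserve M(X,f). *)

theory Defs
  imports Complex_Main "HOL-Library.Multiset"
begin

section \<open>Finite multigraphs\<close>

text \<open>
  The set \<open>ends X e\<close> contains the endpoints of \<open>e\<close>; it is a singleton exactly for self-loops.
  Cells are elements of the sum type: \<open>Inl v\<close> is a vertex, \<open>Inr e\<close> an edge.
\<close>

record ('v, 'e) multigraph =
  verts :: "'v set"
  edges :: "'e set"
  ends :: "'e \<Rightarrow> 'v set"

definition multigraph :: "('v, 'e) multigraph \<Rightarrow> bool" where
  "multigraph X \<longleftrightarrow> finite (verts X) \<and> finite (edges X) \<and>
     (\<forall>e\<in>edges X. ends X e \<subseteq> verts X \<and> card (ends X e) \<in> {1, 2})"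

definition cells :: "('v, 'e) multigraph \<Rightarrow> ('v + 'e) set" where
  "cells X = Inl ` verts X \<union> Inr ` edges X"

definition proper_face :: "('v, 'e) multigraph \<Rightarrow> 'v + 'e \<Rightarrow> 'v + 'e \<Rightarrow> bool" where
  "proper_face X s t \<longleftrightarrow> (\<exists>v\<in>verts X. \<exists>e\<in>edges X. s = Inl v \<and> t = Inr e \<and> v \<in> ends X e)"

definition subcomplex :: "('v, 'e) multigraph \<Rightarrow> ('v, 'e) multigraph \<Rightarrow> bool" where
  "subcomplex D X \<longleftrightarrow> multigraph D \<and> verts D \<subseteq> verts X \<and> edges D \<subseteq> edges X \<and>
     (\<forall>e\<in>edges D. ends D e = ends X e)"

definition restrict_cells :: "('v, 'e) multigraph \<Rightarrow> ('v + 'e) set \<Rightarrow> ('v, 'e) multigraph" where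
  "restrict_cells X S =
     \<lparr>verts = {v \<in> verts X. Inl v \<in> S}, edges = {e \<in> edges X. Inr e \<in> S}, ends = ends X\<rparr>"

definition incident :: "('v, 'e) multigraph \<Rightarrow> (('v + 'e) \<times> ('v + 'e)) set" where
  "incident X = {(s, t). proper_face X s t \<or> proper_face X t s}"

definition component_cells :: "('v, 'e) multigraph \<Rightarrow> 'v + 'e \<Rightarrow> ('v + 'e) set" where
  "component_cells X s = {t \<in> cells X. (s, t) \<in> (incident X)\<^sup>*}"

text \<open>\<open>component X s\<close> is \<open>X[s]\<close>, the connected component of \<open>X\<close> containing the cell \<open>s\<close>.\<close>

definition component :: "('v, 'e) multigraph \<Rightarrow> 'v + 'e \<Rightarrow> ('v, 'e) multigraph" where
  "component X s = restrict_cells X (component_cells X s)"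

definition components :: "('v, 'e) multigraph \<Rightarrow> ('v + 'e) set set" where
  "components X = component_cells X ` cells X"

definition connected_graph :: "('v, 'e) multigraph \<Rightarrow> bool" where
  "connected_graph X \<longleftrightarrow> cells X \<noteq> {} \<and> (\<forall>s\<in>cells X. \<forall>t\<in>cells X. (s, t) \<in> (incident X)\<^sup>*)"

definition graph_iso ::
  "('v, 'e) multigraph \<Rightarrow> ('w, 'd) multigraph \<Rightarrow> ('v + 'e \<Rightarrow> 'w + 'd) \<Rightarrow> bool" where
  "graph_iso X Y \<phi> \<longleftrightarrow> bij_betw \<phi> (cells X) (cells Y) \<and>
     \<phi> ` Inl ` verts X = Inl ` verts Y \<and> \<phi> ` Inr ` edges X = Inr ` edges Y \<and>
     (\<forall>s\<in>cells X. \<forall>t\<in>cells X. proper_face X s t \<longleftrightarrow> proper_face Y (\<phi> s) (\<phi> t))"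

text \<open>
  A subdivision of \<open>S\<^sup>1\<close>: \<open>n \<ge> 1\<close> vertices and \<open>n\<close> edges in cyclic order. The case \<open>n = 1\<close> is a
  self-loop, the case \<open>n = 2\<close> a pair of parallel edges.
\<close>

definition circle_graph :: "('v, 'e) multigraph \<Rightarrow> bool" where
  "circle_graph D \<longleftrightarrow> (\<exists>(n::nat) v e. n \<ge> 1 \<and> inj_on v {..<n} \<and> inj_on e {..<n} \<and>
     verts D = v ` {..<n} \<and> edges D = e ` {..<n} \<and>
     (\<forall>i<n. ends D (e i) = {v i, v (Suc i mod n)}))"


section \<open>Discrete Morse functions\<close>

text \<open>Functions on cells are total; only their values on \<open>cells X\<close> are relevant.\<close>

definition critical :: "('v, 'e) multigraph \<Rightarrow> ('v + 'e \<Rightarrow> real) \<Rightarrow> 'v + 'e \<Rightarrow> bool" where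
  "critical X f s \<longleftrightarrow> s \<in> cells X \<and> (\<forall>t\<in>cells X. f t = f s \<longrightarrow> t = s)"

definition dMf :: "('v, 'e) multigraph \<Rightarrow> ('v + 'e \<Rightarrow> real) \<Rightarrow> bool" where
  "dMf X f \<longleftrightarrow>
     (\<forall>s\<in>cells X. \<forall>t\<in>cells X. proper_face X s t \<longrightarrow> f s \<le> f t) \<and>
     (\<forall>z. card {s \<in> cells X. f s = z} \<le> 2) \<and>
     (\<forall>s\<in>cells X. \<forall>t\<in>cells X. f s = f t \<longrightarrow> s = t \<or> proper_face X s t \<or> proper_face X t s) \<and>
     (\<forall>e\<in>edges X. card (ends X e) = 1 \<longrightarrow> critical X f (Inr e))"

definition critical_dMf :: "('v, 'e) multigraph \<Rightarrow> ('v + 'e \<Rightarrow> real) \<Rightarrow> bool" where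
  "critical_dMf X f \<longleftrightarrow> dMf X f \<and> (\<forall>s\<in>cells X. critical X f s)"

definition critical_values :: "('v, 'e) multigraph \<Rightarrow> ('v + 'e \<Rightarrow> real) \<Rightarrow> real set" where
  "critical_values X f = f ` {s. critical X f s}"

text \<open>\<open>sublevel X f a\<close> is \<open>X\<^sub>a\<close>, and \<open>sublevel_less X f a\<close> is \<open>X\<^bsub>a-\<epsilon>\<^esub>\<close>.\<close>

definition sublevel ::
  "('v, 'e) multigraph \<Rightarrow> ('v + 'e \<Rightarrow> real) \<Rightarrow> real \<Rightarrow> ('v, 'e) multigraph" where
  "sublevel X f a = restrict_cells X {s. f s \<le> a}"

definition sublevel_less ::
  "('v, 'e) multigraph \<Rightarrow> ('v + 'e \<Rightarrow> real) \<Rightarrow> real \<Rightarrow> ('v, 'e) multigraph" where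
  "sublevel_less X f a = restrict_cells X {s. f s < a}"

definition closing :: "('v, 'e) multigraph \<Rightarrow> ('v + 'e \<Rightarrow> real) \<Rightarrow> 'e \<Rightarrow> bool" where
  "closing X f e \<longleftrightarrow> critical X f (Inr e) \<and>
     (\<exists>D. subcomplex D X \<and> circle_graph D \<and> e \<in> edges D \<and> (\<forall>s\<in>cells D. f s \<le> f (Inr e)))"

text \<open>
  A closing edge whose lower component is a single vertex is necessarily a self-loop; in the
  induced tree it becomes a cycle node above a leaf without sibling, which is not allowed in
  generalized merge trees. The following condition excludes precisely these self-loops.
\<close>

definition no_initial_loops :: "('v, 'e) multigraph \<Rightarrow> ('v + 'e \<Rightarrow> real) \<Rightarrow> bool" where
  "no_initial_loops X f \<longleftrightarrow> (\<forall>e\<in>edges X. \<forall>v. ends X e = {v} \<longrightarrow>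
     edges (component (sublevel_less X f (f (Inr e))) (Inl v)) \<noteq> {})"


section \<open>Generalized Morse labeled merge trees\<close>

datatype chirality = Lft | Rgt

fun opposite :: "chirality \<Rightarrow> chirality" where
  "opposite Lft = Rgt"
| "opposite Rgt = Lft"

text \<open>
  A finite rooted tree whose nodes carry a chirality and a label. The order of the list of children
  carries no information: left and right are determined by the chiralities, and isomorphisms may
  permute children. A node \<open>p\<close> is represented by its subtree \<open>T(p)\<close>.
\<close>

datatype ltree = Node (chir: chirality) (lab: real) (children: "ltree list")

fun subtrees :: "ltree \<Rightarrow> ltree list" where
  "subtrees (Node c x ts) = Node c x ts # concat (map subtrees ts)"

definition binary_tree :: "ltree \<Rightarrow> bool" where
  "binary_tree T \<longleftrightarrow> (\<forall>p\<in>set (subtrees T). length (children p) \<le> 2)"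

definition chiral_tree :: "ltree \<Rightarrow> bool" where
  "chiral_tree T \<longleftrightarrow> (\<forall>p\<in>set (subtrees T). \<forall>a b. children p = [a, b] \<longrightarrow> chir a \<noteq> chir b)"

definition generalized_merge_tree :: "ltree \<Rightarrow> bool" where
  "generalized_merge_tree T \<longleftrightarrow> binary_tree T \<and> chiral_tree T \<and> chir T = Lft \<and>
     (\<forall>p\<in>set (subtrees T). \<forall>q\<in>set (children p).
        (children q = [] \<longrightarrow> length (children p) \<noteq> 1) \<and>
        (children q \<noteq> [] \<and> length (children p) = 1 \<longrightarrow> chir q = chir p))"

definition morse_labeled :: "ltree \<Rightarrow> bool" where
  "morse_labeled T \<longleftrightarrow> distinct (map lab (subtrees T)) \<and>
     (\<forall>p\<in>set (subtrees T).
        (\<forall>q\<in>set (subtrees p). lab q \<le> lab p) \<and>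
        (\<forall>q\<in>set (subtrees p). (\<forall>r\<in>set (subtrees p). lab q \<le> lab r) \<longrightarrow> chir q = chir p))"

definition gML_tree :: "ltree \<Rightarrow> bool" where
  "gML_tree T \<longleftrightarrow> generalized_merge_tree T \<and> morse_labeled T"

inductive ltree_iso :: "ltree \<Rightarrow> ltree \<Rightarrow> bool" where
  "mset us = mset ts' \<Longrightarrow> list_all2 ltree_iso ts us \<Longrightarrow> ltree_iso (Node c x ts) (Node c x ts')"

definition gML_trees :: "ltree set" where
  "gML_trees = {T. gML_tree T}"

definition gML_iso_rel :: "(ltree \<times> ltree) set" where
  "gML_iso_rel = {(T, T'). T \<in> gML_trees \<and> T' \<in> gML_trees \<and> ltree_iso T T'}"


section \<open>The induced gML tree\<close>

definition top_critical ::
  "('v, 'e) multigraph \<Rightarrow> ('v + 'e \<Rightarrow> real) \<Rightarrow> ('v, 'e) multigraph \<Rightarrow> 'v + 'e \<Rightarrow> bool" where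
  "top_critical X f K s \<longleftrightarrow> critical X f s \<and> s \<in> cells K \<and>
     (\<forall>t\<in>cells K. critical X f t \<longrightarrow> f t \<le> f s)"

text \<open>
  \<open>node_tree X f s c T\<close>: the subtree \<open>T(M(s))\<close> below the node of the critical cell \<open>s\<close> is \<open>T\<close>, if
  that node has chirality \<open>c\<close>. In the rule for non-closing edges \<open>v\<close> is the endpoint whose component
  has the smaller minimum; as \<open>ends X e\<close> is an unordered set, this is no restriction.
\<close>

inductive node_tree ::
  "('v, 'e) multigraph \<Rightarrow> ('v + 'e \<Rightarrow> real) \<Rightarrow> 'v + 'e \<Rightarrow> chirality \<Rightarrow> ltree \<Rightarrow> bool"
  for X f where
  vertex: "critical X f (Inl v) \<Longrightarrow> node_tree X f (Inl v) c (Node c (f (Inl v)) [])"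
| cycle: "critical X f (Inr e) \<Longrightarrow> closing X f e \<Longrightarrow> ends X e = {v, w} \<Longrightarrow>
    top_critical X f (component (sublevel_less X f (f (Inr e))) (Inl v)) s \<Longrightarrow>
    node_tree X f s c T \<Longrightarrow>
    node_tree X f (Inr e) c (Node c (f (Inr e)) [T])"
| merge: "critical X f (Inr e) \<Longrightarrow> \<not> closing X f e \<Longrightarrow> ends X e = {v, w} \<Longrightarrow>
    K = component (sublevel_less X f (f (Inr e))) (Inl v) \<Longrightarrow>
    K' = component (sublevel_less X f (f (Inr e))) (Inl w) \<Longrightarrow>
    Min (f ` cells K) < Min (f ` cells K') \<Longrightarrow>
    top_critical X f K s \<Longrightarrow> top_critical X f K' s' \<Longrightarrow>
    node_tree X f s c T \<Longrightarrow> node_tree X f s' (opposite c) T' \<Longrightarrow>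
    node_tree X f (Inr e) c (Node c (f (Inr e)) [T, T'])"

definition root_cell :: "('v, 'e) multigraph \<Rightarrow> ('v + 'e \<Rightarrow> real) \<Rightarrow> 'v + 'e \<Rightarrow> bool" where
  "root_cell X f s \<longleftrightarrow> critical X f s \<and>
     (if \<exists>e. critical X f (Inr e)
      then \<exists>e. s = Inr e \<and> (\<forall>e'. critical X f (Inr e') \<longrightarrow> f (Inr e') \<le> f (Inr e))
      else \<exists>v. s = Inl v)"

definition induced_tree :: "('v, 'e) multigraph \<Rightarrow> ('v + 'e \<Rightarrow> real) \<Rightarrow> ltree" where
  "induced_tree X f = (THE T. \<exists>s. root_cell X f s \<and> node_tree X f s Lft T)"


section \<open>The induced discrete Morse function\<close>

fun remove_cycle_nodes :: "ltree \<Rightarrow> ltree" where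
  "remove_cycle_nodes (Node c x [t]) = remove_cycle_nodes t"
| "remove_cycle_nodes (Node c x ts) = Node c x (map remove_cycle_nodes ts)"

fun inorder :: "ltree \<Rightarrow> real list" where
  "inorder (Node c x ts) =
     concat (map (\<lambda>t. if chir t = Lft then inorder t else []) ts) @ [x] @
     concat (map (\<lambda>t. if chir t = Rgt then inorder t else []) ts)"

definition inner_nodes :: "ltree \<Rightarrow> nat" where
  "inner_nodes T = length (filter (\<lambda>p. children p \<noteq> []) (subtrees T))"

definition cycle_nodes :: "ltree \<Rightarrow> ltree set" where
  "cycle_nodes T = {c \<in> set (subtrees T). length (children c) = 1}"

fun oldest_branching :: "ltree \<Rightarrow> ltree" where
  "oldest_branching (Node c x [t]) = oldest_branching t"
| "oldest_branching (Node c x ts) = Node c x ts"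

text \<open>
  The path \<open>P\<close> has vertices \<open>0, \<dots>, k\<close> and edges \<open>PathEdge i\<close> from \<open>i\<close> to \<open>i + 1\<close>. Reading the cells
  of \<open>P\<close> from left to right, vertex \<open>i\<close> is cell number \<open>2 * i\<close> and \<open>PathEdge i\<close> is cell number
  \<open>2 * i + 1\<close>. The edge added for a cycle node \<open>c\<close> is named \<open>CycleEdge (lab c)\<close>; this is unambiguous,
  since labelings are injective.
\<close>

datatype phi_edge = PathEdge nat | CycleEdge real

definition phi_word :: "ltree \<Rightarrow> real list" where
  "phi_word T = inorder (remove_cycle_nodes T)"

definition phi_length :: "ltree \<Rightarrow> nat" where
  "phi_length T = inner_nodes (remove_cycle_nodes T)"

definition parallel_index :: "ltree \<Rightarrow> real \<Rightarrow> nat" where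
  "parallel_index T r = (THE i. i < phi_length T \<and>
     (\<exists>c\<in>cycle_nodes T. lab c = r \<and> phi_word T ! (2 * i + 1) = lab (oldest_branching c)))"

definition Phi_graph :: "ltree \<Rightarrow> (nat, phi_edge) multigraph" where
  "Phi_graph T =
     \<lparr>verts = {..phi_length T},
      edges = PathEdge ` {..<phi_length T} \<union> (\<lambda>c. CycleEdge (lab c)) ` cycle_nodes T,
      ends = (\<lambda>e. case e of PathEdge i \<Rightarrow> {i, Suc i}
                | CycleEdge r \<Rightarrow> {parallel_index T r, Suc (parallel_index T r)})\<rparr>"

fun Phi_fun :: "ltree \<Rightarrow> nat + phi_edge \<Rightarrow> real" where
  "Phi_fun T (Inl i) = phi_word T ! (2 * i)"
| "Phi_fun T (Inr (PathEdge i)) = phi_word T ! (2 * i + 1)"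
| "Phi_fun T (Inr (CycleEdge r)) = r"


section \<open>Symmetry equivalence\<close>

definition elementary_automorphism ::
  "('v, 'e) multigraph \<Rightarrow> ('v + 'e \<Rightarrow> real) \<Rightarrow> real \<Rightarrow> ('v + 'e \<Rightarrow> 'v + 'e) \<Rightarrow> bool" where
  "elementary_automorphism X f c \<xi> \<longleftrightarrow> c \<in> critical_values X f \<and> bij_betw \<xi> (cells X) (cells X) \<and>
     (\<exists>v\<in>verts (sublevel X f c).
        graph_iso (component (sublevel X f c) (Inl v)) (component (sublevel X f c) (Inl v)) \<xi> \<and>
        (\<forall>s\<in>cells X - cells (component (sublevel X f c) (Inl v)). \<xi> s = s))"

text \<open>
  The group \<open>Aut\<^sub>s\<^sub>l(X, f)\<close> is generated by elementary automorphisms, where automorphisms of different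
  components commute. Bijections of \<open>X\<close> that belong to nested components need not commute under
  composition, so a group element acts through its representatives ordered by level: the elementary
  automorphisms act successively on \<open>f\<close>, from lower to higher levels. By the commutation relations
  every element has such a representative, and all of them have the same composition. Without the
  ordering, \<open>f \<circ> \<xi>\<close> would depend on the representative: for \<open>\<xi>\<close> at a low level and \<open>\<zeta>\<close> at a high
  level, conjugating \<open>\<xi>\<close> by \<open>\<zeta>\<close> yields a permutation of a subcomplex that need not be a component of
  any sublevel complex.
\<close>

definition aut_sl_word ::
  "('v, 'e) multigraph \<Rightarrow> ('v + 'e \<Rightarrow> real) \<Rightarrow> (real \<times> ('v + 'e \<Rightarrow> 'v + 'e)) list \<Rightarrow> bool" where
  "aut_sl_word X f ws \<longleftrightarrow> sorted (map fst ws) \<and>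
     (\<forall>(c, \<xi>)\<in>set ws. elementary_automorphism X f c \<xi>)"

text \<open>\<open>f \<circ> word_action [(c\<^sub>1, \<xi>\<^sub>1), \<dots>, (c\<^sub>n, \<xi>\<^sub>n)] = (\<dots>((f \<circ> \<xi>\<^sub>1) \<circ> \<xi>\<^sub>2)\<dots>) \<circ> \<xi>\<^sub>n\<close>\<close>

definition word_action :: "(real \<times> ('a \<Rightarrow> 'a)) list \<Rightarrow> 'a \<Rightarrow> 'a" where
  "word_action ws = foldr (\<circ>) (map snd ws) id"

definition symmetry_equivalent_by ::
  "('v, 'e) multigraph \<Rightarrow> ('v + 'e \<Rightarrow> real) \<Rightarrow> ('v + 'e \<Rightarrow> real) \<Rightarrow>
   (real \<times> ('v + 'e \<Rightarrow> 'v + 'e)) list \<Rightarrow> bool" where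
  "symmetry_equivalent_by X f g ws \<longleftrightarrow>
     critical_values X f = critical_values X g \<and>
     (\<forall>a. \<exists>\<phi>. graph_iso (sublevel X f a) (sublevel X g a) \<phi>) \<and>
     aut_sl_word X f ws \<and> (\<forall>s\<in>cells X. g s = f (word_action ws s))"

text \<open>
  A symmetry equivalence \<open>\<phi>\<close> from \<open>(X, f)\<close> to \<open>(X', f')\<close> that involves only levels at most \<open>a\<close>:
  \<open>f' \<circ> \<psi> = f \<circ> \<xi>\<close> for a simplicial isomorphism \<open>\<psi>\<close>, and \<open>\<phi> = \<psi> \<circ> \<xi>\<^sup>-\<^sup>1\<close>, so that \<open>f' \<circ> \<phi> = f\<close>.
\<close>

definition symmetry_equivalence ::
  "real \<Rightarrow> ('v, 'e) multigraph \<Rightarrow> ('v + 'e \<Rightarrow> real) \<Rightarrow>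
   ('w, 'd) multigraph \<Rightarrow> ('w + 'd \<Rightarrow> real) \<Rightarrow> ('v + 'e \<Rightarrow> 'w + 'd) \<Rightarrow> bool" where
  "symmetry_equivalence a X f X' f' \<phi> \<longleftrightarrow>
     (\<exists>\<psi> ws. graph_iso X X' \<psi> \<and> symmetry_equivalent_by X f (f' \<circ> \<psi>) ws \<and>
        (\<forall>(c, \<xi>)\<in>set ws. c \<le> a) \<and> (\<forall>s\<in>cells X. \<phi> (word_action ws s) = \<psi> s))"


section \<open>Component-merge equivalence\<close>

definition merges ::
  "('v, 'e) multigraph \<Rightarrow> 'v + 'e \<Rightarrow> ('v, 'e) multigraph \<Rightarrow> ('v, 'e) multigraph \<Rightarrow> bool" where
  "merges X s K K' \<longleftrightarrow> cells K \<noteq> cells K' \<and>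
     (\<exists>e\<in>edges X. s = Inr e \<and> (\<exists>v\<in>verts K. \<exists>w\<in>verts K'. ends X e = {v, w}))"

definition closes_circle_within ::
  "('v, 'e) multigraph \<Rightarrow> 'v + 'e \<Rightarrow> ('v, 'e) multigraph \<Rightarrow> bool" where
  "closes_circle_within X s K \<longleftrightarrow>
     (\<exists>e\<in>edges X. s = Inr e \<and>
        (\<exists>D. subcomplex D X \<and> circle_graph D \<and> e \<in> edges D \<and> cells D \<subseteq> insert s (cells K)))"

text \<open>
  In the recursive rule, \<open>\<phi>\<close> has to induce a bijection between the components of \<open>X\<^sub>b\<close> and \<open>X'\<^sub>b\<close> for
  every \<open>b\<close>, not only for those below \<open>a\<close>.
\<close>

inductive CM_equivalence ::
  "real \<Rightarrow> ('v, 'e) multigraph \<Rightarrow> ('v + 'e \<Rightarrow> real) \<Rightarrow>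
   ('w, 'd) multigraph \<Rightarrow> ('w + 'd \<Rightarrow> real) \<Rightarrow> ('v + 'e \<Rightarrow> 'w + 'd) \<Rightarrow> bool" where
  symmetry:
    "multigraph X \<Longrightarrow> connected_graph X \<Longrightarrow> critical_dMf X f \<Longrightarrow>
     multigraph X' \<Longrightarrow> connected_graph X' \<Longrightarrow> critical_dMf X' f' \<Longrightarrow>
     bij_betw \<phi> (cells X) (cells X') \<Longrightarrow>
     symmetry_equivalence a X f X' f' \<phi> \<Longrightarrow>
     CM_equivalence a X f X' f' \<phi>"
| recursive:
    "multigraph X \<Longrightarrow> connected_graph X \<Longrightarrow> critical_dMf X f \<Longrightarrow>
     multigraph X' \<Longrightarrow> connected_graph X' \<Longrightarrow> critical_dMf X' f' \<Longrightarrow>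
     bij_betw \<phi> (cells X) (cells X') \<Longrightarrow>
     \<forall>s\<in>cells X. f' (\<phi> s) = f s \<Longrightarrow>
     \<forall>b. bij_betw (image \<phi>) (components (sublevel X f b)) (components (sublevel X' f' b)) \<Longrightarrow>
     \<forall>v\<in>verts (sublevel_less X f a). \<exists>b\<le>a.
       CM_equivalence b (component (sublevel_less X f a) (Inl v)) f
         (component (sublevel_less X' f' a) (\<phi> (Inl v))) f' \<phi> \<Longrightarrow>
     \<forall>e\<in>edges X. f (Inr e) = a \<longrightarrow>
       (\<forall>v\<in>verts (sublevel_less X f a). \<forall>w\<in>verts (sublevel_less X f a).
          merges X (Inr e) (component (sublevel_less X f a) (Inl v))
            (component (sublevel_less X f a) (Inl w)) \<longleftrightarrow>
          merges X' (\<phi> (Inr e)) (component (sublevel_less X' f' a) (\<phi> (Inl v)))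
            (component (sublevel_less X' f' a) (\<phi> (Inl w)))) \<and>
       (\<forall>v\<in>verts (sublevel_less X f a).
          closes_circle_within X (Inr e) (component (sublevel_less X f a) (Inl v)) \<longleftrightarrow>
          closes_circle_within X' (\<phi> (Inr e))
            (component (sublevel_less X' f' a) (\<phi> (Inl v)))) \<Longrightarrow>
     CM_equivalence a X f X' f' \<phi>"

definition CM_equivalent ::
  "('v, 'e) multigraph \<Rightarrow> ('v + 'e \<Rightarrow> real) \<Rightarrow>
   ('w, 'd) multigraph \<Rightarrow> ('w + 'd \<Rightarrow> real) \<Rightarrow> bool" where
  "CM_equivalent X f X' f' \<longleftrightarrow> (\<exists>a \<phi>. CM_equivalence a X f X' f' \<phi>)"

definition critical_dMfs :: "(('v, 'e) multigraph \<times> ('v + 'e \<Rightarrow> real)) set" where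
  "critical_dMfs = {(X, f). multigraph X \<and> connected_graph X \<and> critical_dMf X f}"

definition CM_rel ::
  "((('v, 'e) multigraph \<times> ('v + 'e \<Rightarrow> real)) \<times> (('v, 'e) multigraph \<times> ('v + 'e \<Rightarrow> real))) set"
where
  "CM_rel = {((X, f), (X', f')).
     (X, f) \<in> critical_dMfs \<and> (X', f') \<in> critical_dMfs \<and> CM_equivalent X f X' f'}"

end

theory Submission
  imports Defs
begin

text \<open>
  All cells of a critical discrete Morse function have distinct values, so a bijection respecting
  the functions is determined by the values alone. The complete invariant is the family of value
  sets \<open>f(X\<^bsub>f(s)\<^esub>[s])\<close> over all cells \<open>s\<close>: two critical functions are CM-equivalent iff these families
  agree. Indeed, linkage of two cells in \<open>X\<^sub>b\<close> can be read off from the family, a symmetry equivalence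
  preserves linkage because each letter only permutes one component, and linkage in turn determines
  which edges merge components and which close circles.

  The family of label sets of subtrees plays the same role for gML trees: it determines the tree up
  to isomorphism, because the chiralities are forced by the positions of the minima. The induced
  tree and the induced function both preserve the family, so they are mutually inverse.
\<close>

section \<open>Cells and components\<close>

text \<open>The obstacle is that a CM equivalence need not be a graph map: it respects components of
  sublevel complexes, while the ends of an edge may move inside the components that they lie in. So
  every notion defined through ends of edges or circles (closing edges, merging, circles within a
  component) has to be rewritten in terms of \<open>lower X f s\<close>, the component that a cell
  \<open>s\<close> completes. The same freedom allows every gML tree to be realized over a path with
  parallel edges: an edge only needs its ends below the right children. A self-loop at a vertex that
  is still isolated is the one case in which the tree of a function fails to be a gML tree; in the
  family it shows up as a member with exactly two elements.\<close>

lemma Inl_in_cells [simp]: "Inl v \<in> cells X \<longleftrightarrow> v \<in> verts X"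
  and Inr_in_cells [simp]: "Inr e \<in> cells X \<longleftrightarrow> e \<in> edges X"
  by (auto simp: cells_def)

lemma cells_restrict [simp]: "cells (restrict_cells X S) = cells X \<inter> S"
  by (auto simp: cells_def restrict_cells_def)

lemma verts_restrict [simp]: "verts (restrict_cells X S) = {v \<in> verts X. Inl v \<in> S}"
  and edges_restrict [simp]: "edges (restrict_cells X S) = {e \<in> edges X. Inr e \<in> S}"
  and ends_restrict [simp]: "ends (restrict_cells X S) = ends X"
  by (auto simp: restrict_cells_def)

lemma restrict_restrict: "restrict_cells (restrict_cells X A) B = restrict_cells X (A \<inter> B)"
  by (auto simp: restrict_cells_def)

lemma restrict_UNIV [simp]: "restrict_cells X UNIV = X"
  by (simp add: restrict_cells_def)

lemma restrict_cong: "cells X \<inter> A = cells X \<inter> B \<Longrightarrow> restrict_cells X A = restrict_cells X B"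
  unfolding restrict_cells_def
  by (smt (verit, best) Collect_cong Inl_in_cells Inr_in_cells IntD2 IntI)

lemma proper_face_restrict:
  "proper_face (restrict_cells X S) s t \<longleftrightarrow> proper_face X s t \<and> s \<in> S \<and> t \<in> S"
  by (auto simp: proper_face_def)

lemma incident_restrict:
  "(s, t) \<in> incident (restrict_cells X S) \<longleftrightarrow> (s, t) \<in> incident X \<and> s \<in> S \<and> t \<in> S"
  by (auto simp: incident_def proper_face_restrict)

lemma incident_cells: "(s, t) \<in> incident X \<Longrightarrow> s \<in> cells X \<and> t \<in> cells X"
  by (auto simp: incident_def proper_face_def cells_def)

lemma sym_incident: "sym (incident X)"
  by (auto simp: incident_def sym_def)

lemma reach_sym: "(s, t) \<in> (incident X)\<^sup>* \<Longrightarrow> (t, s) \<in> (incident X)\<^sup>*"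
  using sym_incident sym_rtrancl symE by metis

lemma reach_cells: "(s, t) \<in> (incident X)\<^sup>* \<Longrightarrow> s \<in> cells X \<Longrightarrow> t \<in> cells X"
  by (induction rule: rtrancl_induct) (auto dest: incident_cells)

lemma finite_cells: "multigraph X \<Longrightarrow> finite (cells X)"
  by (auto simp: cells_def multigraph_def)

lemma component_cells_self: "s \<in> cells X \<Longrightarrow> s \<in> component_cells X s"
  by (auto simp: component_cells_def)

lemma component_cells_sub: "component_cells X s \<subseteq> cells X"
  by (auto simp: component_cells_def)

lemma component_cells_eq: "t \<in> component_cells X s \<Longrightarrow> component_cells X t = component_cells X s"
  unfolding component_cells_def using reach_sym rtrancl_trans by (smt (verit) Collect_cong mem_Collect_eq)

lemma component_cells_sym: "t \<in> component_cells X s \<Longrightarrow> s \<in> cells X \<Longrightarrow> s \<in> component_cells X t"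
  using component_cells_eq component_cells_self by blast

lemma component_cells_incident:
  "t \<in> component_cells X s \<Longrightarrow> (t, u) \<in> incident X \<Longrightarrow> u \<in> component_cells X s"
  unfolding component_cells_def
  by (auto dest: incident_cells intro: rtrancl_into_rtrancl)

lemma component_cells_mono:
  assumes "A \<subseteq> B"
  shows "component_cells (restrict_cells X A) s \<subseteq> component_cells (restrict_cells X B) s"
proof -
  have "incident (restrict_cells X A) \<subseteq> incident (restrict_cells X B)"
    using assms by (auto simp: incident_restrict)
  then show ?thesis
    using assms rtrancl_mono unfolding component_cells_def cells_restrict by blast
qed

lemma cells_component [simp]: "cells (component X s) = component_cells X s"
  using component_cells_sub by (auto simp: component_def)

lemma component_cells_least:
  assumes "s \<in> C" and "\<And>t u. t \<in> C \<Longrightarrow> (t, u) \<in> incident X \<Longrightarrow> u \<in> C"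
  shows "component_cells X s \<subseteq> C"
proof
  fix t assume "t \<in> component_cells X s"
  then have "(s, t) \<in> (incident X)\<^sup>*" by (simp add: component_cells_def)
  then show "t \<in> C" by (induction rule: rtrancl_induct) (use assms in auto)
qed

text \<open>Every chain that links cells of \<open>C\<close> runs inside \<open>C\<close>, hence
  inside \<open>B\<close>, and passing to fewer cells creates no links. This is the tool for
  comparing components at different levels.\<close>

lemma component_shrink:
  assumes "C = component_cells (restrict_cells X A) s" "C \<subseteq> B" "B \<subseteq> A" "u \<in> C"
  shows "component_cells (restrict_cells X B) u = C"
proof
  have C: "C = component_cells (restrict_cells X A) u"
    using assms component_cells_eq by metis
  then show "component_cells (restrict_cells X B) u \<subseteq> C"
    using assms(3) component_cells_mono by metis
  show "C \<subseteq> component_cells (restrict_cells X B) u"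
  proof
    fix t assume "t \<in> C"
    then have "(u, t) \<in> (incident (restrict_cells X A))\<^sup>*"
      unfolding C component_cells_def by simp
    then show "t \<in> component_cells (restrict_cells X B) u"
    proof (induction rule: rtrancl_induct)
      case base
      have "u \<in> cells (restrict_cells X B)"
        using assms component_cells_sub[of "restrict_cells X A" s] by auto
      then show ?case by (rule component_cells_self)
    next
      case (step y z)
      have "z \<in> C" using step C component_cells_incident
        by (metis \<open>component_cells (restrict_cells X B) u \<subseteq> C\<close> subsetD)
      moreover have "y \<in> C" using step(3) \<open>component_cells (restrict_cells X B) u \<subseteq> C\<close> by blast
      ultimately have "(y, z) \<in> incident (restrict_cells X B)"
        using step(2) assms(2) by (auto simp: incident_restrict)
      then show ?case using step component_cells_incident by metis
    qed
  qed
qed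

lemma component_cells_component:
  assumes "t \<in> component_cells X s"
  shows "component_cells (component X s) t = component_cells X s"
proof -
  show ?thesis
    unfolding component_def
    using assms component_shrink[OF refl, of X UNIV s "component_cells X s" t] by simp
qed

text \<open>As \<open>S\<close> is closed under faces, no edge of the component loses an end. For
  sublevel sets this closedness is the monotonicity of \<open>f\<close> along faces.\<close>

lemma subcomplex_component:
  assumes "multigraph X" and "\<And>s t. proper_face X s t \<Longrightarrow> t \<in> S \<Longrightarrow> s \<in> S"
  shows "subcomplex (component (restrict_cells X S) s) X"
  unfolding subcomplex_def
proof (intro conjI)
  let ?K = "component (restrict_cells X S) s"
  have "ends X e \<subseteq> verts ?K" if "e \<in> edges ?K" for e
  proof
    fix v assume v: "v \<in> ends X e"
    have e: "Inr e \<in> component_cells (restrict_cells X S) s" "e \<in> edges X" "Inr e \<in> S"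
      using that by (auto simp: component_def)
    then have "proper_face X (Inl v) (Inr e)"
      using v assms(1) by (auto simp: proper_face_def multigraph_def)
    then have "(Inr e, Inl v) \<in> incident (restrict_cells X S)"
      using assms(2)[of "Inl v" "Inr e"] e by (auto simp: incident_restrict incident_def proper_face_restrict)
    then have "Inl v \<in> component_cells (restrict_cells X S) s"
      using e component_cells_incident by metis
    then show "v \<in> verts ?K" by (metis cells_component Inl_in_cells)
  qed
  then show "multigraph ?K"
    using assms(1) by (auto simp: multigraph_def component_def)
qed (auto simp: component_def)

lemma connected_component:
  "s \<in> cells X \<Longrightarrow> connected_graph (component X s)"
  using component_cells_self[of s X] component_cells_component[of _ X s]
  unfolding connected_graph_def cells_component
  by (auto simp: component_cells_def[of "component X s"])

lemma connected_component_cells: "connected_graph X \<Longrightarrow> s \<in> cells X \<Longrightarrow> component_cells X s = cells X"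
  by (auto simp: connected_graph_def component_cells_def)

lemma multigraph_ends:
  assumes "multigraph X" "e \<in> edges X"
  obtains v w where "ends X e = {v, w}" "v \<in> verts X" "w \<in> verts X"
proof -
  have "ends X e \<subseteq> verts X" "card (ends X e) = 1 \<or> card (ends X e) = 2"
    using assms by (auto simp: multigraph_def)
  then show ?thesis using that by (auto simp: card_1_singleton_iff card_2_iff)
qed

section \<open>Circles\<close>

text \<open>Only the vertices are listed: with parallel edges the edges are not determined by them,
  and they are picked when a path is closed to a circle.\<close>

definition vertex_path :: "('v, 'e) multigraph \<Rightarrow> 'v \<Rightarrow> 'v \<Rightarrow> 'v list \<Rightarrow> bool" where
  "vertex_path X v w p \<longleftrightarrow> p \<noteq> [] \<and> hd p = v \<and> last p = w \<and> distinct p \<and> set p \<subseteq> verts X \<and>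
     (\<forall>i. Suc i < length p \<longrightarrow> (\<exists>e\<in>edges X. ends X e = {p ! i, p ! Suc i}))"

text \<open>If the new vertex already lies on the path, the path is cut off there instead of being
  prolonged, so simplicity never has to be restored.\<close>

lemma vertex_path_extend:
  assumes p: "vertex_path X v w p" and e: "e \<in> edges X" "ends X e = {w, u}" and u: "u \<in> verts X"
  shows "\<exists>q. vertex_path X v u q"
proof (cases "u \<in> set p")
  case True
  then obtain j where j: "j < length p" "p ! j = u" by (auto simp: in_set_conv_nth)
  define q where "q = take (Suc j) p"
  have "length q = Suc j" and nth: "\<And>i. i < Suc j \<Longrightarrow> q ! i = p ! i" using j by (auto simp: q_def)
  moreover from this have "q \<noteq> []" by auto
  ultimately have "q \<noteq> []" "hd q = v" "last q = u"
    using p j by (auto simp: vertex_path_def hd_conv_nth last_conv_nth)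
  moreover have "distinct q" "set q \<subseteq> verts X"
    using p unfolding q_def vertex_path_def by (auto dest: in_set_takeD)
  moreover have "\<exists>e\<in>edges X. ends X e = {q ! i, q ! Suc i}" if "Suc i < length q" for i
    using p j that nth \<open>length q = Suc j\<close> by (auto simp: vertex_path_def)
  ultimately have "vertex_path X v u q" by (simp add: vertex_path_def)
  then show ?thesis by blast
next
  case False
  have "vertex_path X v u (p @ [u])"
    unfolding vertex_path_def
  proof (intro conjI allI impI)
    fix i assume i: "Suc i < length (p @ [u])"
    show "\<exists>e\<in>edges X. ends X e = {(p @ [u]) ! i, (p @ [u]) ! Suc i}"
    proof (cases "Suc i < length p")
      case True
      then show ?thesis using p by (auto simp: vertex_path_def nth_append)
    next
      case False
      then have "Suc i = length p" using i by simp
      then have "i = length p - 1" by simp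
      then have "p ! i = w" "(p @ [u]) ! Suc i = u"
        using p \<open>Suc i = length p\<close> by (auto simp: vertex_path_def last_conv_nth)
      then show ?thesis using e \<open>Suc i = length p\<close> by (auto simp: nth_append)
    qed
  qed (use p False u in \<open>auto simp: vertex_path_def\<close>)
  then show ?thesis by blast
qed

lemma vertex_path_exists:
  assumes X: "multigraph X" and "v \<in> verts X" and "(Inl v, Inl w) \<in> (incident X)\<^sup>*"
  shows "\<exists>p. vertex_path X v w p"
proof -
  \<comment> \<open>Chains alternate between vertices and edges, so the induction claim covers edges
    too: once an edge is reached, all its ends are reached by simple paths.\<close>
  have "(\<forall>w. t = Inl w \<longrightarrow> (\<exists>p. vertex_path X v w p)) \<and>
        (\<forall>e w. t = Inr e \<longrightarrow> w \<in> ends X e \<longrightarrow> (\<exists>p. vertex_path X v w p))"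
    if "(Inl v, t) \<in> (incident X)\<^sup>*" for t
    using that
  proof (induction rule: rtrancl_induct)
    case base
    have "vertex_path X v v [v]" using assms by (simp add: vertex_path_def)
    then show ?case by blast
  next
    case (step y z)
    show ?case
    proof (cases z)
      case (Inl w)
      then show ?thesis using step by (auto simp: incident_def proper_face_def)
    next
      case (Inr e)
      then obtain u where u: "y = Inl u" "u \<in> ends X e" "e \<in> edges X"
        using step by (auto simp: incident_def proper_face_def)
      then obtain p where p: "vertex_path X v u p" using step by blast
      have "\<exists>q. vertex_path X v w q" if w: "w \<in> ends X e" for w
      proof (cases "w = u")
        case True
        then show ?thesis using p by blast
      next
        case False
        obtain a b where ab: "ends X e = {a, b}" "a \<in> verts X" "b \<in> verts X"
          using multigraph_ends[OF X u(3)] .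
        then have "ends X e = {u, w}" using u w False by auto
        moreover have "w \<in> verts X" using ab w by auto
        ultimately show ?thesis using vertex_path_extend[OF p u(3)] by blast
      qed
      then show ?thesis using Inr by blast
    qed
  qed
  then show ?thesis using assms(3) by blast
qed

text \<open>A simple path in \<open>Y\<close> between the ends of \<open>e\<close> is closed by
  \<open>e\<close>, which lies outside \<open>Y\<close>. For \<open>v = w\<close> the path is a
  single vertex and the circle is the self-loop.\<close>

lemma circle_through:
  assumes Y: "subcomplex Y X" and X: "multigraph X" and e: "e \<in> edges X" "ends X e = {v, w}"
    and "e \<notin> edges Y" "v \<in> verts Y" and vw: "Inl w \<in> component_cells Y (Inl v)"
  shows "\<exists>D. subcomplex D X \<and> circle_graph D \<and> e \<in> edges D \<and> cells D \<subseteq> insert (Inr e) (cells Y)"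
proof -
  obtain p where "vertex_path Y v w p"
    using vertex_path_exists[of Y v w] assms by (auto simp: subcomplex_def component_cells_def)
  then have p: "p \<noteq> []" "hd p = v" "last p = w" "distinct p" "set p \<subseteq> verts Y"
    and pe: "\<forall>i. Suc i < length p \<longrightarrow> (\<exists>d. d \<in> edges Y \<and> ends Y d = {p ! i, p ! Suc i})"
    by (auto simp: vertex_path_def)
  define n where "n = length p"
  have n: "n \<ge> 1" "p ! 0 = v" "p ! (n - 1) = w" using p
    by (auto simp: n_def hd_conv_nth last_conv_nth Suc_le_eq)
  from pe obtain d where d: "\<And>i. Suc i < n \<Longrightarrow> d i \<in> edges Y \<and> ends Y (d i) = {p ! i, p ! Suc i}"
    unfolding n_def by metis
  have endsY: "ends Y c = ends X c" if "c \<in> edges Y" for c using Y that by (auto simp: subcomplex_def)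
  define D where "D = \<lparr>verts = set p, edges = insert e (d ` {..<n - 1}), ends = ends X\<rparr>"
  \<comment> \<open>Cyclic enumeration of the edges: the last index \<open>n - 1\<close> goes to
    \<open>e\<close>, which leads from the final vertex \<open>w\<close> of the path back to
    \<open>v\<close>.\<close>
  define h where "h i = (if Suc i < n then d i else e)" for i
  have DX: "d i \<in> edges Y \<and> d i \<in> edges X \<and> d i \<noteq> e \<and> ends X (d i) = {p ! i, p ! Suc i}"
    if "Suc i < n" for i
    using d[OF that] endsY Y assms(5) by (auto simp: subcomplex_def)
  have ends_h: "ends D (h i) = {p ! i, p ! (Suc i mod n)}" if "i < n" for i
  proof (cases "Suc i < n")
    case True
    then show ?thesis using DX[of i] by (simp add: D_def h_def)
  next
    case False
    then have "i = n - 1" "Suc i = n" using that by auto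
    then show ?thesis using e n by (simp add: D_def h_def insert_commute)
  qed
  have inj_p: "p ! i = p ! j \<longleftrightarrow> i = j" if "i < n" "j < n" for i j
    using p(4) that by (simp add: n_def nth_eq_iff_index_eq)
  have "inj_on h {..<n}"
  proof (rule inj_onI)
    fix i j assume ij: "i \<in> {..<n}" "j \<in> {..<n}" "h i = h j"
    consider "Suc i < n" "Suc j < n" | "Suc i = n" "Suc j = n" | "Suc i < n" "Suc j = n" | "Suc i = n" "Suc j < n"
      using ij by fastforce
    then show "i = j"
    proof cases
      case 1
      \<comment> \<open>In a list without repetitions, an unordered pair of neighbours fixes its
        position.\<close>
      then have "{p ! i, p ! Suc i} = {p ! j, p ! Suc j}" using ij DX[of i] DX[of j] by (simp add: h_def)
      then show ?thesis using inj_p 1 by (auto simp: doubleton_eq_iff)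
    qed (use ij DX in \<open>force simp: h_def\<close>)+
  qed
  moreover have "h ` {..<n} = edges D"
  proof -
    have "{..<n} = insert (n - 1) {..<n - 1}" using n by auto
    then have "h ` {..<n} = insert (h (n - 1)) (h ` {..<n - 1})" by (metis image_insert)
    moreover have "h (n - 1) = e" by (auto simp: h_def)
    moreover have "h ` {..<n - 1} = d ` {..<n - 1}" by (rule image_cong) (auto simp: h_def)
    ultimately show ?thesis by (simp add: D_def)
  qed
  moreover have "(!) p ` {..<n} = verts D"
    by (auto simp: D_def n_def in_set_conv_nth)
  moreover have "inj_on ((!) p) {..<n}" using inj_p by (auto intro: inj_onI)
  ultimately have "circle_graph D" unfolding circle_graph_def using n ends_h
    by (intro exI[of _ n] exI[of _ "(!) p"] exI[of _ h]) auto
  moreover have "subcomplex D X"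
  proof -
    have "ends X c \<subseteq> set p" if c: "c \<in> edges D" for c
    proof -
      from c consider "c = e" | i where "c = d i" "Suc i < n" by (auto simp: D_def)
      then show ?thesis
      proof cases
        case 1 then show ?thesis using e p by auto
      next
        case 2 then show ?thesis using DX[of i] by (auto simp: n_def)
      qed
    qed
    moreover have "edges D \<subseteq> edges X" using DX e by (auto simp: D_def)
    moreover have "set p \<subseteq> verts X" using p Y by (auto simp: subcomplex_def)
    ultimately show ?thesis using X by (auto simp: subcomplex_def multigraph_def D_def)
  qed
  moreover have "cells D \<subseteq> insert (Inr e) (cells Y)"
    using p DX by (auto simp: D_def cells_def)
  moreover have "e \<in> edges D" by (simp add: D_def)
  ultimately show ?thesis by blast
qed

text \<open>The remaining \<open>n - 1\<close> edges of the circle lead from one end of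
  \<open>e\<close> around to the other.\<close>

lemma circle_remove_edge:
  assumes D: "circle_graph D" and e: "e \<in> edges D" "ends D e = {v, w}"
  shows "(Inl v, Inl w) \<in> (incident (restrict_cells D (- {Inr e})))\<^sup>*"
proof -
  let ?R = "incident (restrict_cells D (- {Inr e}))"
  obtain n x h where n: "(n::nat) \<ge> 1" and inj: "inj_on x {..<n}" "inj_on h {..<n}"
    and V: "verts D = x ` {..<n}" and E: "edges D = h ` {..<n}"
    and ends: "\<And>i. i < n \<Longrightarrow> ends D (h i) = {x i, x (Suc i mod n)}"
    using D unfolding circle_graph_def by (elim exE conjE) (rule that, auto)
  obtain j where j: "j < n" "e = h j" using e E by auto
  have step: "(Inl (x i), Inl (x (Suc i mod n))) \<in> ?R\<^sup>*" if i: "i < n" "i \<noteq> j" for i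
  proof -
    have "h i \<noteq> e" using inj j i by (auto simp: inj_on_def)
    have "Suc i mod n < n" using n by auto
    then have "h i \<in> edges D" "x i \<in> verts D" "x (Suc i mod n) \<in> verts D" using i V E by auto
    then have "(Inl (x i), Inr (h i)) \<in> ?R" "(Inr (h i), Inl (x (Suc i mod n))) \<in> ?R"
      using ends[OF i(1)] \<open>h i \<noteq> e\<close>
      by (simp_all add: incident_restrict incident_def proper_face_def)
    then show ?thesis by (meson converse_rtrancl_into_rtrancl r_into_rtrancl)
  qed
  \<comment> \<open>The walk starts just behind edge \<open>j\<close> and returns to index
    \<open>j\<close> only after \<open>n - 1\<close> steps, so with \<open>k < n\<close> edge
    \<open>j\<close> itself is never traversed.\<close>
  have "(Inl (x (Suc j mod n)), Inl (x ((Suc j + k) mod n))) \<in> ?R\<^sup>*" if "k < n" for k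
    using that
  proof (induction k)
    case 0 show ?case by simp
  next
    case (Suc k)
    let ?i = "(Suc j + k) mod n"
    have "?i \<noteq> j"
    proof
      assume eq: "?i = j"
      show False
      proof (cases "Suc j + k < n")
        case False
        then have "?i = Suc j + k - n" using j Suc.prems by (simp add: mod_if)
        then show False using eq False Suc.prems j by linarith
      qed (use eq in simp)
    qed
    then have "(Inl (x ?i), Inl (x (Suc ?i mod n))) \<in> ?R\<^sup>*" using step n by auto
    moreover have "Suc ?i mod n = (Suc j + Suc k) mod n" by (simp add: mod_Suc_eq)
    ultimately show ?case using Suc by (metis Suc_lessD rtrancl_trans)
  qed
  from this[of "n - 1"] have "(Inl (x (Suc j mod n)), Inl (x j)) \<in> ?R\<^sup>*"
    using n j by simp
  moreover have "{v, w} = {x j, x (Suc j mod n)}" using ends e j by metis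
  ultimately show ?thesis using reach_sym by (metis doubleton_eq_iff)
qed

section \<open>The family of sublevel components\<close>

lemma cells_sublevel: "cells (sublevel X f b) = {s \<in> cells X. f s \<le> b}"
  and cells_sublevel_less: "cells (sublevel_less X f b) = {s \<in> cells X. f s < b}"
  by (auto simp: sublevel_def sublevel_less_def)

lemma incident_sublevel:
  "(s, t) \<in> incident (sublevel X f b) \<longleftrightarrow> (s, t) \<in> incident X \<and> f s \<le> b \<and> f t \<le> b"
  and incident_sublevel_less:
  "(s, t) \<in> incident (sublevel_less X f b) \<longleftrightarrow> (s, t) \<in> incident X \<and> f s < b \<and> f t < b"
  by (simp_all add: sublevel_def sublevel_less_def incident_restrict)

lemma component_sublevel_mono:
  "a \<le> b \<Longrightarrow> component_cells (sublevel X f a) s \<subseteq> component_cells (sublevel X f b) s"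
  unfolding sublevel_def by (rule component_cells_mono) auto

lemma incident_Inr:
  "(Inr e, u) \<in> incident X \<longleftrightarrow> e \<in> edges X \<and> (\<exists>v\<in>ends X e. v \<in> verts X \<and> u = Inl v)"
  by (auto simp: incident_def proper_face_def)

text \<open>The component that \<open>s\<close> completes at the moment it enters. In the induced
  tree these are the cells whose nodes lie in the subtree of the node of \<open>s\<close>.\<close>

definition lower :: "('v, 'e) multigraph \<Rightarrow> ('v + 'e \<Rightarrow> real) \<Rightarrow> 'v + 'e \<Rightarrow> ('v + 'e) set" where
  "lower X f s = component_cells (sublevel X f (f s)) s"

definition merge_family :: "('v, 'e) multigraph \<Rightarrow> ('v + 'e \<Rightarrow> real) \<Rightarrow> real set set" where
  "merge_family X f = (\<lambda>s. f ` lower X f s) ` cells X"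

lemma lower_self: "s \<in> cells X \<Longrightarrow> s \<in> lower X f s"
  unfolding lower_def by (rule component_cells_self) (simp add: cells_sublevel)

lemma lower_sub: "lower X f s \<subseteq> {t \<in> cells X. f t \<le> f s}"
  unfolding lower_def using component_cells_sub cells_sublevel by metis

lemma Union_merge_family: "\<Union> (merge_family X f) = f ` cells X"
  using lower_self lower_sub by (fastforce simp: merge_family_def)

text \<open>Lowering the level to the largest value in the component removes none of its cells.
  Hence the family indexed by single cells records the components of all levels.\<close>

lemma lower_top:
  assumes C: "C = component_cells (sublevel X f b) t" and s: "s \<in> C" and "\<And>u. u \<in> C \<Longrightarrow> f u \<le> f s"
  shows "lower X f s = C"
proof -
  have "s \<in> cells (sublevel X f b)" using C s component_cells_sub by blast
  then have "f s \<le> b" by (simp add: cells_sublevel)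
  then show ?thesis unfolding lower_def sublevel_def
    using C s assms(3) by (intro component_shrink[of _ _ "{s. f s \<le> b}" t]) (auto simp: sublevel_def)
qed

text \<open>Criticality of all cells is injectivity, and injectivity makes the bound on fibres, the
  condition on equal values and the one on self-loops automatic.\<close>

lemma critical_dMf_iff:
  "critical_dMf X f \<longleftrightarrow>
     inj_on f (cells X) \<and> (\<forall>s t. proper_face X s t \<longrightarrow> f s \<le> f t)"
proof
  assume c: "critical_dMf X f"
  have "proper_face X s t \<Longrightarrow> s \<in> cells X \<and> t \<in> cells X" for s t
    by (auto simp: proper_face_def)
  then show "inj_on f (cells X) \<and> (\<forall>s t. proper_face X s t \<longrightarrow> f s \<le> f t)"
    using c unfolding critical_dMf_def dMf_def critical_def inj_on_def by metis
next
  assume i: "inj_on f (cells X) \<and> (\<forall>s t. proper_face X s t \<longrightarrow> f s \<le> f t)"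
  have "card {s \<in> cells X. f s = z} \<le> 2" for z
  proof (cases "\<exists>s\<in>cells X. f s = z")
    case True
    then obtain s where "s \<in> cells X" "f s = z" by blast
    then have "{s \<in> cells X. f s = z} = {s}" using i by (auto simp: inj_on_def)
    then show ?thesis by simp
  next
    case False
    then have "{s \<in> cells X. f s = z} = {}" by blast
    then show ?thesis by (metis card.empty le0)
  qed
  moreover have "critical X f s" if "s \<in> cells X" for s
    using i that unfolding critical_def inj_on_def by blast
  moreover have "s = t" if "s \<in> cells X" "t \<in> cells X" "f s = f t" for s t
    using i that unfolding inj_on_def by blast
  ultimately show "critical_dMf X f"
    using i unfolding critical_dMf_def dMf_def by simp
qed

section \<open>Sublevel components of a critical discrete Morse function\<close>

locale morse_graph =
  fixes X :: "('v, 'e) multigraph" and f :: "'v + 'e \<Rightarrow> real"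
  assumes graph: "multigraph X" and morse: "critical_dMf X f"
begin

lemma inj: "inj_on f (cells X)"
  using morse by (simp add: critical_dMf_iff)

lemma inj_eq: "s \<in> cells X \<Longrightarrow> t \<in> cells X \<Longrightarrow> f s = f t \<longleftrightarrow> s = t"
  using inj by (auto simp: inj_on_def)

lemma critical_iff: "critical X f s \<longleftrightarrow> s \<in> cells X"
  using inj_eq by (auto simp: critical_def)

lemma face_less: "proper_face X s t \<Longrightarrow> f s < f t"
proof -
  assume p: "proper_face X s t"
  then have "f s \<noteq> f t" using inj_eq by (auto simp: proper_face_def)
  then show ?thesis using p morse by (fastforce simp: critical_dMf_iff)
qed

lemma finite: "finite (cells X)"
  using graph by (rule finite_cells)

lemma ends_less: "e \<in> edges X \<Longrightarrow> v \<in> ends X e \<Longrightarrow> v \<in> verts X \<and> f (Inl v) < f (Inr e)"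
proof -
  assume a: "e \<in> edges X" "v \<in> ends X e"
  then have "v \<in> verts X" using graph by (auto simp: multigraph_def)
  then show ?thesis using a by (auto intro!: face_less simp: proper_face_def)
qed

text \<open>A finite complex leaves a gap in the values just below \<open>a\<close>. So strict
  sublevel complexes are ordinary ones, and facts about the latter carry over.\<close>

lemma sublevel_less_eq_sublevel:
  obtains b where "b < a" and "\<And>s. s \<in> cells X \<Longrightarrow> f s < a \<longleftrightarrow> f s \<le> b"
    and "sublevel_less X f a = sublevel X f b"
proof -
  \<comment> \<open>The extra element \<open>a - 1\<close> keeps the set nonempty when no cell has a
    value below \<open>a\<close>.\<close>
  define B where "B = insert (a - 1) {x \<in> f ` cells X. x < a}"
  have B: "finite B" "B \<noteq> {}" using finite by (auto simp: B_def)
  then have "Max B \<in> B" by (rule Max_in)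
  then have "Max B < a" by (auto simp: B_def)
  moreover have "f s \<le> Max B" if "s \<in> cells X" "f s < a" for s
    using that B by (auto simp: B_def intro!: Max_ge)
  ultimately have b: "Max B < a" "\<And>s. s \<in> cells X \<Longrightarrow> f s < a \<longleftrightarrow> f s \<le> Max B" by force+
  then have "sublevel_less X f a = sublevel X f (Max B)"
    unfolding sublevel_def sublevel_less_def by (intro restrict_cong) auto
  then show ?thesis using that b by blast
qed

lemma lower_vertex: "v \<in> verts X \<Longrightarrow> lower X f (Inl v) = {Inl v}"
proof
  assume v: "v \<in> verts X"
  show "lower X f (Inl v) \<subseteq> {Inl v}"
    unfolding lower_def
  proof (rule component_cells_least)
    fix t u assume "t \<in> {Inl v :: 'v + 'e}" "(t, u) \<in> incident (sublevel X f (f (Inl v)))"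
    then have "(Inl v, u) \<in> incident X" "f u \<le> f (Inl v)" by (auto simp: incident_sublevel)
    then have "proper_face X (Inl v) u" by (auto simp: incident_def proper_face_def)
    then show "u \<in> {Inl v}" using face_less \<open>f u \<le> f (Inl v)\<close> by fastforce
  qed simp
qed (simp add: lower_self)

text \<open>At its own level the edge is the only new cell, so it joins the strict components of its
  ends and touches nothing else. For a closing edge the two components coincide.\<close>

lemma lower_edge:
  fixes e defines "C \<equiv> \<lambda>v. component_cells (sublevel_less X f (f (Inr e))) (Inl v)"
  assumes e: "e \<in> edges X" "ends X e = {v, w}"
  shows "lower X f (Inr e) = insert (Inr e) (C v \<union> C w)"
proof
  let ?a = "f (Inr e)"
  have vw: "Inl v \<in> C v" "Inl w \<in> C w"
    unfolding C_def using ends_less[OF e(1)] e(2)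
    by (simp_all add: component_cells_self cells_sublevel_less)
  have sub: "C x \<subseteq> {t \<in> cells X. f t < ?a}" for x
    unfolding C_def using component_cells_sub cells_sublevel_less by metis
  \<comment> \<open>The edge is the only cell of value \<open>?a\<close>, so a step that does not
    lead to it stays strictly below \<open>?a\<close>.\<close>
  have nb: "u = Inr e \<or> u \<in> C x" if "t \<in> C x" "(t, u) \<in> incident (sublevel X f ?a)" for t u x
  proof (cases "u = Inr e")
    case False
    have tu: "(t, u) \<in> incident X" "f u \<le> ?a" using that by (auto simp: incident_sublevel)
    then have "u \<in> cells X" using incident_cells by metis
    then have "f u < ?a" using tu False e inj_eq[of u "Inr e"] by fastforce
    then have "(t, u) \<in> incident (sublevel_less X f ?a)"
      using sub[of x] that(1) tu by (auto simp: incident_sublevel_less)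
    then show ?thesis using that(1) component_cells_incident unfolding C_def by metis
  qed simp
  show "lower X f (Inr e) \<subseteq> insert (Inr e) (C v \<union> C w)"
    unfolding lower_def
  proof (rule component_cells_least)
    fix t u assume t: "t \<in> insert (Inr e) (C v \<union> C w)" and tu: "(t, u) \<in> incident (sublevel X f ?a)"
    show "u \<in> insert (Inr e) (C v \<union> C w)"
    proof (cases "t = Inr e")
      case True
      then have "(Inr e, u) \<in> incident X" using tu by (simp add: incident_sublevel)
      then have "u = Inl v \<or> u = Inl w" by (simp add: incident_Inr e) blast
      then show ?thesis using vw by auto
    next
      case False
      then show ?thesis using t tu nb by blast
    qed
  qed simp
  have "C x \<subseteq> lower X f (Inr e)" if x: "x \<in> ends X e" for x
  proof -
    have "C x \<subseteq> component_cells (sublevel X f ?a) (Inl x)"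
      unfolding C_def sublevel_def sublevel_less_def by (rule component_cells_mono) auto
    moreover have "(Inr e, Inl x) \<in> incident (sublevel X f ?a)"
      using x ends_less[OF e(1) x] e(1) by (simp only: incident_sublevel incident_Inr) auto
    then have "Inl x \<in> lower X f (Inr e)"
      using lower_self[of "Inr e"] e component_cells_incident unfolding lower_def by force
    then have "component_cells (sublevel X f ?a) (Inl x) = lower X f (Inr e)"
      unfolding lower_def by (rule component_cells_eq)
    ultimately show ?thesis by simp
  qed
  then show "insert (Inr e) (C v \<union> C w) \<subseteq> lower X f (Inr e)"
    using lower_self[of "Inr e"] e by auto
qed

text \<open>A component belongs to the family through its top cell, which gives one direction. For
  the other, a member of the family bounded by \<open>b\<close> consists of the values of cells that
  are linked inside level \<open>b\<close>.\<close>

lemma linked_iff_merge_family: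
  assumes "s \<in> cells X" "t \<in> cells X"
  shows "t \<in> component_cells (sublevel X f b) s \<longleftrightarrow>
    (\<exists>A\<in>merge_family X f. f s \<in> A \<and> f t \<in> A \<and> (\<forall>x\<in>A. x \<le> b))"
proof
  let ?C = "component_cells (sublevel X f b) s"
  assume t: "t \<in> ?C"
  have C: "?C \<subseteq> {u \<in> cells X. f u \<le> b}" using component_cells_sub cells_sublevel by metis
  have "s \<in> ?C"
    using t assms C component_cells_self cells_sublevel component_cells_def reach_sym reach_cells
    by (smt (verit) mem_Collect_eq component_cells_eq)
  have "finite ?C" "?C \<noteq> {}" using C t finite finite_subset by fastforce+
  then obtain u where u: "u \<in> ?C" "\<And>r. r \<in> ?C \<Longrightarrow> f r \<le> f u"
    using finite_imageI[of ?C f] Max_in[of "f ` ?C"] Max_ge[of "f ` ?C"] by fastforce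
  then have "lower X f u = ?C" by (intro lower_top[OF refl]) auto
  then show "\<exists>A\<in>merge_family X f. f s \<in> A \<and> f t \<in> A \<and> (\<forall>x\<in>A. x \<le> b)"
    using u t \<open>s \<in> ?C\<close> C by (intro bexI[of _ "f ` ?C"]) (auto simp: merge_family_def)
next
  assume "\<exists>A\<in>merge_family X f. f s \<in> A \<and> f t \<in> A \<and> (\<forall>x\<in>A. x \<le> b)"
  then obtain u where u: "u \<in> cells X" "f s \<in> f ` lower X f u" "f t \<in> f ` lower X f u"
      "\<forall>x\<in>f ` lower X f u. x \<le> b"
    unfolding merge_family_def by blast
  then have "s \<in> lower X f u" "t \<in> lower X f u" "f u \<le> b"
    using assms lower_sub[of X f u] lower_self[of u X f] inj_eq by (auto simp: subset_iff)
  then have "s \<in> component_cells (sublevel X f b) u" "t \<in> component_cells (sublevel X f b) u"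
    unfolding lower_def using component_sublevel_mono by blast+
  then show "t \<in> component_cells (sublevel X f b) s" using component_cells_eq by metis
qed

text \<open>A circle through \<open>e\<close> links the ends of \<open>e\<close> by its other cells,
  whose values are strictly smaller by injectivity; conversely a path below closes up with
  \<open>e\<close>. Closing edges are thereby recognized from components alone.\<close>

lemma closing_iff:
  assumes e: "e \<in> edges X" "ends X e = {v, w}"
  shows "closing X f e \<longleftrightarrow>
    Inl w \<in> component_cells (sublevel_less X f (f (Inr e))) (Inl v)"
proof
  let ?Y = "sublevel_less X f (f (Inr e))"
  assume "closing X f e"
  then obtain D where D: "subcomplex D X" "circle_graph D" "e \<in> edges D"
    and max: "\<And>s. s \<in> cells D \<Longrightarrow> f s \<le> f (Inr e)" by (auto simp: closing_def)
  have "ends D e = {v, w}" using D e by (auto simp: subcomplex_def)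
  then have "(Inl v, Inl w) \<in> (incident (restrict_cells D (- {Inr e})))\<^sup>*"
    using circle_remove_edge D by metis
  moreover have "incident (restrict_cells D (- {Inr e})) \<subseteq> incident ?Y"
  proof (rule subrelI)
    fix s t assume "(s, t) \<in> incident (restrict_cells D (- {Inr e}))"
    then have st: "(s, t) \<in> incident D" "s \<noteq> Inr e" "t \<noteq> Inr e" by (auto simp: incident_restrict)
    have DX: "cells D \<subseteq> cells X" using D by (auto simp: subcomplex_def cells_def)
    have "f r < f (Inr e)" if "r \<in> cells D" "r \<noteq> Inr e" for r
      using max that DX inj_eq[of r "Inr e"] e by fastforce
    then have "f s < f (Inr e)" "f t < f (Inr e)" using st incident_cells by metis+
    moreover have "(s, t) \<in> incident X"
      using st(1) D(1) by (auto simp: incident_def proper_face_def subcomplex_def)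
    ultimately show "(s, t) \<in> incident ?Y" by (simp add: incident_sublevel_less)
  qed
  ultimately have "(Inl v, Inl w) \<in> (incident ?Y)\<^sup>*" using rtrancl_mono by blast
  then show "Inl w \<in> component_cells ?Y (Inl v)"
    using ends_less e by (auto simp: component_cells_def cells_sublevel_less)
next
  let ?Y = "sublevel_less X f (f (Inr e))"
  let ?K = "component ?Y (Inl v)"
  assume w: "Inl w \<in> component_cells ?Y (Inl v)"
  have K: "subcomplex ?K X" unfolding sublevel_less_def
    by (rule subcomplex_component[OF graph]) (use face_less in force)
  have v: "Inl v \<in> component_cells ?Y (Inl v)"
    using ends_less e by (intro component_cells_self) (auto simp: cells_sublevel_less)
  have sub: "cells ?K \<subseteq> {s \<in> cells X. f s < f (Inr e)}"
    using component_cells_sub[of ?Y] by (simp add: cells_sublevel_less)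
  obtain D where "subcomplex D X" "circle_graph D" "e \<in> edges D" "cells D \<subseteq> insert (Inr e) (cells ?K)"
  proof (rule exE[OF circle_through[OF K graph e]])
    show "e \<notin> edges ?K" using sub by (auto simp flip: Inr_in_cells)
    show "v \<in> verts ?K" using v by (metis Inl_in_cells cells_component)
    show "Inl w \<in> component_cells ?K (Inl v)" using w v component_cells_component by metis
  qed (use that in blast)
  then show "closing X f e" unfolding closing_def critical_iff using sub e by fastforce
qed

text \<open>The right-hand side is respected by component preserving bijections, although these move
  the ends of edges. Both \<open>s\<close> and the representatives \<open>v\<close>,
  \<open>w\<close> are arbitrary cells, since the image of an edge or a vertex under such a
  bijection is not known beforehand to be of the same kind.\<close>

lemma merges_iff:
  fixes s defines "Y \<equiv> sublevel_less X f (f s)"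
  assumes s: "s \<in> cells X" and v: "v \<in> cells Y" and w: "w \<in> cells Y"
  shows "merges X s (component Y v) (component Y w) \<longleftrightarrow>
    component_cells Y v \<noteq> component_cells Y w \<and> v \<in> lower X f s \<and> w \<in> lower X f s"
proof
  assume "merges X s (component Y v) (component Y w)"
  then obtain e x y where e: "component_cells Y v \<noteq> component_cells Y w" "e \<in> edges X" "s = Inr e"
    "ends X e = {x, y}" "Inl x \<in> component_cells Y v" "Inl y \<in> component_cells Y w"
    unfolding merges_def cells_component by (metis Inl_in_cells cells_component)
  then have "component_cells Y (Inl x) = component_cells Y v" "component_cells Y (Inl y) = component_cells Y w"
    using component_cells_eq by metis+
  then show "component_cells Y v \<noteq> component_cells Y w \<and> v \<in> lower X f s \<and> w \<in> lower X f s"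
    using lower_edge[of e x y] e component_cells_self[OF v] component_cells_self[OF w]
    unfolding Y_def by auto
next
  assume a: "component_cells Y v \<noteq> component_cells Y w \<and> v \<in> lower X f s \<and> w \<in> lower X f s"
  \<comment> \<open>Thus \<open>lower X f s\<close> contains a cell besides \<open>s\<close>, which
    is impossible for a vertex.\<close>
  have vw: "v \<noteq> s" "w \<noteq> s" using v w by (auto simp: Y_def cells_sublevel_less)
  then obtain e where e: "s = Inr e" "e \<in> edges X"
    using s a lower_vertex by (cases s) auto
  obtain x y where xy: "ends X e = {x, y}" using multigraph_ends[OF graph e(2)] .
  have "u \<in> component_cells Y (Inl x) \<or> u \<in> component_cells Y (Inl y)"
    if "u \<in> lower X f s" "u \<noteq> s" for u
    using lower_edge[OF e(2) xy] that e unfolding Y_def by auto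
  moreover have cls: "component_cells Y u = component_cells Y r \<and> r \<in> component_cells Y u"
    if "u \<in> component_cells Y r" "r \<in> cells Y" for u r
    using that component_cells_eq component_cells_self by metis
  moreover have "Inl x \<in> cells Y" "Inl y \<in> cells Y"
    using ends_less[OF e(2)] xy e by (auto simp: Y_def cells_sublevel_less)
  ultimately obtain x' y' where x': "x' \<in> {x, y}" "Inl x' \<in> component_cells Y v"
    and y': "y' \<in> {x, y}" "Inl y' \<in> component_cells Y w"
    using a vw by (metis insertI1 insertI2)
  then have "component_cells Y (Inl x') = component_cells Y v" "component_cells Y (Inl y') = component_cells Y w"
    using component_cells_eq by metis+
  \<comment> \<open>The components of \<open>x'\<close> and \<open>y'\<close> differ, so these are
    two different ends and exhaust the ends of the edge.\<close>
  then have "{x', y'} = {x, y}" using x'(1) y'(1) a by auto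
  then show "merges X s (component Y v) (component Y w)"
    unfolding merges_def using e a xy x' y'
    by (metis Inl_in_cells cells_component)
qed

lemma closes_circle_within_iff:
  fixes s defines "Y \<equiv> sublevel_less X f (f s)"
  assumes s: "s \<in> cells X" and v: "v \<in> cells Y"
  shows "closes_circle_within X s (component Y v) \<longleftrightarrow>
    v \<in> lower X f s \<and> lower X f s - {s} \<subseteq> component_cells Y v"
proof
  assume "closes_circle_within X s (component Y v)"
  then obtain e D where e: "e \<in> edges X" "s = Inr e" and D: "subcomplex D X" "e \<in> edges D"
    "cells D \<subseteq> insert s (cells (component Y v))"
    by (auto simp: closes_circle_within_def)
  obtain x y where xy: "ends X e = {x, y}" using multigraph_ends[OF graph e(1)] .
  then have "Inl x \<in> cells D" "Inl y \<in> cells D"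
    using D unfolding subcomplex_def multigraph_def by auto
  then have "Inl x \<in> component_cells Y v" "Inl y \<in> component_cells Y v"
    using D(3) e(2) unfolding cells_component by blast+
  then have "component_cells Y (Inl x) = component_cells Y v" "component_cells Y (Inl y) = component_cells Y v"
    using component_cells_eq by metis+
  then show "v \<in> lower X f s \<and> lower X f s - {s} \<subseteq> component_cells Y v"
    using lower_edge[OF e(1) xy] e component_cells_self[OF v] unfolding Y_def by auto
next
  assume a: "v \<in> lower X f s \<and> lower X f s - {s} \<subseteq> component_cells Y v"
  let ?K = "component Y v"
  have "v \<noteq> s" using v by (auto simp: Y_def cells_sublevel_less)
  then obtain e where e: "s = Inr e" "e \<in> edges X"
    using s a lower_vertex by (cases s) auto
  obtain x y where xy: "ends X e = {x, y}" using multigraph_ends[OF graph e(2)] .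
  have "Inl x \<in> cells Y" "Inl y \<in> cells Y"
    using ends_less[OF e(2)] xy e by (auto simp: Y_def cells_sublevel_less)
  then have "Inl x \<in> lower X f s" "Inl y \<in> lower X f s"
    using lower_edge[OF e(2) xy] component_cells_self e unfolding Y_def by blast+
  then have in_K: "Inl x \<in> component_cells Y v" "Inl y \<in> component_cells Y v"
    using a e by auto
  have K: "subcomplex ?K X" unfolding Y_def sublevel_less_def
    by (rule subcomplex_component[OF graph]) (use face_less in force)
  have sub: "cells ?K \<subseteq> {r \<in> cells X. f r < f s}"
    using component_cells_sub[of Y] unfolding Y_def by (simp add: cells_sublevel_less)
  obtain D where "subcomplex D X" "circle_graph D" "e \<in> edges D" "cells D \<subseteq> insert (Inr e) (cells ?K)"
  proof (rule exE[OF circle_through[OF K graph e(2) xy]])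
    show "e \<notin> edges ?K" using sub e by (auto simp flip: Inr_in_cells)
    show "x \<in> verts ?K" using in_K by (metis Inl_in_cells cells_component)
    show "Inl y \<in> component_cells ?K (Inl x)" using in_K component_cells_component by metis
  qed (use that in blast)
  then show "closes_circle_within X s ?K" using e unfolding closes_circle_within_def by blast
qed

lemma morse_graph_component: "morse_graph (component (sublevel X f b) s) f"
proof
  let ?K = "component (sublevel X f b) s"
  have K: "subcomplex ?K X" unfolding sublevel_def
    by (rule subcomplex_component[OF graph]) (use face_less in force)
  then show "multigraph ?K" by (simp add: subcomplex_def)
  have "cells ?K \<subseteq> cells X" using K by (auto simp: subcomplex_def cells_def)
  moreover have "proper_face ?K r t \<Longrightarrow> proper_face X r t" for r t
    using K by (auto simp: subcomplex_def proper_face_def)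
  ultimately show "critical_dMf ?K f"
    using morse inj_on_subset unfolding critical_dMf_iff by metis
qed

end

section \<open>Bijections that preserve sublevel components\<close>

text \<open>Linkage at every level is preserved, incidence need not be: an end of an edge may be
  sent to another vertex of the corresponding component. For critical functions on connected graphs
  this turns out to be the same as being a CM equivalence of some level.\<close>

definition merge_preserving ::
  "('v, 'e) multigraph \<Rightarrow> ('v + 'e \<Rightarrow> real) \<Rightarrow>
   ('w, 'd) multigraph \<Rightarrow> ('w + 'd \<Rightarrow> real) \<Rightarrow> ('v + 'e \<Rightarrow> 'w + 'd) \<Rightarrow> bool" where
  "merge_preserving X f X' f' \<phi> \<longleftrightarrow>
     bij_betw \<phi> (cells X) (cells X') \<and> (\<forall>s\<in>cells X. f' (\<phi> s) = f s) \<and>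
     (\<forall>b. \<forall>s\<in>cells X. \<forall>t\<in>cells X. f s \<le> b \<longrightarrow> f t \<le> b \<longrightarrow>
        (t \<in> component_cells (sublevel X f b) s \<longleftrightarrow>
         \<phi> t \<in> component_cells (sublevel X' f' b) (\<phi> s)))"

lemma merge_preservingI:
  assumes "bij_betw \<phi> (cells X) (cells X')" and "\<And>s. s \<in> cells X \<Longrightarrow> f' (\<phi> s) = f s"
    and "\<And>b s t. s \<in> cells X \<Longrightarrow> t \<in> cells X \<Longrightarrow> f s \<le> b \<Longrightarrow> f t \<le> b \<Longrightarrow>
      t \<in> component_cells (sublevel X f b) s \<longleftrightarrow>
      \<phi> t \<in> component_cells (sublevel X' f' b) (\<phi> s)"
  shows "merge_preserving X f X' f' \<phi>"
  using assms by (simp add: merge_preserving_def)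

lemma component_cells_bij:
  assumes \<phi>: "bij_betw \<phi> (cells Y) (cells Y')"
    and inc: "\<And>s t. s \<in> cells Y \<Longrightarrow> t \<in> cells Y \<Longrightarrow> (s, t) \<in> incident Y \<longleftrightarrow> (\<phi> s, \<phi> t) \<in> incident Y'"
    and s: "s \<in> cells Y" and t: "t \<in> cells Y"
  shows "t \<in> component_cells Y s \<longleftrightarrow> \<phi> t \<in> component_cells Y' (\<phi> s)"
proof
  assume "t \<in> component_cells Y s"
  then have "(s, t) \<in> (incident Y)\<^sup>*" by (simp add: component_cells_def)
  then have "t \<in> cells Y \<and> \<phi> t \<in> component_cells Y' (\<phi> s)"
  proof (induction rule: rtrancl_induct)
    case base
    show ?case using s \<phi> by (simp add: bij_betwE component_cells_self)
  next
    case (step y z)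
    then have "z \<in> cells Y" using incident_cells by metis
    then show ?case using step inc component_cells_incident by metis
  qed
  then show "\<phi> t \<in> component_cells Y' (\<phi> s)" ..
next
  assume "\<phi> t \<in> component_cells Y' (\<phi> s)"
  then have "(\<phi> s, \<phi> t) \<in> (incident Y')\<^sup>*" by (simp add: component_cells_def)
  then have "\<exists>u\<in>cells Y. \<phi> u = \<phi> t \<and> u \<in> component_cells Y s"
  proof (induction rule: rtrancl_induct)
    case base
    show ?case using s component_cells_self by blast
  next
    case (step y z)
    then obtain u where u: "u \<in> cells Y" "\<phi> u = y" "u \<in> component_cells Y s" by blast
    have "z \<in> cells Y'" using step incident_cells by metis
    then obtain r where r: "r \<in> cells Y" "\<phi> r = z"
      using \<phi> by (metis bij_betw_imp_surj_on imageE)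
    then have "r \<in> component_cells Y s" using u inc step component_cells_incident by metis
    then show ?case using r by blast
  qed
  then show "t \<in> component_cells Y s" using \<phi> t by (metis bij_betw_def inj_on_eq_iff)
qed

lemma merge_preserving_comp:
  assumes 1: "merge_preserving X f Y g \<phi>" and 2: "merge_preserving Y g Z h \<psi>"
  shows "merge_preserving X f Z h (\<psi> \<circ> \<phi>)"
proof (rule merge_preservingI)
  have \<phi>: "bij_betw \<phi> (cells X) (cells Y)" and \<psi>: "bij_betw \<psi> (cells Y) (cells Z)"
    using assms by (simp_all add: merge_preserving_def)
  then show "bij_betw (\<psi> \<circ> \<phi>) (cells X) (cells Z)" by (rule bij_betw_trans)
  have Y: "\<phi> s \<in> cells Y" if "s \<in> cells X" for s using \<phi> that by (rule bij_betwE[rule_format])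
  then show "h ((\<psi> \<circ> \<phi>) s) = f s" if "s \<in> cells X" for s
    using that assms by (simp add: merge_preserving_def)
  show "t \<in> component_cells (sublevel X f b) s \<longleftrightarrow>
      (\<psi> \<circ> \<phi>) t \<in> component_cells (sublevel Z h b) ((\<psi> \<circ> \<phi>) s)"
    if "s \<in> cells X" "t \<in> cells X" "f s \<le> b" "f t \<le> b" for b s t
    using that assms Y by (simp add: merge_preserving_def)
qed

text \<open>Cancels \<open>\<xi>\<close> on the right. The form fits
  \<open>symmetry_equivalence\<close>, which gives \<open>\<phi>\<close> only through its composite
  with the action of a word.\<close>

lemma merge_preserving_factor:
  assumes 1: "merge_preserving X g Y h \<xi>" and 2: "merge_preserving X g Z k \<psi>"
    and \<phi>: "bij_betw \<phi> (cells Y) (cells Z)" and eq: "\<And>s. s \<in> cells X \<Longrightarrow> \<phi> (\<xi> s) = \<psi> s"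
  shows "merge_preserving Y h Z k \<phi>"
proof (rule merge_preservingI)
  have X: "\<exists>r\<in>cells X. s = \<xi> r" if "s \<in> cells Y" for s
    using that 1 by (auto simp: merge_preserving_def bij_betw_def)
  show "k (\<phi> s) = h s" if "s \<in> cells Y" for s
    using X[OF that] eq 1 2 by (auto simp: merge_preserving_def)
  show "t \<in> component_cells (sublevel Y h b) s \<longleftrightarrow>
      \<phi> t \<in> component_cells (sublevel Z k b) (\<phi> s)"
    if "s \<in> cells Y" "t \<in> cells Y" "h s \<le> b" "h t \<le> b" for b s t
  proof -
    obtain r u where "r \<in> cells X" "u \<in> cells X" "s = \<xi> r" "t = \<xi> u" using X \<open>s \<in> cells Y\<close> \<open>t \<in> cells Y\<close> by metis
    then show ?thesis using that 1 2 eq by (simp add: merge_preserving_def)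
  qed
qed (rule \<phi>)

lemma merge_preserving_image:
  assumes "merge_preserving X f X' f' \<phi>" "s \<in> cells X" "f s \<le> b"
  shows "\<phi> ` component_cells (sublevel X f b) s = component_cells (sublevel X' f' b) (\<phi> s)"
proof
  have sub: "component_cells (sublevel X f b) s \<subseteq> {t \<in> cells X. f t \<le> b}"
    "component_cells (sublevel X' f' b) (\<phi> s) \<subseteq> {t \<in> cells X'. f' t \<le> b}"
    using component_cells_sub cells_sublevel by metis+
  show "\<phi> ` component_cells (sublevel X f b) s \<subseteq> component_cells (sublevel X' f' b) (\<phi> s)"
    using assms sub(1) by (auto simp: merge_preserving_def)
  show "component_cells (sublevel X' f' b) (\<phi> s) \<subseteq> \<phi> ` component_cells (sublevel X f b) s"
  proof
    fix t assume t: "t \<in> component_cells (sublevel X' f' b) (\<phi> s)"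
    then have "t \<in> cells X'" using sub(2) by blast
    moreover have "cells X' = \<phi> ` cells X" using assms(1) by (simp add: merge_preserving_def bij_betw_def)
    ultimately obtain r where "r \<in> cells X" "t = \<phi> r" by blast
    then show "t \<in> \<phi> ` component_cells (sublevel X f b) s"
      using assms t sub(2) by (auto simp: merge_preserving_def)
  qed
qed

lemma merge_preserving_lower:
  assumes "merge_preserving X f X' f' \<phi>" "s \<in> cells X"
  shows "\<phi> ` lower X f s = lower X' f' (\<phi> s)"
  using merge_preserving_image[OF assms order.refl] assms
  by (simp add: lower_def merge_preserving_def)

lemma merge_preserving_family:
  assumes "merge_preserving X f X' f' \<phi>"
  shows "merge_family X f = merge_family X' f'"
proof -
  have X': "cells X' = \<phi> ` cells X" and f: "\<And>s. s \<in> cells X \<Longrightarrow> f' (\<phi> s) = f s"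
    using assms by (auto simp: merge_preserving_def bij_betw_def)
  have "f' ` lower X' f' (\<phi> s) = f ` lower X f s" if "s \<in> cells X" for s
    using that lower_sub[of X f s] f
    by (auto simp: merge_preserving_lower[OF assms, symmetric] image_image intro!: image_cong)
  then show ?thesis by (simp add: merge_family_def X' image_image)
qed

text \<open>The bijection is forced: a cell goes to the cell of the same value. It exists because
  the unions of the families are the sets of values, and it preserves linkage because linkage is
  expressed by the family.\<close>

lemma merge_preserving_if_family_eq:
  assumes "morse_graph X f" "morse_graph X' f'" and fam: "merge_family X f = merge_family X' f'"
  shows "\<exists>\<phi>. merge_preserving X f X' f' \<phi>"
proof -
  interpret X: morse_graph X f by fact
  interpret X': morse_graph X' f' by fact
  have vals: "f ` cells X = f' ` cells X'" using fam Union_merge_family by metis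
  define \<phi> where "\<phi> = the_inv_into (cells X') f' \<circ> f"
  have \<phi>: "\<phi> s \<in> cells X'" "f' (\<phi> s) = f s" if "s \<in> cells X" for s
    using vals that X'.inj
    by (auto simp: \<phi>_def intro!: the_inv_into_into f_the_inv_into_f)
  have "merge_preserving X f X' f' \<phi>"
  proof (rule merge_preservingI)
    have "bij_betw f (cells X) (f' ` cells X')" "bij_betw f' (cells X') (f' ` cells X')"
      using X.inj X'.inj vals by (simp_all add: bij_betw_def)
    then show "bij_betw \<phi> (cells X) (cells X')"
      unfolding \<phi>_def using bij_betw_the_inv_into bij_betw_trans by blast
    show "t \<in> component_cells (sublevel X f b) s \<longleftrightarrow> \<phi> t \<in> component_cells (sublevel X' f' b) (\<phi> s)"
      if "s \<in> cells X" "t \<in> cells X" for b s t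
      using that \<phi> fam X.linked_iff_merge_family X'.linked_iff_merge_family by simp
  qed (use \<phi> in simp)
  then show ?thesis by blast
qed

section \<open>Symmetry equivalences preserve sublevel components\<close>

lemma graph_iso_incident:
  assumes "graph_iso X Y \<phi>" "s \<in> cells X" "t \<in> cells X"
  shows "(s, t) \<in> incident X \<longleftrightarrow> (\<phi> s, \<phi> t) \<in> incident Y"
  using assms by (simp add: graph_iso_def incident_def)

lemma bij_betw_sublevel:
  assumes "bij_betw \<phi> (cells X) (cells Y)" and g: "\<And>s. s \<in> cells X \<Longrightarrow> g s = f (\<phi> s)"
  shows "bij_betw \<phi> (cells (sublevel X g b)) (cells (sublevel Y f b))"
proof -
  have inj: "inj_on \<phi> (cells X)" and Y: "cells Y = \<phi> ` cells X"
    using assms(1) by (simp_all add: bij_betw_def)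
  have "inj_on \<phi> (cells (sublevel X g b))" using inj by (rule inj_on_subset) (auto simp: cells_sublevel)
  moreover have "\<phi> ` cells (sublevel X g b) = cells (sublevel Y f b)"
    unfolding cells_sublevel Y using g by auto
  ultimately show ?thesis by (simp add: bij_betw_def)
qed

lemma merge_preserving_graph_iso:
  assumes \<psi>: "graph_iso X Y \<psi>" and g: "\<And>s. s \<in> cells X \<Longrightarrow> g s = f (\<psi> s)"
  shows "merge_preserving X g Y f \<psi>"
proof (rule merge_preservingI)
  show bij: "bij_betw \<psi> (cells X) (cells Y)" using \<psi> by (simp add: graph_iso_def)
  show "f (\<psi> s) = g s" if "s \<in> cells X" for s using g that by simp
  show "t \<in> component_cells (sublevel X g b) s \<longleftrightarrow> \<psi> t \<in> component_cells (sublevel Y f b) (\<psi> s)"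
    if "s \<in> cells X" "t \<in> cells X" "g s \<le> b" "g t \<le> b" for b s t
  proof (rule component_cells_bij)
    show "bij_betw \<psi> (cells (sublevel X g b)) (cells (sublevel Y f b))"
      using bij g by (rule bij_betw_sublevel)
    show "(s, t) \<in> incident (sublevel X g b) \<longleftrightarrow> (\<psi> s, \<psi> t) \<in> incident (sublevel Y f b)"
      if "s \<in> cells (sublevel X g b)" "t \<in> cells (sublevel X g b)" for s t
      using that g graph_iso_incident[OF \<psi>] by (simp add: incident_sublevel cells_sublevel)
  qed (use that in \<open>simp_all add: cells_sublevel\<close>)
qed

text \<open>Here \<open>h\<close> is the function reached so far. From level \<open>c\<close> on,
  \<open>\<xi>\<close> moves cells only inside one component, which changes neither the sublevel
  complex nor its components. Below \<open>c\<close>, \<open>\<xi>\<close> is an incidence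
  preserving bijection from the sublevel complex of \<open>h \<circ> \<xi>\<close> onto that of
  \<open>h\<close>.\<close>

lemma merge_preserving_elementary:
  assumes el: "elementary_automorphism X f c \<xi>" and h: "sublevel X h c = sublevel X f c"
  shows "merge_preserving X (h \<circ> \<xi>) X h \<xi>"
    and "c \<le> b \<Longrightarrow> sublevel X (h \<circ> \<xi>) b = sublevel X h b"
proof -
  obtain v where v: "v \<in> verts (sublevel X f c)"
    and iso: "graph_iso (component (sublevel X f c) (Inl v)) (component (sublevel X f c) (Inl v)) \<xi>"
    and id: "\<And>s. s \<in> cells X \<Longrightarrow> s \<notin> component_cells (sublevel X f c) (Inl v) \<Longrightarrow> \<xi> s = s"
    and bij: "bij_betw \<xi> (cells X) (cells X)"
    using el unfolding elementary_automorphism_def by auto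
  let ?K = "component (sublevel X h c) (Inl v)"
  define C where "C = component_cells (sublevel X h c) (Inl v)"
  \<comment> \<open>The automorphism was given with respect to \<open>f\<close>, but at level
    \<open>c\<close> the complexes of \<open>f\<close> and \<open>h\<close> are the same.\<close>
  have iso: "graph_iso ?K ?K \<xi>" and id: "\<And>s. s \<in> cells X \<Longrightarrow> s \<notin> C \<Longrightarrow> \<xi> s = s"
    using iso id h by (simp_all add: C_def)
  have C_sub: "C \<subseteq> {s \<in> cells X. h s \<le> c}"
    unfolding C_def using component_cells_sub cells_sublevel by metis
  have \<xi>C: "bij_betw \<xi> C C" using iso by (simp add: graph_iso_def C_def)
  then have C: "\<xi> s \<in> C \<longleftrightarrow> s \<in> C" if "s \<in> cells X" for s
    using id that by (metis bij_betwE)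
  have cellsX: "\<xi> s \<in> cells X" if "s \<in> cells X" for s using that bij by (metis bij_betwE)
  have incC: "(s, t) \<in> incident X \<longleftrightarrow> (\<xi> s, \<xi> t) \<in> incident X" if st: "s \<in> C" "t \<in> C" for s t
  proof -
    have "(s, t) \<in> incident ?K \<longleftrightarrow> (s, t) \<in> incident X" if "s \<in> C" "t \<in> C" for s t
      using that C_sub unfolding component_def by (auto simp: incident_restrict incident_sublevel C_def)
    moreover have "\<xi> s \<in> C" "\<xi> t \<in> C" using st \<xi>C by (metis bij_betwE)+
    moreover have "s \<in> cells ?K" "t \<in> cells ?K" using st by (simp_all add: C_def)
    ultimately show ?thesis using st graph_iso_incident[OF iso] by blast
  qed
  have closed: "t \<in> C" if "s \<in> C" "(s, t) \<in> incident X" "h t \<le> c" for s t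
    using that C_sub component_cells_incident[of s "sublevel X h c" "Inl v" t]
    by (auto simp: C_def incident_sublevel)
  \<comment> \<open>Cells of \<open>C\<close> and their images have values at most \<open>c\<close>;
    all other cells are fixed.\<close>
  have le: "h (\<xi> s) \<le> b \<longleftrightarrow> h s \<le> b" if "s \<in> cells X" "c \<le> b" for s b
    using that id C C_sub by (cases "s \<in> C") force+
  then show sub_eq: "sublevel X (h \<circ> \<xi>) b = sublevel X h b" if "c \<le> b" for b
    unfolding sublevel_def using that by (intro restrict_cong) auto
  show "merge_preserving X (h \<circ> \<xi>) X h \<xi>"
  proof (rule merge_preservingI)
    fix b s t assume st: "s \<in> cells X" "t \<in> cells X" "(h \<circ> \<xi>) s \<le> b" "(h \<circ> \<xi>) t \<le> b"
    show "t \<in> component_cells (sublevel X (h \<circ> \<xi>) b) s \<longleftrightarrow>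
      \<xi> t \<in> component_cells (sublevel X h b) (\<xi> s)"
    proof (cases "c \<le> b")
      case True
      have "component_cells (sublevel X h b) (\<xi> r) = component_cells (sublevel X h b) r \<and>
          \<xi> r \<in> component_cells (sublevel X h b) r"
        if r: "r \<in> cells X" "h (\<xi> r) \<le> b" for r
      proof (cases "r \<in> C")
        case rC: True
        then have "\<xi> r \<in> C" using C r by simp
        have "component_cells (sublevel X h c) r = C" using rC component_cells_eq C_def by metis
        then have "\<xi> r \<in> component_cells (sublevel X h b) r"
          using \<open>\<xi> r \<in> C\<close> True component_sublevel_mono by blast
        then show ?thesis using component_cells_eq by metis
      next
        case False
        then have "\<xi> r = r" using id r by simp
        then show ?thesis using r component_cells_self[of r "sublevel X h b"] by (simp add: cells_sublevel)
      qed
      then show ?thesis using st sub_eq[OF True] component_cells_eq component_cells_self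
        by (smt (verit) comp_apply component_cells_sym cellsX cells_sublevel mem_Collect_eq)
    next
      case False
      show ?thesis
      proof (rule component_cells_bij)
        show "bij_betw \<xi> (cells (sublevel X (h \<circ> \<xi>) b)) (cells (sublevel X h b))"
          using bij by (rule bij_betw_sublevel) simp
        fix s t assume "s \<in> cells (sublevel X (h \<circ> \<xi>) b)" "t \<in> cells (sublevel X (h \<circ> \<xi>) b)"
        then have st: "s \<in> cells X" "t \<in> cells X" "h (\<xi> s) \<le> b" "h (\<xi> t) \<le> b"
          by (auto simp: cells_sublevel)
        have "(s, t) \<in> incident X \<longleftrightarrow> (\<xi> s, \<xi> t) \<in> incident X"
        proof -
          consider "s \<in> C" "t \<in> C" | "s \<notin> C" "t \<notin> C" | "s \<in> C" "t \<notin> C" | "s \<notin> C" "t \<in> C" by blast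
          then show ?thesis
          proof cases
            case 1 then show ?thesis using incC by simp
          next
            case 2 then show ?thesis using id st by simp
          next
            \<comment> \<open>The fixed cell has a value at most \<open>b < c\<close>, so an
              incidence with a cell of \<open>C\<close> would put it into \<open>C\<close>. Neither
              side of the equivalence holds.\<close>
            case 3
            then have "\<xi> t = t" "h t \<le> c" using id st False by force+
            then show ?thesis using 3 closed C st by metis
          next
            case 4
            then have "\<xi> s = s" "h s \<le> c" using id st False by force+
            then show ?thesis using 4 closed C st symE[OF sym_incident] by metis
          qed
        qed
        then show "(s, t) \<in> incident (sublevel X (h \<circ> \<xi>) b) \<longleftrightarrow> (\<xi> s, \<xi> t) \<in> incident (sublevel X h b)"
          by (simp add: incident_sublevel)
      qed (use st in \<open>simp_all add: cells_sublevel\<close>)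
    qed
  qed (use bij in simp_all)
qed

lemma merge_preserving_id: "merge_preserving X f X f id"
  by (simp add: merge_preserving_def)

text \<open>Acting from lower to higher levels, every letter meets a function whose sublevel complexes at
  that level and above are still those of \<open>f\<close>.\<close>

lemma merge_preserving_word:
  assumes "aut_sl_word X f ws" and "\<And>c \<xi> b. (c, \<xi>) \<in> set ws \<Longrightarrow> c \<le> b \<Longrightarrow> sublevel X h b = sublevel X f b"
  shows "merge_preserving X (h \<circ> word_action ws) X h (word_action ws)"
  using assms
proof (induction ws arbitrary: h)
  case Nil
  then show ?case using merge_preserving_id[of X h] by (simp add: word_action_def id_def)
next
  case (Cons w ws)
  obtain c \<xi> where w: "w = (c, \<xi>)" by force
  have el: "elementary_automorphism X f c \<xi>" and "aut_sl_word X f ws"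
    and le: "\<And>d \<zeta>. (d, \<zeta>) \<in> set ws \<Longrightarrow> c \<le> d"
    using Cons.prems(1) w by (force simp: aut_sl_word_def)+
  have h: "sublevel X h b = sublevel X f b" if "c \<le> b" for b
    using Cons.prems(2)[of c \<xi> b] that w by simp
  note mp = merge_preserving_elementary[OF el h[OF order.refl]]
  have "merge_preserving X (h \<circ> \<xi> \<circ> word_action ws) X (h \<circ> \<xi>) (word_action ws)"
  proof (rule Cons.IH)
    fix d \<zeta> b assume "(d, \<zeta>) \<in> set ws" "d \<le> b"
    then have "c \<le> b" using le by force
    then show "sublevel X (h \<circ> \<xi>) b = sublevel X f b" using mp(2) h by simp
  qed fact
  from merge_preserving_comp[OF this mp(1)] show ?case
    by (simp add: word_action_def w comp_def)
qed

lemma merge_preserving_cong: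
  assumes "merge_preserving X f Y h \<phi>" and "\<And>s. s \<in> cells X \<Longrightarrow> f s = g s"
  shows "merge_preserving X g Y h \<phi>"
proof -
  have "sublevel X f b = sublevel X g b" for b
    unfolding sublevel_def using assms(2) by (intro restrict_cong) auto
  then show ?thesis using assms by (simp add: merge_preserving_def)
qed

text \<open>On \<open>X\<close> the functions \<open>f' \<circ> \<psi>\<close> and
  \<open>f \<circ> word_action ws\<close> agree. From this common function both the word and
  \<open>\<psi>\<close> preserve linkage, and \<open>\<phi>\<close> is what remains of
  \<open>\<psi>\<close> after cancelling the word.\<close>

lemma symmetry_equivalence_merge_preserving:
  assumes "symmetry_equivalence a X f X' f' \<phi>" and "bij_betw \<phi> (cells X) (cells X')"
  shows "merge_preserving X f X' f' \<phi>"
proof -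
  obtain \<psi> ws where \<psi>: "graph_iso X X' \<psi>" and sym: "symmetry_equivalent_by X f (f' \<circ> \<psi>) ws"
    and \<phi>: "\<And>s. s \<in> cells X \<Longrightarrow> \<phi> (word_action ws s) = \<psi> s"
    using assms(1) unfolding symmetry_equivalence_def by blast
  have "merge_preserving X (f \<circ> word_action ws) X f (word_action ws)"
    using sym by (intro merge_preserving_word) (auto simp: symmetry_equivalent_by_def)
  then have "merge_preserving X (f' \<circ> \<psi>) X f (word_action ws)"
    by (rule merge_preserving_cong) (use sym in \<open>simp add: symmetry_equivalent_by_def\<close>)
  moreover have "merge_preserving X (f' \<circ> \<psi>) X' f' \<psi>"
    by (rule merge_preserving_graph_iso[OF \<psi>]) simp
  ultimately show ?thesis using assms(2) \<phi> by (rule merge_preserving_factor)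
qed

section \<open>CM equivalence in terms of the merge family\<close>

text \<open>In the recursive rule linkage comes from the bijection between components at every
  level: the image of the component of \<open>s\<close> is a component containing
  \<open>\<phi> s\<close>, hence the component of \<open>\<phi> s\<close>.\<close>

lemma CM_equivalence_merge_preserving:
  "CM_equivalence a X f X' f' \<phi> \<Longrightarrow> merge_preserving X f X' f' \<phi>"
proof (induction rule: CM_equivalence.induct)
  case (symmetry X f X' f' \<phi> a)
  show ?case by (rule symmetry_equivalence_merge_preserving) fact+
next
  case (recursive X f X' f' \<phi> a)
  have bij: "bij_betw \<phi> (cells X) (cells X')" and f: "\<forall>s\<in>cells X. f' (\<phi> s) = f s"
    and comps: "\<And>b. bij_betw (image \<phi>) (components (sublevel X f b)) (components (sublevel X' f' b))"
    using recursive.hyps by auto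
  show ?case
  proof (rule merge_preservingI)
    fix b s t assume st: "s \<in> cells X" "t \<in> cells X" "f s \<le> b" "f t \<le> b"
    let ?C = "component_cells (sublevel X f b) s"
    have s: "s \<in> cells (sublevel X f b)" using st by (simp add: cells_sublevel)
    then have "?C \<in> components (sublevel X f b)" by (simp add: components_def)
    then have "\<phi> ` ?C \<in> components (sublevel X' f' b)" using comps[of b] by (metis bij_betwE)
    then obtain r where r: "\<phi> ` ?C = component_cells (sublevel X' f' b) r"
      by (auto simp: components_def)
    have "s \<in> ?C" using s by (rule component_cells_self)
    then have "\<phi> s \<in> component_cells (sublevel X' f' b) r" using r by blast
    then have "\<phi> ` ?C = component_cells (sublevel X' f' b) (\<phi> s)"
      using r component_cells_eq by metis
    moreover have "t \<in> ?C \<longleftrightarrow> \<phi> t \<in> \<phi> ` ?C"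
    proof -
      have "?C \<subseteq> cells X" using component_cells_sub[of "sublevel X f b" s] by (auto simp: cells_sublevel)
      then show ?thesis using bij st(2) by (metis bij_betw_imp_inj_on inj_on_image_mem_iff)
    qed
    ultimately show "t \<in> ?C \<longleftrightarrow> \<phi> t \<in> component_cells (sublevel X' f' b) (\<phi> s)" by simp
  qed (use bij f in auto)
qed

section \<open>Restriction to a component of a sublevel complex\<close>

lemma component_cells_outside: "s \<notin> cells Y \<Longrightarrow> component_cells Y s = {}"
  using reach_sym reach_cells unfolding component_cells_def by fast

text \<open>The component of \<open>s\<close> at level \<open>min b c\<close> never leaves its
  component at level \<open>b\<close>, so cutting down to the latter first does no harm.\<close>

lemma component_cells_sublevel_component:
  assumes "s \<in> component_cells (sublevel X f b) v"
  shows "component_cells (sublevel (component (sublevel X f b) v) f c) s =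
    component_cells (sublevel X f (min b c)) s"
proof (cases "f s \<le> c")
  case True
  let ?C = "component_cells (sublevel X f b) v"
  let ?D = "component_cells (sublevel X f (min b c)) s"
  have "?D \<subseteq> component_cells (sublevel X f b) s" by (rule component_sublevel_mono) simp
  also have "\<dots> = ?C" using assms by (rule component_cells_eq)
  finally have DC: "?D \<subseteq> ?C" .
  have sub: "sublevel (component (sublevel X f b) v) f c = restrict_cells X (?C \<inter> {t. f t \<le> min b c})"
    unfolding component_def by (auto simp: sublevel_def restrict_restrict intro!: restrict_cong)
  have "s \<in> cells (sublevel X f (min b c))"
    using assms True component_cells_sub[of "sublevel X f b" v] by (auto simp: cells_sublevel)
  then have "s \<in> ?D" by (rule component_cells_self)
  then show ?thesis unfolding sub using DC component_cells_sub[of "sublevel X f (min b c)" s]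
    by (intro component_shrink[of _ _ "{t. f t \<le> min b c}" s]) (auto simp: sublevel_def)
next
  case False
  then show ?thesis by (simp add: cells_sublevel component_cells_outside)
qed

lemma merge_preserving_component:
  assumes mp: "merge_preserving X f X' f' \<phi>" and v: "v \<in> cells X" "f v \<le> b"
  shows "merge_preserving (component (sublevel X f b) v) f (component (sublevel X' f' b) (\<phi> v)) f' \<phi>"
proof (rule merge_preservingI)
  let ?K = "component (sublevel X f b) v"
  have K: "cells ?K \<subseteq> {s \<in> cells X. f s \<le> b}"
    using component_cells_sub[of "sublevel X f b" v] by (simp add: cells_sublevel)
  have img: "\<phi> ` component_cells (sublevel X f b) v = component_cells (sublevel X' f' b) (\<phi> v)"
    using merge_preserving_image[OF mp v] .
  have "inj_on \<phi> (cells X)" using mp by (simp add: merge_preserving_def bij_betw_def)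
  then have "inj_on \<phi> (cells ?K)" by (rule inj_on_subset) (use K in blast)
  then show "bij_betw \<phi> (cells ?K) (cells (component (sublevel X' f' b) (\<phi> v)))"
    using img by (simp add: bij_betw_def)
  show "f' (\<phi> s) = f s" if "s \<in> cells ?K" for s
    using that K mp by (auto simp: merge_preserving_def)
  fix c s t assume st: "s \<in> cells ?K" "t \<in> cells ?K" "f s \<le> c" "f t \<le> c"
  have "\<phi> s \<in> component_cells (sublevel X' f' b) (\<phi> v)" using st(1) img by auto
  moreover have "s \<in> cells X" "t \<in> cells X" "f s \<le> min b c" "f t \<le> min b c" using st K by auto
  ultimately show "t \<in> component_cells (sublevel ?K f c) s \<longleftrightarrow>
      \<phi> t \<in> component_cells (sublevel (component (sublevel X' f' b) (\<phi> v)) f' c) (\<phi> s)"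
    using st(1) mp by (simp add: component_cells_sublevel_component merge_preserving_def)
qed

text \<open>The recursive rule applies at the largest value \<open>a\<close>: components strictly
  below miss the top cell, so they have fewer cells and induction covers them. A single vertex needs
  no base case, since nothing lies strictly below it and there are no edges.\<close>

lemma CM_equivalence_if_merge_preserving:
  assumes "morse_graph X f" "morse_graph X' f'" "connected_graph X" "connected_graph X'"
    and "merge_preserving X f X' f' \<phi>"
  shows "CM_equivalence (Max (f ` cells X)) X f X' f' \<phi>"
  using assms
proof (induction "card (cells X)" arbitrary: X X' rule: less_induct)
  case less
  interpret X: morse_graph X f by (rule less.prems)
  interpret X': morse_graph X' f' by (rule less.prems)
  note mp = less.prems(5)
  have bij: "bij_betw \<phi> (cells X) (cells X')" and f: "\<And>s. s \<in> cells X \<Longrightarrow> f' (\<phi> s) = f s"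
    using mp by (simp_all add: merge_preserving_def)
  have cellsX': "\<phi> s \<in> cells X'" if "s \<in> cells X" for s using that bij by (metis bij_betwE)
  define a where "a = Max (f ` cells X)"
  have ne: "cells X \<noteq> {}" using less.prems by (simp add: connected_graph_def)
  then have "a \<in> f ` cells X" unfolding a_def using X.finite by (intro Max_in) auto
  then obtain top where top: "top \<in> cells X" "f top = a" by blast
  obtain b where b: "b < a" "\<And>s. s \<in> cells X \<Longrightarrow> f s < a \<longleftrightarrow> f s \<le> b"
    and Y: "sublevel_less X f a = sublevel X f b"
    using X.sublevel_less_eq_sublevel by metis
  \<comment> \<open>Both functions take the same values, so the same \<open>b\<close> works for
    \<open>X'\<close>.\<close>
  have Y': "sublevel_less X' f' a = sublevel X' f' b"
    unfolding sublevel_def sublevel_less_def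
  proof (rule restrict_cong)
    have "f' s < a \<longleftrightarrow> f' s \<le> b" if s: "s \<in> cells X'" for s
    proof -
      obtain r where "r \<in> cells X" "s = \<phi> r" using s bij by (auto simp: bij_betw_def)
      then show ?thesis using b(2)[of r] f by simp
    qed
    then show "cells X' \<inter> {s. f' s < a} = cells X' \<inter> {s. f' s \<le> b}" by auto
  qed
  have img: "\<phi> ` component_cells (sublevel X f c) s = component_cells (sublevel X' f' c) (\<phi> s)"
    if "s \<in> cells X" "f s \<le> c" for s c using merge_preserving_image[OF mp that] .
  have img_eq: "\<phi> ` A = \<phi> ` B \<longleftrightarrow> A = B" "\<phi> ` A \<subseteq> \<phi> ` B \<longleftrightarrow> A \<subseteq> B" if "A \<subseteq> cells X" "B \<subseteq> cells X" for A B
  proof -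
    have "inj_on \<phi> (cells X)" using bij by (rule bij_betw_imp_inj_on)
    then show "\<phi> ` A = \<phi> ` B \<longleftrightarrow> A = B" using that by (rule inj_on_image_eq_iff)
    show "\<phi> ` A \<subseteq> \<phi> ` B \<longleftrightarrow> A \<subseteq> B"
      using that inj_on_image_eq_iff[OF \<open>inj_on \<phi> (cells X)\<close>, of "A \<union> B" B]
      unfolding subset_Un_eq[of A B] subset_Un_eq[of "\<phi> ` A"] by (simp add: image_Un)
  qed
  have sub: "component_cells (sublevel X f c) s \<subseteq> cells X" for c s
    using component_cells_sub[of "sublevel X f c" s] by (auto simp: cells_sublevel)
  show ?case unfolding a_def[symmetric]
  proof (rule CM_equivalence.recursive)
    show "\<forall>c. bij_betw (image \<phi>) (components (sublevel X f c)) (components (sublevel X' f' c))"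
    proof
      fix c
      have "inj_on (image \<phi>) (components (sublevel X f c))"
        using img_eq(1) sub unfolding components_def by (auto intro!: inj_onI)
      moreover have "cells (sublevel X' f' c) = \<phi> ` cells (sublevel X f c)"
        using bij_betw_sublevel[OF bij, of f f' c] f by (simp add: bij_betw_def)
      then have "image \<phi> ` components (sublevel X f c) = components (sublevel X' f' c)"
        using img by (simp add: components_def image_image cells_sublevel)
      ultimately show "bij_betw (image \<phi>) (components (sublevel X f c)) (components (sublevel X' f' c))"
        by (simp add: bij_betw_def)
    qed
    show "\<forall>v\<in>verts (sublevel_less X f a). \<exists>b\<le>a.
       CM_equivalence b (component (sublevel_less X f a) (Inl v)) f
         (component (sublevel_less X' f' a) (\<phi> (Inl v))) f' \<phi>"
    proof
      fix v assume "v \<in> verts (sublevel_less X f a)"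
      then have "Inl v \<in> cells (sublevel X f b)" by (simp add: Y)
      then have v: "Inl v \<in> cells X" "f (Inl v) \<le> b" by (auto simp: cells_sublevel)
      let ?K = "component (sublevel X f b) (Inl v)"
      let ?K' = "component (sublevel X' f' b) (\<phi> (Inl v))"
      have K: "cells ?K \<subseteq> {s \<in> cells X. f s \<le> b}"
        using component_cells_sub[of "sublevel X f b" "Inl v"] by (simp add: cells_sublevel)
      then have "top \<notin> cells ?K" using top b by auto
      then have "cells ?K \<subset> cells X" using K top by blast
      then have "card (cells ?K) < card (cells X)" using X.finite by (rule psubset_card_mono[rotated])
      moreover have "connected_graph ?K" "connected_graph ?K'"
        using v cellsX' f by (auto intro!: connected_component simp: cells_sublevel)
      ultimately have "CM_equivalence (Max (f ` cells ?K)) ?K f ?K' f' \<phi>"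
        using less.hyps X.morse_graph_component X'.morse_graph_component
          merge_preserving_component[OF mp v] by blast
      moreover have "Max (f ` cells ?K) \<le> a"
        using \<open>connected_graph ?K\<close> \<open>cells ?K \<subset> cells X\<close> X.finite unfolding a_def connected_graph_def
        by (intro Max_mono) auto
      ultimately show "\<exists>b\<le>a. CM_equivalence b (component (sublevel_less X f a) (Inl v)) f
         (component (sublevel_less X' f' a) (\<phi> (Inl v))) f' \<phi>"
        unfolding Y Y' by blast
    qed
    have mem: "v \<in> cells X" "f v \<le> b" "\<phi> v \<in> cells (sublevel X' f' b)" "v \<in> cells (sublevel X f b)"
      if "Inl u \<in> cells (sublevel X f b)" "v = Inl u" for v u
      using that f cellsX' by (auto simp: cells_sublevel)
    have low: "\<phi> ` lower X f s = lower X' f' (\<phi> s)" "lower X f s \<subseteq> cells X" if "s \<in> cells X" for s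
      using merge_preserving_lower[OF mp that] lower_sub[of X f s] by auto
    have lowv: "v \<in> lower X f s \<longleftrightarrow> \<phi> v \<in> lower X' f' (\<phi> s)" if "s \<in> cells X" "v \<in> cells X" for s v
      using low that bij by (metis bij_betw_def inj_on_image_mem_iff)
    show "\<forall>e\<in>edges X. f (Inr e) = a \<longrightarrow>
       (\<forall>v\<in>verts (sublevel_less X f a). \<forall>w\<in>verts (sublevel_less X f a).
          merges X (Inr e) (component (sublevel_less X f a) (Inl v))
            (component (sublevel_less X f a) (Inl w)) \<longleftrightarrow>
          merges X' (\<phi> (Inr e)) (component (sublevel_less X' f' a) (\<phi> (Inl v)))
            (component (sublevel_less X' f' a) (\<phi> (Inl w)))) \<and>
       (\<forall>v\<in>verts (sublevel_less X f a).
          closes_circle_within X (Inr e) (component (sublevel_less X f a) (Inl v)) \<longleftrightarrow>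
          closes_circle_within X' (\<phi> (Inr e))
            (component (sublevel_less X' f' a) (\<phi> (Inl v))))"
    proof (intro ballI impI conjI)
      fix e v w assume e: "e \<in> edges X" "f (Inr e) = a"
        and v: "v \<in> verts (sublevel_less X f a)" and w: "w \<in> verts (sublevel_less X f a)"
      have s: "Inr e \<in> cells X" using e by simp
      have "Inl v \<in> cells (sublevel X f b)" "Inl w \<in> cells (sublevel X f b)" using v w by (simp_all add: Y)
      note v = mem[OF this(1) refl] and w = mem[OF this(2) refl]
      have a': "f' (\<phi> (Inr e)) = a" using f s e by simp
      show "merges X (Inr e) (component (sublevel_less X f a) (Inl v))
            (component (sublevel_less X f a) (Inl w)) \<longleftrightarrow>
          merges X' (\<phi> (Inr e)) (component (sublevel_less X' f' a) (\<phi> (Inl v)))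
            (component (sublevel_less X' f' a) (\<phi> (Inl w)))"
        using X.merges_iff[OF s, unfolded e(2) Y, OF v(4) w(4)]
          X'.merges_iff[OF cellsX'[OF s], unfolded a' Y', OF v(3) w(3)]
          lowv[OF s v(1)] lowv[OF s w(1)] img_eq(1)[OF sub sub, of b "Inl v" b "Inl w"]
          img[OF v(1,2)] img[OF w(1,2)]
        unfolding Y Y' by simp
    next
      fix e v assume e: "e \<in> edges X" "f (Inr e) = a"
        and v: "v \<in> verts (sublevel_less X f a)"
      have s: "Inr e \<in> cells X" using e by simp
      have "Inl v \<in> cells (sublevel X f b)" using v by (simp add: Y)
      note v = mem[OF this(1) refl]
      have a': "f' (\<phi> (Inr e)) = a" using f s e by simp
      have "\<phi> ` (lower X f (Inr e) - {Inr e}) = lower X' f' (\<phi> (Inr e)) - {\<phi> (Inr e)}"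
        using low[OF s] s bij by (auto simp: bij_betw_def inj_on_eq_iff subset_iff)
      then have "lower X f (Inr e) - {Inr e} \<subseteq> component_cells (sublevel X f b) (Inl v) \<longleftrightarrow>
        lower X' f' (\<phi> (Inr e)) - {\<phi> (Inr e)} \<subseteq> component_cells (sublevel X' f' b) (\<phi> (Inl v))"
        using img_eq(2)[of "lower X f (Inr e) - {Inr e}", OF _ sub[of b "Inl v"]] low[OF s] img[OF v(1,2)]
        by auto
      then show "closes_circle_within X (Inr e) (component (sublevel_less X f a) (Inl v)) \<longleftrightarrow>
          closes_circle_within X' (\<phi> (Inr e)) (component (sublevel_less X' f' a) (\<phi> (Inl v)))"
        using X.closes_circle_within_iff[OF s, unfolded e(2) Y, OF v(4)]
          X'.closes_circle_within_iff[OF cellsX'[OF s], unfolded a' Y', OF v(3)]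
          lowv[OF s v(1)]
        unfolding Y Y' by simp
    qed
  qed (use less.prems bij f X.graph X'.graph X.morse X'.morse in auto)
qed

text \<open>Symmetry and transitivity are not visible in the rules of \<open>CM_equivalence\<close>;
  for an equality of invariants they are immediate, also between graphs over different
  types.\<close>

theorem CM_equivalent_iff_merge_family:
  assumes "(X, f) \<in> critical_dMfs" "(X', f') \<in> critical_dMfs"
  shows "CM_equivalent X f X' f' \<longleftrightarrow> merge_family X f = merge_family X' f'"
proof -
  have "morse_graph X f" "morse_graph X' f'" "connected_graph X" "connected_graph X'"
    using assms by (auto simp: critical_dMfs_def morse_graph_def)
  then show ?thesis
    unfolding CM_equivalent_def
    using CM_equivalence_merge_preserving merge_preserving_family
      merge_preserving_if_family_eq CM_equivalence_if_merge_preserving by meson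
qed

section \<open>Merge trees and their label sets\<close>

definition labels :: "ltree \<Rightarrow> real set" where
  "labels T = lab ` set (subtrees T)"

definition tree_family :: "ltree \<Rightarrow> real set set" where
  "tree_family T = labels ` set (subtrees T)"

lemma labels_Node [simp]: "labels (Node c x ts) = insert x (\<Union>t\<in>set ts. labels t)"
  by (auto simp: labels_def)

lemma tree_family_Node [simp]:
  "tree_family (Node c x ts) = insert (labels (Node c x ts)) (\<Union>t\<in>set ts. tree_family t)"
  by (auto simp: tree_family_def simp del: labels_Node)

lemma subtrees_self: "T \<in> set (subtrees T)"
  by (cases T) simp

lemma subtrees_trans: "p \<in> set (subtrees q) \<Longrightarrow> q \<in> set (subtrees T) \<Longrightarrow> p \<in> set (subtrees T)"
proof (induction T)
  case (Node c x ts)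
  then show ?case by (cases "q = Node c x ts") auto
qed

lemma finite_labels: "finite (labels T)"
  by (simp add: labels_def)

lemma lab_in_labels: "lab T \<in> labels T"
  by (simp add: labels_def subtrees_self)

lemma labels_nonempty: "labels T \<noteq> {}"
  using lab_in_labels by blast

lemma labels_in_tree_family: "labels T \<in> tree_family T"
  by (simp add: tree_family_def subtrees_self)

lemma labels_subtree: "p \<in> set (subtrees T) \<Longrightarrow> labels p \<subseteq> labels T"
  using subtrees_trans by (auto simp: labels_def)

lemma tree_family_subset: "A \<in> tree_family T \<Longrightarrow> A \<subseteq> labels T \<and> A \<noteq> {}"
  using labels_subtree labels_nonempty by (auto simp: tree_family_def)

lemma Union_tree_family: "\<Union> (tree_family T) = labels T"
  using tree_family_subset labels_in_tree_family by blast

inductive merge_tree :: "ltree \<Rightarrow> bool" where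
  leaf: "merge_tree (Node c x [])"
| cycle: "merge_tree t \<Longrightarrow> chir t = c \<Longrightarrow> lab t < x \<Longrightarrow> merge_tree (Node c x [t])"
| merge: "merge_tree t \<Longrightarrow> merge_tree u \<Longrightarrow> chir t = c \<Longrightarrow> chir u = opposite c \<Longrightarrow>
    lab t < x \<Longrightarrow> lab u < x \<Longrightarrow> labels t \<inter> labels u = {} \<Longrightarrow> Min (labels t) < Min (labels u) \<Longrightarrow>
    ts = [t, u] \<or> ts = [u, t] \<Longrightarrow> merge_tree (Node c x ts)"

lemma opposite_neq [simp]: "opposite c \<noteq> c" "c \<noteq> opposite c"
  by (cases c; simp)+

lemma merge_tree_labels_le: "merge_tree T \<Longrightarrow> y \<in> labels T \<Longrightarrow> y \<le> lab T"
proof (induction arbitrary: y rule: merge_tree.induct)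
  case (cycle t c x)
  then show ?case by fastforce
next
  case (merge t u c x ts)
  then show ?case by fastforce
qed simp

lemma merge_tree_children_less:
  assumes "merge_tree (Node c x ts)" "t \<in> set ts" "y \<in> labels t"
  shows "y < x"
  using assms(1)
proof cases
  case cycle
  then show ?thesis using assms merge_tree_labels_le by fastforce
next
  case (merge t u)
  then show ?thesis using assms merge_tree_labels_le by fastforce
qed (use assms in simp)

lemma merge_tree_subtree: "merge_tree T \<Longrightarrow> p \<in> set (subtrees T) \<Longrightarrow> merge_tree p"
proof (induction rule: merge_tree.induct)
  case (leaf c x)
  then show ?case by (simp add: merge_tree.leaf)
next
  case (cycle t c x)
  then show ?case using merge_tree.cycle by auto
next
  case (merge t u c x ts)
  then show ?case using merge_tree.merge[of t u c x ts] by auto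
qed

lemma lab_eq_Max: "merge_tree T \<Longrightarrow> lab T = Max (labels T)"
  using merge_tree_labels_le lab_in_labels finite_labels by (metis Max_eqI)

lemma Min_labels_in: "Min (labels T) \<in> labels T"
  using finite_labels labels_nonempty by (rule Min_in)

lemma Min_labels_insert:
  assumes "y \<in> A" "finite A" "y < x"
  shows "Min (insert x A) = Min A"
proof -
  have "Min A < x" using assms by (intro Min_le[THEN le_less_trans])
  then show ?thesis using assms by (subst Min_insert) (auto simp: min_def)
qed

text \<open>The minimum of a node is that of its child with the same chirality, so following the
  minimum downwards never changes the chirality.\<close>

lemma merge_tree_Min_chir:
  "merge_tree T \<Longrightarrow> p \<in> set (subtrees T) \<Longrightarrow> lab p = Min (labels T) \<Longrightarrow> chir p = chir T"
proof (induction rule: merge_tree.induct)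
  case (cycle t c x)
  have "Min (labels (Node c x [t])) = Min (labels t)"
    using Min_labels_insert[OF lab_in_labels finite_labels cycle.hyps(3)] by simp
  moreover have "Min (labels t) \<noteq> x"
    using cycle Min_labels_in merge_tree_labels_le by fastforce
  ultimately show ?case using cycle by auto
next
  case (merge t u c x ts)
  have un: "labels (Node c x ts) = insert x (labels t \<union> labels u)" using merge.hyps(9) by auto
  have "Min (labels (Node c x ts)) = Min (labels t \<union> labels u)"
    unfolding un using lab_in_labels[of t] finite_labels merge.hyps by (intro Min_labels_insert) auto
  also have "\<dots> = Min (labels t)"
    using merge.hyps by (simp add: Min_Un finite_labels labels_nonempty)
  finally have m: "lab p = Min (labels t)" using merge.prems by simp
  have "lab p \<noteq> x" using m merge.hyps Min_labels_in merge_tree_labels_le by fastforce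
  moreover have "lab p \<notin> labels u" using m merge.hyps(7) Min_labels_in by fastforce
  then have "p \<notin> set (subtrees u)" by (auto simp: labels_def)
  ultimately show ?case using merge m by auto
qed simp

lemma merge_tree_distinct: "merge_tree T \<Longrightarrow> distinct (map lab (subtrees T))"
proof (induction rule: merge_tree.induct)
  case (cycle t c x)
  then have "x \<notin> labels t" using merge_tree_labels_le by fastforce
  then show ?case using cycle by (simp add: labels_def)
next
  case (merge t u c x ts)
  then have "x \<notin> labels t" "x \<notin> labels u" using merge_tree_labels_le by fastforce+
  from merge.hyps(9) show ?case
    using merge.IH merge.hyps(7) \<open>x \<notin> labels t\<close> \<open>x \<notin> labels u\<close>
    by (elim disjE) (simp_all add: labels_def Int_commute)
qed simp

lemma merge_tree_morse_labeled: "merge_tree T \<Longrightarrow> morse_labeled T"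
  unfolding morse_labeled_def
proof (intro conjI ballI impI)
  assume T: "merge_tree T"
  then show "distinct (map lab (subtrees T))" by (rule merge_tree_distinct)
  fix p q assume p: "p \<in> set (subtrees T)" and q: "q \<in> set (subtrees p)"
  have mp: "merge_tree p" using T p by (rule merge_tree_subtree)
  then show "lab q \<le> lab p" using q merge_tree_labels_le by (auto simp: labels_def)
  assume "\<forall>r\<in>set (subtrees p). lab q \<le> lab r"
  then have "lab q = Min (labels p)" using q by (intro Min_eqI[symmetric]) (auto simp: labels_def)
  with mp q show "chir q = chir p" by (rule merge_tree_Min_chir)
qed

lemma merge_tree_binary_chiral: "merge_tree T \<Longrightarrow> binary_tree T \<and> chiral_tree T"
  unfolding binary_tree_def chiral_tree_def
proof (intro conjI ballI allI impI)
  fix p assume "merge_tree T" "p \<in> set (subtrees T)"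
  then have p: "merge_tree p" by (rule merge_tree_subtree)
  then show "length (children p) \<le> 2" by cases auto
  show "chir a \<noteq> chir b" if "children p = [a, b]" for a b
    using p
  proof cases
    case (merge t u)
    then have "{a, b} = {t, u}" using that by auto
    then show ?thesis using merge(4,5) by (metis doubleton_eq_iff opposite_neq(1))
  qed (use that in auto)
qed

text \<open>Apart from the chirality of the root, all that a \<open>merge_tree\<close> may lack is a
  sibling of some leaf; the subtree at the parent of such a leaf has exactly two labels.\<close>

lemma merge_tree_gML_tree:
  assumes T: "merge_tree T" and c: "chir T = Lft" and two: "\<And>A. A \<in> tree_family T \<Longrightarrow> card A \<noteq> 2"
  shows "gML_tree T"
proof -
  have "(children q = [] \<longrightarrow> length (children p) \<noteq> 1) \<and>
        (children q \<noteq> [] \<and> length (children p) = 1 \<longrightarrow> chir q = chir p)"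
    if p: "p \<in> set (subtrees T)" and q: "q \<in> set (children p)" for p q
  proof (intro conjI impI notI)
    have mp: "merge_tree p" using T p by (rule merge_tree_subtree)
    show False if leaf: "children q = []" and "length (children p) = 1"
    proof -
      have "children p = [q]" using that q by (cases "children p") auto
      then obtain d x where p': "p = Node d x [q]" by (cases p) auto
      obtain y e where "q = Node e y []" using leaf by (cases q) auto
      then have "labels p = {x, y}" "y < x" using p' mp by (auto elim: merge_tree.cases)
      then have "card (labels p) = 2" by simp
      then show False using two p by (simp add: tree_family_def)
    qed
    show "chir q = chir p" if "children q \<noteq> [] \<and> length (children p) = 1"
      using mp q that by cases auto
  qed
  then show ?thesis
    unfolding gML_tree_def generalized_merge_tree_def
    using merge_tree_morse_labeled[OF T] merge_tree_binary_chiral[OF T] c by blast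
qed

section \<open>From Morse labelings to the recursive form\<close>

lemma morse_labeled_child:
  assumes "morse_labeled (Node c x ts)" "t \<in> set ts"
  shows "morse_labeled t"
proof -
  have "distinct (map lab (subtrees t))"
    using assms by (auto simp: morse_labeled_def map_concat distinct_concat_iff)
  then show ?thesis using assms by (auto simp: morse_labeled_def)
qed

lemma morse_labeled_Min_chir:
  assumes "morse_labeled T" "p \<in> set (subtrees T)" "lab p = Min (labels T)"
  shows "chir p = chir T"
proof -
  have "\<forall>r\<in>set (subtrees T). lab p \<le> lab r"
    using assms(3) finite_labels by (simp add: labels_def)
  then show ?thesis using assms subtrees_self unfolding morse_labeled_def by blast
qed

text \<open>The minimum of a node is attained in the child with the smallest minimum. The node
  attaining it shares its chirality with both, so this child has the chirality of its parent, and a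
  second child must have the opposite one.\<close>

lemma merge_tree_if_morse_labeled:
  "binary_tree T \<Longrightarrow> chiral_tree T \<Longrightarrow> morse_labeled T \<Longrightarrow> merge_tree T"
proof (induction T)
  case (Node c x ts)
  have IH: "merge_tree t" if "t \<in> set ts" for t
  proof (rule Node.IH[OF that])
    show "binary_tree t" "chiral_tree t"
      using that Node.prems by (auto simp: binary_tree_def chiral_tree_def)
    show "morse_labeled t" using morse_labeled_child[OF Node.prems(3) that] .
  qed
  have less: "y < x" if "t \<in> set ts" "y \<in> labels t" for t y
  proof -
    have "y \<le> x" using Node.prems(3) that by (auto simp: morse_labeled_def labels_def)
    moreover have "y \<noteq> x" using Node.prems(3) that by (auto simp: morse_labeled_def labels_def)
    ultimately show ?thesis by simp
  qed
  have Min: "chir t = c" if t: "t \<in> set ts" and le: "\<And>u. u \<in> set ts \<Longrightarrow> Min (labels t) \<le> Min (labels u)" for t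
  proof -
    obtain p where p: "p \<in> set (subtrees t)" "lab p = Min (labels t)"
      using Min_labels_in[of t] by (auto simp: labels_def)
    have "Min (labels (Node c x ts)) = lab p"
    proof (rule Min_eqI)
      show "finite (labels (Node c x ts))" by (rule finite_labels)
      show "lab p \<in> labels (Node c x ts)" using p t Min_labels_in[of t] by auto
      fix y assume "y \<in> labels (Node c x ts)"
      then consider "y = x" | u where "u \<in> set ts" "y \<in> labels u" by auto
      then show "lab p \<le> y"
      proof cases
        case 1
        then show ?thesis using less[OF t Min_labels_in] p by simp
      next
        case 2
        then have "Min (labels u) \<le> y" by (simp add: finite_labels)
        then show ?thesis using le[OF 2(1)] p by simp
      qed
    qed
    moreover have "p \<in> set (subtrees (Node c x ts))" using p t by auto
    ultimately have "chir p = c" using morse_labeled_Min_chir[OF Node.prems(3)] by simp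
    moreover have "chir p = chir t"
      using morse_labeled_Min_chir[OF morse_labeled_child[OF Node.prems(3) t] p] .
    ultimately show ?thesis by simp
  qed
  have "length ts \<le> 2" using Node.prems(1) by (auto simp: binary_tree_def)
  then consider "ts = []" | t where "ts = [t]" | t u where "ts = [t, u]"
    by (cases ts; cases "tl ts"; cases "tl (tl ts)") auto
  then show ?case
  proof cases
    case 1
    then show ?thesis by (simp add: merge_tree.leaf)
  next
    case 2
    then show ?thesis using IH Min[of t] less[of t] lab_in_labels by (auto intro!: merge_tree.cycle)
  next
    case 3
    have disj: "labels t \<inter> labels u = {}"
      using Node.prems(3) 3 by (auto simp: morse_labeled_def labels_def)
    have "chir t \<noteq> chir u" using Node.prems(2) 3 by (auto simp: chiral_tree_def)
    then have opp: "chir t = c \<Longrightarrow> chir u = opposite c" "chir u = c \<Longrightarrow> chir t = opposite c"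
      by (cases c; cases "chir t"; cases "chir u"; simp)+
    have "lab t < x" "lab u < x" using less 3 lab_in_labels by auto
    moreover have "merge_tree t" "merge_tree u" using IH 3 by auto
    moreover have "Min (labels t) \<noteq> Min (labels u)" using disj Min_labels_in by (metis disjoint_iff)
    then consider "Min (labels t) < Min (labels u)" | "Min (labels u) < Min (labels t)" by linarith
    then have "(Min (labels t) < Min (labels u) \<and> chir t = c) \<or> (Min (labels u) < Min (labels t) \<and> chir u = c)"
    proof cases
      case 1
      have "chir t = c" by (rule Min) (use 1 3 in auto)
      then show ?thesis using 1 by simp
    next
      case 2
      have "chir u = c" by (rule Min) (use 2 3 in auto)
      then show ?thesis using 2 by simp
    qed
    ultimately show ?thesis
      using merge_tree.merge[of t u c x ts] merge_tree.merge[of u t c x ts] disj opp 3 by auto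
  qed
qed

lemma gML_tree_merge_tree: "gML_tree T \<Longrightarrow> merge_tree T \<and> chir T = Lft"
  using merge_tree_if_morse_labeled by (auto simp: gML_tree_def generalized_merge_tree_def)

section \<open>Isomorphism of merge trees\<close>

lemma ltree_iso_refl: "ltree_iso T T"
proof (induction T)
  case (Node c x ts)
  then show ?case by (intro ltree_iso.intros[of ts]) (auto simp: list_all2_same)
qed

lemma ltree_iso_sym: "ltree_iso T T' \<Longrightarrow> ltree_iso T' T"
proof (induction rule: ltree_iso.induct)
  case (1 us ts' ts c x)
  then have "list_all2 ltree_iso us ts" by (auto simp: list_all2_conv_all_nth)
  from list_all2_reorder_left_invariance[OF this 1(1)[symmetric]]
  show ?case by (auto intro: ltree_iso.intros)
qed

text \<open>The permutation of children in the first isomorphism is pushed through the second, so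
  that the two matchings compose.\<close>

lemma ltree_iso_trans: "ltree_iso T T' \<Longrightarrow> ltree_iso T' T'' \<Longrightarrow> ltree_iso T T''"
proof (induction arbitrary: T'' rule: ltree_iso.induct)
  case (1 us ts' ts c x)
  from 1(3) obtain vs ts'' where T'': "T'' = Node c x ts''" "mset vs = mset ts''" "list_all2 ltree_iso ts' vs"
    by (auto elim: ltree_iso.cases)
  obtain ws where ws: "list_all2 ltree_iso us ws" "mset ws = mset vs"
    using list_all2_reorder_left_invariance[OF T''(3), of us] 1(1) by auto
  have "list_all2 ltree_iso ts ws"
    using 1(2) ws(1) by (auto simp: list_all2_conv_all_nth)
  then show ?case using ws T'' by (auto intro: ltree_iso.intros)
qed

lemma equiv_gML_iso_rel: "equiv gML_trees gML_iso_rel"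
  by (rule equivI)
    (auto simp: gML_iso_rel_def intro!: refl_onI symI transI intro: ltree_iso_refl ltree_iso_sym ltree_iso_trans)

lemma list_all2_image_eq: "list_all2 (\<lambda>x y. h x = h y) xs ys \<Longrightarrow> h ` set xs = h ` set ys"
  by (induction rule: list_all2_induct) auto

lemma ltree_iso_family: "ltree_iso T T' \<Longrightarrow> labels T = labels T' \<and> tree_family T = tree_family T'"
proof (induction rule: ltree_iso.induct)
  case (1 us ts' ts c x)
  have "set us = set ts'" using 1 by (metis mset_eq_setD)
  moreover have "labels ` set ts = labels ` set us" "tree_family ` set ts = tree_family ` set us"
    using 1 by (intro list_all2_image_eq; force elim: list_all2_mono)+
  ultimately show ?case by simp
qed

text \<open>The root label exceeds all others and is missing from the label sets of proper subtrees.
  Deleting the full label set therefore leaves exactly the families of the children.\<close>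

lemma tree_family_children:
  assumes T: "merge_tree T"
  shows "(\<Union>t\<in>set (children T). tree_family t) = tree_family T - {labels T}"
proof -
  obtain c x ts where T': "T = Node c x ts" by (cases T)
  have "A \<noteq> labels T" if "t \<in> set ts" "A \<in> tree_family t" for t A
  proof -
    have "A \<subseteq> labels t" using that tree_family_subset by blast
    then have "x \<notin> A" using merge_tree_children_less[of c x ts t x] T T' that by auto
    then show ?thesis using T' by auto
  qed
  then show ?thesis using T' by auto
qed

lemma tree_family_of_union:
  assumes disj: "labels t \<inter> labels u = {}"
  shows "tree_family t = {A \<in> tree_family t \<union> tree_family u. A \<subseteq> labels t}"
    and "tree_family u = {A \<in> tree_family t \<union> tree_family u. A \<subseteq> labels u}"
  using tree_family_subset[of _ t] tree_family_subset[of _ u] disj by blast+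

text \<open>The family of a single tree has a greatest member, the union of two families over
  disjoint labels has none. This tells a node with one child from a node with two.\<close>

lemma tree_family_neq_Un:
  assumes disj: "labels t \<inter> labels u = {}"
  shows "tree_family r \<noteq> tree_family t \<union> tree_family u"
proof
  assume F: "tree_family r = tree_family t \<union> tree_family u"
  then have "labels r = labels t \<union> labels u" using Union_tree_family by (metis Union_Un_distrib)
  moreover have "labels r \<subseteq> labels t \<or> labels r \<subseteq> labels u"
    using F labels_in_tree_family[of r] tree_family_subset by blast
  ultimately show False using disj labels_nonempty[of t] labels_nonempty[of u] by blast
qed

text \<open>The overall minimum marks one child in each tree. The label set of either marked child
  belongs to the family of the other one, so the two sets agree, and inclusion in them sorts the
  members of the union.\<close>

lemma tree_family_union_eq:
  assumes F: "tree_family t \<union> tree_family u = tree_family t' \<union> tree_family u'"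
    and disj: "labels t \<inter> labels u = {}" "labels t' \<inter> labels u' = {}"
    and Min: "Min (labels t) < Min (labels u)" "Min (labels t') < Min (labels u')"
  shows "tree_family t = tree_family t' \<and> tree_family u = tree_family u'"
proof -
  have L: "labels t \<union> labels u = labels t' \<union> labels u'"
    using F Union_tree_family by (metis Union_Un_distrib)
  have "Min (labels t \<union> labels u) = Min (labels t)" "Min (labels t' \<union> labels u') = Min (labels t')"
    using Min by (simp_all add: Min_Un finite_labels labels_nonempty)
  then have m: "Min (labels t) = Min (labels t')" using L by simp
  then have m_in: "Min (labels t) \<in> labels t" "Min (labels t) \<in> labels t'"
    using Min_labels_in[of t] Min_labels_in[of t'] by simp_all
  \<comment> \<open>\<open>labels t\<close> contains the minimum, which lies in
    \<open>labels t'\<close>; hence it cannot come from the disjoint side \<open>u'\<close>.\<close>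
  then have "labels t \<in> tree_family t'"
    using F labels_in_tree_family[of t] tree_family_subset[of "labels t" u'] disj(2) by blast
  moreover have "labels t' \<in> tree_family t"
    using m_in F labels_in_tree_family[of t'] tree_family_subset[of "labels t'" u] disj(1) by blast
  ultimately have t: "labels t = labels t'" using tree_family_subset by blast
  then have u: "labels u = labels u'" using L disj by blast
  have "tree_family t = {A \<in> tree_family t' \<union> tree_family u'. A \<subseteq> labels t'}"
    using tree_family_of_union(1)[OF disj(1)] unfolding F t .
  moreover have "tree_family u = {A \<in> tree_family t' \<union> tree_family u'. A \<subseteq> labels u'}"
    using tree_family_of_union(2)[OF disj(1)] unfolding F u .
  ultimately show ?thesis using tree_family_of_union[OF disj(2)] by metis
qed

text \<open>Labels are recovered as maxima of label sets. Chiralities are handed down from the root,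
  unchanged to the child with the smaller minimum and reversed to the other, so nothing is left to
  choose.\<close>

theorem ltree_iso_if_family_eq:
  "merge_tree T \<Longrightarrow> merge_tree T' \<Longrightarrow> chir T = chir T' \<Longrightarrow> tree_family T = tree_family T' \<Longrightarrow> ltree_iso T T'"
proof (induction arbitrary: T' rule: merge_tree.induct)
  case (leaf c x)
  obtain c' x' ts' where T': "T' = Node c' x' ts'" by (cases T')
  have "tree_family T' = {{x}}" using leaf.prems(3) by simp
  then have "tree_family T' - {labels T'} = {}" using labels_in_tree_family[of T'] by auto
  then have "(\<Union>t\<in>set ts'. tree_family t) = {}"
    using tree_family_children[OF leaf.prems(1)] T' by (metis ltree.sel(3))
  then have "ts' = []" using labels_in_tree_family by (cases ts') auto
  then have "T' = Node c x []" using leaf.prems T' by simp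
  then show ?case by (simp add: ltree_iso_refl)
next
  case (cycle t c x)
  have T: "merge_tree (Node c x [t])" using cycle.hyps by (intro merge_tree.cycle)
  obtain c' x' ts' where T': "T' = Node c' x' ts'" by (cases T')
  have L: "labels (Node c x [t]) = labels T'" using cycle.prems Union_tree_family by metis
  then have x: "x' = x" using lab_eq_Max[OF T] lab_eq_Max[OF cycle.prems(1)] T' by simp
  have "(\<Union>u\<in>set (children (Node c x [t])). tree_family u) = (\<Union>u\<in>set (children T'). tree_family u)"
    using tree_family_children[OF T] tree_family_children[OF cycle.prems(1)] cycle.prems(3) L by metis
  then have F: "tree_family t = (\<Union>t\<in>set ts'. tree_family t)" using T' by simp
  from cycle.prems(1) have "\<exists>t'. ts' = [t'] \<and> merge_tree t' \<and> chir t' = c'"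
    unfolding T'
  proof cases
    case leaf
    then show ?thesis using F labels_in_tree_family by auto
  next
    case (merge t' u')
    then have "tree_family t = tree_family t' \<union> tree_family u'" using F by auto
    then show ?thesis using tree_family_neq_Un merge(7) by blast
  qed auto
  then obtain t' where t': "ts' = [t']" "merge_tree t'" "chir t' = c'" by blast
  then have "ltree_iso t t'" using cycle F T' by auto
  then show ?case using t' T' x cycle.prems(2) by (auto intro!: ltree_iso.intros[of "[t']"])
next
  case (merge t u c x ts)
  have T: "merge_tree (Node c x ts)" using merge.hyps by (rule merge_tree.merge)
  obtain c' x' ts' where T': "T' = Node c' x' ts'" by (cases T')
  have c': "c' = c" using merge.prems(2) T' by simp
  have L: "labels (Node c x ts) = labels T'" using merge.prems Union_tree_family by metis
  then have x: "x' = x" using lab_eq_Max[OF T] lab_eq_Max[OF merge.prems(1)] T' by simp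
  have "(\<Union>u\<in>set (children (Node c x ts)). tree_family u) = (\<Union>u\<in>set (children T'). tree_family u)"
    using tree_family_children[OF T] tree_family_children[OF merge.prems(1)] merge.prems(3) L by metis
  then have F: "tree_family t \<union> tree_family u = (\<Union>t\<in>set ts'. tree_family t)"
    using merge.hyps(9) T' by auto
  from merge.prems(1)[unfolded T'] have "ltree_iso (Node c x ts) (Node c' x' ts')"
  proof cases
    case leaf
    then show ?thesis using F labels_in_tree_family by auto
  next
    case (cycle t')
    then have "tree_family t' = tree_family t \<union> tree_family u" using F by auto
    then show ?thesis using tree_family_neq_Un merge.hyps(7) by blast
  next
    case m': (merge t' u')
    then have "tree_family t \<union> tree_family u = tree_family t' \<union> tree_family u'" using F by auto
    then have "tree_family t = tree_family t'" "tree_family u = tree_family u'"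
      using tree_family_union_eq merge.hyps m' by metis+
    then have iso: "ltree_iso t t'" "ltree_iso u u'" using merge m' c' by auto
    show ?thesis
    proof (rule disjE[OF merge.hyps(9)])
      assume "ts = [t, u]"
      then show ?thesis using iso m' x c' by (auto intro!: ltree_iso.intros[of "[t', u']"])
    next
      assume "ts = [u, t]"
      then show ?thesis using iso m' x c' by (auto intro!: ltree_iso.intros[of "[u', t']"])
    qed
  qed
  then show ?case using T' by simp
qed

section \<open>The induced tree\<close>

context morse_graph
begin

lemma top_critical_unique: "top_critical X f K s \<Longrightarrow> top_critical X f K s' \<Longrightarrow> s = s'"
  unfolding top_critical_def critical_iff using inj_eq by (metis order_antisym)

text \<open>The only choice in the rules is which end is called \<open>v\<close>. For a closing edge
  both ends give the same component, and for a merging edge the strict inequality of the minima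
  fixes the order.\<close>

lemma node_tree_unique: "node_tree X f s c T \<Longrightarrow> node_tree X f s c T' \<Longrightarrow> T = T'"
proof (induction arbitrary: T' rule: node_tree.induct)
  case (vertex v c)
  from vertex.prems show ?case by cases auto
next
  case (cycle e v w s c T)
  let ?Y = "sublevel_less X f (f (Inr e))"
  have e: "e \<in> edges X" using cycle.hyps(1) by (simp add: critical_iff)
  from cycle.prems show ?case
  proof cases
    case c': (cycle v' w' s' T'')
    have "Inl w \<in> component_cells ?Y (Inl v)"
      using closing_iff[OF e cycle.hyps(3)] cycle.hyps(2) by simp
    then have "component_cells ?Y (Inl w) = component_cells ?Y (Inl v)" by (rule component_cells_eq)
    moreover have "v' = v \<or> v' = w" using cycle.hyps(3) c'(4) by (auto simp: doubleton_eq_iff)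
    ultimately have "component ?Y (Inl v') = component ?Y (Inl v)" by (auto simp: component_def)
    then have "s' = s" using c'(5) cycle.hyps(4) top_critical_unique by simp
    then show ?thesis using c' cycle.IH by simp
  qed (use cycle.hyps in simp)
next
  case (merge e v w K K' s s' c T T2)
  let ?Y = "sublevel_less X f (f (Inr e))"
  from merge.prems show ?case
  proof cases
    case m: (merge v' w' L L' r r' U U')
    have "v' = v \<and> w' = w \<or> v' = w \<and> w' = v"
      using merge.hyps(3) m(4) by (auto simp: doubleton_eq_iff)
    moreover have "\<not> (v' = w \<and> w' = v)" using merge.hyps(4,5,6) m(5,6,7) by auto
    ultimately have "L = K" "L' = K'" using merge.hyps(4,5) m(5,6) by auto
    then have "r = s" "r' = s'" using top_critical_unique m merge.hyps by metis+
    then show ?thesis using m merge.IH by simp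
  qed (use merge.hyps in simp)
qed

text \<open>Supplies the cell that the rules ask for. As its \<open>lower\<close> is the strict
  component itself, the label sets can be passed up from the child to the edge.\<close>

lemma component_top:
  assumes v: "v \<in> verts X" "f (Inl v) < a"
  obtains s where "s \<in> cells X" "f s < a" "top_critical X f (component (sublevel_less X f a) (Inl v)) s"
    and "lower X f s = component_cells (sublevel_less X f a) (Inl v)"
proof -
  obtain b where Y: "sublevel_less X f a = sublevel X f b"
    using sublevel_less_eq_sublevel by metis
  let ?C = "component_cells (sublevel_less X f a) (Inl v)"
  have C: "?C \<subseteq> {s \<in> cells X. f s < a}" using component_cells_sub cells_sublevel_less by metis
  have "Inl v \<in> ?C" using v by (intro component_cells_self) (simp add: cells_sublevel_less)
  moreover have "finite ?C" using C finite finite_subset by fastforce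
  ultimately have "Max (f ` ?C) \<in> f ` ?C" by (intro Max_in) auto
  then obtain s where s: "s \<in> ?C" "f s = Max (f ` ?C)" by auto
  then have max: "f t \<le> f s" if "t \<in> ?C" for t
    using that \<open>finite ?C\<close> by simp
  have "lower X f s = ?C"
    by (rule lower_top[of _ X f b "Inl v"]) (use s max Y in auto)
  then show ?thesis using that[of s] s max C by (auto simp: top_critical_def critical_iff)
qed

text \<open>Existence is proved together with the label sets, because \<open>merge_tree\<close>
  demands disjointness and an order of minima that are read off from them. The chirality is kept
  general, since the two children of a merging edge receive different ones.\<close>

lemma node_tree_exists:
  assumes "s \<in> cells X"
  shows "\<exists>T. node_tree X f s c T \<and> merge_tree T \<and> chir T = c \<and> lab T = f s \<and>
    labels T = f ` lower X f s \<and> tree_family T = (\<lambda>t. f ` lower X f t) ` lower X f s"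
  using assms
proof (induction "card {t \<in> cells X. f t < f s}" arbitrary: s c rule: less_induct)
  case less
  have IH: "\<exists>T. node_tree X f r c T \<and> merge_tree T \<and> chir T = c \<and> lab T = f r \<and>
    labels T = f ` lower X f r \<and> tree_family T = (\<lambda>t. f ` lower X f t) ` lower X f r"
    if r: "r \<in> cells X" "f r < f s" for r c
  proof -
    have "{t \<in> cells X. f t < f r} \<subset> {t \<in> cells X. f t < f s}" using r by force
    then have "card {t \<in> cells X. f t < f r} < card {t \<in> cells X. f t < f s}"
      using finite by (intro psubset_card_mono) auto
    then show ?thesis using less.hyps r(1) by blast
  qed
  show ?case
  proof (cases s)
    case (Inl v)
    then have "lower X f s = {s}" using less.prems lower_vertex by simp
    moreover have "node_tree X f s c (Node c (f s) [])"
      unfolding Inl using less.prems Inl by (intro node_tree.vertex) (simp add: critical_iff)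
    ultimately show ?thesis using merge_tree.leaf
      by (intro exI[of _ "Node c (f s) []"]) simp
  next
    case (Inr e)
    define Y where "Y = sublevel_less X f (f s)"
    define C where "C = (\<lambda>v. component_cells Y (Inl v))"
    have e: "e \<in> edges X" "critical X f (Inr e)" using less.prems Inr by (simp_all add: critical_iff)
    have s_less: "y < f s" if "y \<in> f ` C v" for v y
      using that component_cells_sub[of Y "Inl v"] by (auto simp: C_def Y_def cells_sublevel_less)
    have tops: "\<exists>r. r \<in> cells X \<and> f r < f s \<and> top_critical X f (component Y (Inl v)) r \<and> lower X f r = C v"
      if "v \<in> ends X e" for v
      using component_top[of v "f s"] ends_less[OF e(1) that] unfolding Y_def C_def Inr by metis
    have cl: "closing X f e \<longleftrightarrow> Inl w \<in> C v" if "ends X e = {v, w}" for v w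
      using closing_iff[OF e(1) that] by (simp add: C_def Y_def Inr)
    have low: "lower X f s = insert s (C v \<union> C w)" if "ends X e = {v, w}" for v w
      using lower_edge[OF e(1) that] by (simp add: C_def Y_def Inr)
    have self: "Inl v \<in> C v" if "v \<in> ends X e" for v
      unfolding C_def Y_def using ends_less[OF e(1) that] Inr
      by (intro component_cells_self) (simp add: cells_sublevel_less)
    obtain v w where vw: "ends X e = {v, w}" using multigraph_ends[OF graph e(1)] .
    show ?thesis
    proof (cases "closing X f e")
      case True
      then have "C w = C v" using cl[OF vw] component_cells_eq unfolding C_def by metis
      then have L: "lower X f s = insert s (C v)" using low[OF vw] by simp
      obtain r where r: "r \<in> cells X" "f r < f s" "top_critical X f (component Y (Inl v)) r" "lower X f r = C v"
        using tops[of v] vw by auto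
      then obtain T where T: "node_tree X f r c T" "merge_tree T" "chir T = c" "lab T = f r"
        "labels T = f ` C v" "tree_family T = (\<lambda>t. f ` lower X f t) ` C v"
        using IH[of r c] by metis
      have "node_tree X f s c (Node c (f s) [T])"
        unfolding Inr using e True vw r T Inr by (intro node_tree.cycle) (simp_all add: Y_def)
      moreover have "merge_tree (Node c (f s) [T])" using T r by (intro merge_tree.cycle) simp_all
      moreover have "labels (Node c (f s) [T]) = f ` lower X f s" using T L by simp
      ultimately show ?thesis using T L
        by (intro exI[of _ "Node c (f s) [T]"]) (simp del: labels_Node)
    next
      case False
      \<comment> \<open>Stated for either naming of the ends, so that the one with the smaller
        minimum may be called \<open>v\<close>.\<close>
      have main: ?thesis if vw: "ends X e = {v, w}" and less: "Min (f ` C v) < Min (f ` C w)" for v w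
      proof -
        have disj: "C v \<inter> C w = {}"
        proof (rule ccontr)
          assume "C v \<inter> C w \<noteq> {}"
          then have "C v = C w" unfolding C_def using component_cells_eq by (metis IntE ex_in_conv)
          then show False using self[of w] vw cl[OF vw] False by simp
        qed
        obtain r where r: "r \<in> cells X" "f r < f s" "top_critical X f (component Y (Inl v)) r" "lower X f r = C v"
          using tops[of v] vw by auto
        obtain r' where r': "r' \<in> cells X" "f r' < f s" "top_critical X f (component Y (Inl w)) r'" "lower X f r' = C w"
          using tops[of w] vw by auto
        obtain T where T: "node_tree X f r c T" "merge_tree T" "chir T = c" "lab T = f r"
          "labels T = f ` C v" "tree_family T = (\<lambda>t. f ` lower X f t) ` C v"
          using IH[OF r(1,2), of c] r(4) by metis
        obtain T' where T': "node_tree X f r' (opposite c) T'" "merge_tree T'" "chir T' = opposite c" "lab T' = f r'"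
          "labels T' = f ` C w" "tree_family T' = (\<lambda>t. f ` lower X f t) ` C w"
          using IH[OF r'(1,2), of "opposite c"] r'(4) by metis
        have "C v \<subseteq> cells X" "C w \<subseteq> cells X"
          using lower_sub[of X f r] lower_sub[of X f r'] r r' by auto
        then have "labels T \<inter> labels T' = {}"
          using inj_on_image_Int[OF inj, of "C v" "C w"] disj T T' by simp
        then have mt: "merge_tree (Node c (f s) [T, T'])"
          using T T' r r' less by (intro merge_tree.merge[of T T']) simp_all
        have "node_tree X f (Inr e) c (Node c (f (Inr e)) [T, T'])"
          by (rule node_tree.merge[OF e(2) False vw refl refl _ _ _ T(1) T'(1)])
            (use less r r' in \<open>simp_all add: C_def Y_def Inr\<close>)
        then have "node_tree X f s c (Node c (f s) [T, T'])" using Inr by simp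
        moreover have "labels (Node c (f s) [T, T']) = f ` lower X f s"
          using T T' low[OF vw] by (simp add: image_Un)
        ultimately show ?thesis using mt T T' low[OF vw]
          by (intro exI[of _ "Node c (f s) [T, T']"]) (simp add: image_Un del: labels_Node)
      qed
      have "f ` C v \<noteq> {}" "f ` C w \<noteq> {}" using self vw by auto
      moreover have sub: "C u \<subseteq> cells X" for u
        using component_cells_sub[of Y] by (auto simp: C_def Y_def cells_sublevel_less)
      then have "finite (f ` C u)" for u using finite finite_subset by blast
      ultimately have "Min (f ` C v) \<in> f ` C v" "Min (f ` C w) \<in> f ` C w" by simp_all
      moreover have "f ` C v \<inter> f ` C w = {}"
      proof (rule ccontr)
        assume "f ` C v \<inter> f ` C w \<noteq> {}"
        then obtain t where "t \<in> C v" "t \<in> C w" using sub inj_eq by blast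
        then have "C v = C w" unfolding C_def using component_cells_eq by metis
        then show False using self[of w] vw cl[OF vw] False by simp
      qed
      ultimately have "Min (f ` C v) \<noteq> Min (f ` C w)" by (metis disjoint_iff)
      then consider "Min (f ` C v) < Min (f ` C w)" | "Min (f ` C w) < Min (f ` C v)" by linarith
      then show ?thesis
      proof cases
        case 1
        with vw show ?thesis by (rule main)
      next
        case 2
        have "ends X e = {w, v}" using vw by (simp add: insert_commute)
        then show ?thesis using 2 by (rule main)
      qed
    qed
  qed
qed

text \<open>In a connected graph with an edge, every vertex lies on an edge of larger value, so the
  top cell is an edge; without edges the graph is a single vertex.\<close>

lemma root_cell_iff:
  assumes "connected_graph X"
  shows "root_cell X f s \<longleftrightarrow> s \<in> cells X \<and> (\<forall>t\<in>cells X. f t \<le> f s)"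
proof (cases "edges X = {}")
  case True
  then have ex: "\<not> (\<exists>e. critical X f (Inr e))" by (simp add: critical_iff)
  have "component_cells X s \<subseteq> {s}" for s
    by (rule component_cells_least) (use True in \<open>auto simp: incident_def proper_face_def\<close>)
  then have one: "cells X = {s}" if "s \<in> cells X" for s
    using connected_component_cells[OF assms that] that by auto
  show ?thesis
  proof
    assume "root_cell X f s"
    then have "s \<in> cells X" by (simp add: root_cell_def critical_iff)
    moreover from this have "cells X = {s}" by (rule one)
    ultimately show "s \<in> cells X \<and> (\<forall>t\<in>cells X. f t \<le> f s)" by simp
  next
    assume s: "s \<in> cells X \<and> (\<forall>t\<in>cells X. f t \<le> f s)"
    then have "\<exists>v. s = Inl v" using True by (cases s) auto
    then show "root_cell X f s" using s ex by (simp add: root_cell_def critical_iff)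
  qed
next
  case False
  then have ex: "\<exists>e. critical X f (Inr e)" by (auto simp: critical_iff)
  have dom: "\<exists>e\<in>edges X. f s \<le> f (Inr e)" if "s \<in> cells X" for s
  proof (cases s)
    case (Inl v)
    obtain e where e: "e \<in> edges X" using False by blast
    then have "(Inl v, Inr e) \<in> (incident X)\<^sup>*"
      using that Inl assms by (simp add: connected_graph_def)
    then obtain t where "(Inl v, t) \<in> incident X" by (auto elim: converse_rtranclE)
    then obtain e' where "proper_face X (Inl v) (Inr e')" "e' \<in> edges X"
      by (auto simp: incident_def proper_face_def)
    then show ?thesis using face_less Inl by (metis less_imp_le)
  qed (use that in auto)
  show ?thesis
  proof
    assume "root_cell X f s"
    then obtain e where "s = Inr e" "e \<in> edges X" "\<And>e'. e' \<in> edges X \<Longrightarrow> f (Inr e') \<le> f (Inr e)"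
      using ex by (auto simp: root_cell_def critical_iff)
    then show "s \<in> cells X \<and> (\<forall>t\<in>cells X. f t \<le> f s)" using dom by (metis Inr_in_cells order_trans)
  next
    assume s: "s \<in> cells X \<and> (\<forall>t\<in>cells X. f t \<le> f s)"
    then obtain e where e: "e \<in> edges X" "f s \<le> f (Inr e)" using dom by blast
    then have "f s = f (Inr e)" using s by (intro order_antisym) auto
    then have "s = Inr e" using s e by (simp add: inj_eq)
    then show "root_cell X f s" using s ex by (simp add: root_cell_def critical_iff)
  qed
qed

text \<open>The sublevel complex of the top cell is the whole connected graph, so the family of the
  tree at the root ranges over all cells.\<close>

theorem induced_tree_family:
  assumes "connected_graph X"
  shows "merge_tree (induced_tree X f) \<and> chir (induced_tree X f) = Lft \<and>
    tree_family (induced_tree X f) = merge_family X f"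
proof -
  have "cells X \<noteq> {}" using assms by (simp add: connected_graph_def)
  then have "Max (f ` cells X) \<in> f ` cells X" using finite by (intro Max_in) auto
  then obtain s where s: "s \<in> cells X" "f s = Max (f ` cells X)" by auto
  then have max: "\<forall>t\<in>cells X. f t \<le> f s" using finite by simp
  have root: "root_cell X f r \<longleftrightarrow> r = s" for r
    using root_cell_iff[OF assms] s max inj_eq by (metis order_antisym)
  obtain T where T: "node_tree X f s Lft T" "merge_tree T" "chir T = Lft"
    "tree_family T = (\<lambda>t. f ` lower X f t) ` lower X f s"
    using node_tree_exists[OF s(1)] by metis
  have "induced_tree X f = T"
    unfolding induced_tree_def root using T(1) node_tree_unique by (intro the_equality) auto
  moreover have "lower X f s = cells X"
  proof -
    have "sublevel X f (f s) = restrict_cells X UNIV"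
      unfolding sublevel_def using max by (intro restrict_cong) auto
    then show ?thesis using connected_component_cells[OF assms s(1)] by (simp add: lower_def)
  qed
  ultimately show ?thesis using T by (simp add: merge_family_def)
qed

text \<open>Two elements mean an edge with a single further cell: its ends coincide and their strict
  component is a bare vertex, which is the excluded self-loop.\<close>

theorem no_initial_loops_iff: "no_initial_loops X f \<longleftrightarrow> (\<forall>A\<in>merge_family X f. card A \<noteq> 2)"
proof
  assume nl: "no_initial_loops X f"
  show "\<forall>A\<in>merge_family X f. card A \<noteq> 2"
  proof (intro ballI notI)
    fix A assume "A \<in> merge_family X f" "card A = 2"
    then obtain s where s: "s \<in> cells X" "card (f ` lower X f s) = 2"
      by (auto simp: merge_family_def)
    have "inj_on f (lower X f s)" using inj lower_sub[of X f s] inj_on_subset by blast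
    then have two: "card (lower X f s) = 2" using s(2) by (simp add: card_image)
    then obtain e where e: "s = Inr e" "e \<in> edges X"
      using s(1) lower_vertex by (cases s) auto
    let ?C = "\<lambda>v. component_cells (sublevel_less X f (f (Inr e))) (Inl v)"
    obtain v w where vw: "ends X e = {v, w}" using multigraph_ends[OF graph e(2)] .
    have L: "lower X f s = insert (Inr e) (?C v \<union> ?C w)" using lower_edge[OF e(2) vw] e by simp
    have self: "Inl v \<in> ?C v" "Inl w \<in> ?C w"
      using ends_less[OF e(2)] vw by (simp_all add: component_cells_self cells_sublevel_less)
    obtain x y where "lower X f s = {x, y}" using two by (meson card_2_iff)
    then have "\<And>t. t \<in> ?C v \<union> ?C w \<Longrightarrow> t \<in> {x, y}" "Inr e \<in> {x, y}" using L by auto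
    moreover have "Inr e \<notin> ?C v"
      using component_cells_sub[of "sublevel_less X f (f (Inr e))"] by (auto simp: cells_sublevel_less)
    ultimately have "v = w" "?C v = {Inl v}" using self by blast+
    then have "edges (component (sublevel_less X f (f (Inr e))) (Inl v)) = {}"
      by (metis (no_types, lifting) cells_component Inr_in_cells ex_in_conv singletonD sum.distinct(1))
    then show False using nl e vw \<open>v = w\<close> by (auto simp: no_initial_loops_def)
  qed
next
  assume two: "\<forall>A\<in>merge_family X f. card A \<noteq> 2"
  show "no_initial_loops X f"
    unfolding no_initial_loops_def
  proof (intro ballI allI impI notI)
    fix e v assume e: "e \<in> edges X" "ends X e = {v}"
    let ?Y = "sublevel_less X f (f (Inr e))"
    assume "edges (component ?Y (Inl v)) = {}"
    then have no_edge: "Inr d \<notin> component_cells ?Y (Inl v)" for d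
      by (metis cells_component Inr_in_cells empty_iff)
    have self: "Inl v \<in> component_cells ?Y (Inl v)"
      using ends_less[OF e(1)] e by (intro component_cells_self) (simp add: cells_sublevel_less)
    have "component_cells ?Y (Inl v) \<subseteq> {Inl v}"
    proof (rule component_cells_least)
      fix t u assume "t \<in> {Inl v :: 'v + 'e}" "(t, u) \<in> incident ?Y"
      then have "(Inl v, u) \<in> incident ?Y" by simp
      then have "u \<in> component_cells ?Y (Inl v)" using self component_cells_incident by metis
      moreover have "\<exists>d. u = Inr d" using \<open>(Inl v, u) \<in> incident ?Y\<close>
        by (auto simp: incident_def proper_face_def)
      ultimately show "u \<in> {Inl v}" using no_edge by blast
    qed simp
    then have "lower X f (Inr e) = {Inr e, Inl v}"
      using lower_edge[of e v v] e self by auto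
    moreover have "f (Inr e) \<noteq> f (Inl v)" using ends_less[OF e(1)] e by force
    ultimately have "card (f ` lower X f (Inr e)) = 2" by simp
    then show False using two e by (auto simp: merge_family_def)
  qed
qed

end

section \<open>Graphs realizing a merge tree\<close>

lemma merge_tree_lab_inj:
  assumes "merge_tree T" "p \<in> set (subtrees T)" "q \<in> set (subtrees T)" "lab p = lab q"
  shows "p = q"
  using merge_tree_distinct[OF assms(1)] assms(2-4) by (auto simp: distinct_map inj_on_def)

text \<open>Siblings have disjoint labels, which makes the label sets of subtrees a laminar
  family.\<close>

lemma merge_tree_nested:
  "merge_tree T \<Longrightarrow> p \<in> set (subtrees T) \<Longrightarrow> q \<in> set (subtrees T) \<Longrightarrow> labels p \<inter> labels q \<noteq> {} \<Longrightarrow>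
    p \<in> set (subtrees q) \<or> q \<in> set (subtrees p)"
proof (induction rule: merge_tree.induct)
  case (merge t u c x ts)
  have "p = Node c x ts \<or> p \<in> set (subtrees t) \<or> p \<in> set (subtrees u)"
    "q = Node c x ts \<or> q \<in> set (subtrees t) \<or> q \<in> set (subtrees u)"
    using merge.prems merge.hyps(9) by auto
  moreover have "\<not> (p \<in> set (subtrees t) \<and> q \<in> set (subtrees u))" "\<not> (p \<in> set (subtrees u) \<and> q \<in> set (subtrees t))"
    using labels_subtree merge.hyps(7) merge.prems(3) by blast+
  ultimately show ?case using merge.IH merge.prems by blast
qed auto

lemma child_subtree: "t \<in> set (children p) \<Longrightarrow> t \<in> set (subtrees p)"
  by (cases p) (auto intro: subtrees_self)

lemma merge_tree_child_less:
  "merge_tree p \<Longrightarrow> t \<in> set (children p) \<Longrightarrow> y \<in> labels t \<Longrightarrow> y < lab p"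
  using merge_tree_children_less by (cases p) auto

text \<open>Isolates what forces a graph to have the family of \<open>T\<close>: a vertex for each
  leaf, an edge for each inner node, and ends that lie below the children and reach every child.
  Which vertices below a child serve as ends is left open. For a node with one child both ends lie
  below it.\<close>

locale realization =
  fixes X :: "('v, 'e) multigraph" and f :: "'v + 'e \<Rightarrow> real" and T :: ltree
  assumes graph: "multigraph X" and inj: "inj_on f (cells X)" and tree: "merge_tree T"
    and vals: "f ` cells X \<subseteq> labels T"
    and leaf: "\<And>p. p \<in> set (subtrees T) \<Longrightarrow> children p = [] \<Longrightarrow> \<exists>v\<in>verts X. f (Inl v) = lab p"
    and inner: "\<And>p. p \<in> set (subtrees T) \<Longrightarrow> children p \<noteq> [] \<Longrightarrow>
      \<exists>e\<in>edges X. f (Inr e) = lab p \<and> (\<forall>v\<in>ends X e. \<exists>t\<in>set (children p). f (Inl v) \<in> labels t) \<and>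
        (\<forall>t\<in>set (children p). \<exists>v\<in>ends X e. f (Inl v) \<in> labels t)"
begin

lemma cell_eqI: "s \<in> cells X \<Longrightarrow> t \<in> cells X \<Longrightarrow> f s = f t \<Longrightarrow> s = t"
  using inj by (simp add: inj_on_def)

lemma node_cell: "p \<in> set (subtrees T) \<Longrightarrow> \<exists>s\<in>cells X. f s = lab p"
  using leaf[of p] inner[of p] by (metis Inl_in_cells Inr_in_cells)

text \<open>\<open>inner\<close> only promises some edge with the label of a node; by injectivity it
  is the given edge. The node is not a leaf, as the label of a leaf is already taken by a
  vertex.\<close>

lemma edge_node:
  assumes e: "e \<in> edges X"
  obtains p where "p \<in> set (subtrees T)" "lab p = f (Inr e)"
    and "\<And>v. v \<in> ends X e \<Longrightarrow> \<exists>t\<in>set (children p). f (Inl v) \<in> labels t"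
    and "\<And>t. t \<in> set (children p) \<Longrightarrow> \<exists>v\<in>ends X e. f (Inl v) \<in> labels t"
proof -
  have "f (Inr e) \<in> labels T" using e vals by auto
  then obtain p where p: "p \<in> set (subtrees T)" "lab p = f (Inr e)" by (auto simp: labels_def)
  have "children p \<noteq> []"
  proof
    assume "children p = []"
    then obtain v where "v \<in> verts X" "f (Inl v) = f (Inr e)" using leaf p by metis
    then have "Inl v = (Inr e :: 'v + 'e)" using e by (intro cell_eqI) auto
    then show False by simp
  qed
  then obtain d where d: "d \<in> edges X" "f (Inr d) = f (Inr e)"
    and "\<forall>v\<in>ends X d. \<exists>t\<in>set (children p). f (Inl v) \<in> labels t"
    and "\<forall>t\<in>set (children p). \<exists>v\<in>ends X d. f (Inl v) \<in> labels t"
    using inner[OF p(1)] p(2) by metis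
  moreover have "Inr d = (Inr e :: 'v + 'e)" using d e by (intro cell_eqI) auto
  ultimately show ?thesis using that p by simp
qed

lemma critical_dMf: "critical_dMf X f"
  unfolding critical_dMf_iff
proof (intro conjI allI impI)
  fix s t assume "proper_face X s t"
  then obtain v e where e: "s = Inl v" "t = Inr e" "e \<in> edges X" "v \<in> ends X e"
    by (auto simp: proper_face_def)
  obtain p where p: "p \<in> set (subtrees T)" "lab p = f (Inr e)"
    and "\<exists>t\<in>set (children p). f (Inl v) \<in> labels t"
    using edge_node[OF e(3)] e(4) by metis
  then show "f s \<le> f t"
    using merge_tree_child_less[OF merge_tree_subtree[OF tree p(1)]] e by force
qed (rule inj)

sublocale morse_graph X f
  using graph critical_dMf by unfold_locales

text \<open>An incidence leaving the cells of \<open>p\<close> would involve an edge whose node lies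
  properly above \<open>p\<close>, and its label would exceed the level. Conversely the edge of
  \<open>p\<close> has an end below each child, and by induction that end is linked to all cells
  below the child.\<close>

lemma lower_eq:
  assumes "p \<in> set (subtrees T)" "s \<in> cells X" "f s = lab p"
  shows "lower X f s = {t \<in> cells X. f t \<in> labels p}"
  using assms
proof (induction p arbitrary: s)
  case (Node c x ts)
  let ?p = "Node c x ts"
  let ?S = "{t \<in> cells X. f t \<in> labels ?p}"
  have mp: "merge_tree ?p" using tree Node.prems(1) by (rule merge_tree_subtree)
  have child: "t \<in> set (subtrees T)" if "t \<in> set ts" for t
    using that Node.prems(1) subtrees_trans[OF child_subtree[of t ?p]] by simp
  show ?case
  proof
    show "lower X f s \<subseteq> ?S"
      unfolding lower_def
    proof (rule component_cells_least)
      show "s \<in> ?S" using Node.prems by simp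
      fix t u assume t: "t \<in> ?S" and tu: "(t, u) \<in> incident (sublevel X f (f s))"
      have tu: "(t, u) \<in> incident X" "f t \<le> x" "f u \<le> x" using tu Node.prems by (simp_all add: incident_sublevel)
      then have u: "u \<in> cells X" using incident_cells by metis
      obtain v e where ve: "v \<in> ends X e" "e \<in> edges X" "(t = Inl v \<and> u = Inr e) \<or> (t = Inr e \<and> u = Inl v)"
        using tu(1) by (auto simp: incident_def proper_face_def)
      obtain q where q: "q \<in> set (subtrees T)" "lab q = f (Inr e)"
        and qv: "\<exists>r\<in>set (children q). f (Inl v) \<in> labels r"
        using edge_node[OF ve(2)] ve(1) by metis
      have v_in: "f (Inl v) \<in> labels q" using qv labels_subtree[OF child_subtree] by blast
      have "labels q \<inter> labels ?p \<noteq> {}"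
        using ve(3) t v_in lab_in_labels[of q] q(2) by auto
      then have "q \<in> set (subtrees ?p) \<or> ?p \<in> set (subtrees q)"
        using merge_tree_nested[OF tree q(1) Node.prems(1)] by blast
      \<comment> \<open>An ancestor has a label at least \<open>x\<close>, while the level bounds
        \<open>lab q\<close> by \<open>x\<close>.\<close>
      moreover have "q = ?p" if "?p \<in> set (subtrees q)"
      proof (rule merge_tree_lab_inj[OF tree q(1) Node.prems(1)])
        have "x \<in> labels q" using that lab_in_labels[of ?p] labels_subtree by fastforce
        then have "x \<le> lab q" using merge_tree_labels_le[OF merge_tree_subtree[OF tree q(1)]] by simp
        moreover have "lab q \<le> x" using ve(3) tu q(2) by auto
        ultimately show "lab q = lab ?p" by simp
      qed
      ultimately have "labels q \<subseteq> labels ?p" using labels_subtree by blast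
      then have "f (Inl v) \<in> labels ?p" "f (Inr e) \<in> labels ?p"
        using v_in lab_in_labels[of q] q(2) by auto
      then show "u \<in> ?S" using ve(3) u by auto
    qed
    show "?S \<subseteq> lower X f s"
    proof
      fix r assume r: "r \<in> ?S"
      show "r \<in> lower X f s"
      proof (cases "f r = x")
        case True
        then have "r = s" using r Node.prems by (intro cell_eqI) auto
        then show ?thesis using Node.prems lower_self by simp
      next
        case False
        then obtain t where t: "t \<in> set ts" "f r \<in> labels t" using r by auto
        obtain s' where s': "s' \<in> cells X" "f s' = lab t" using node_cell[OF child[OF t(1)]] by blast
        have low: "lower X f s' = {u \<in> cells X. f u \<in> labels t}"
          using Node.IH[OF t(1) child[OF t(1)] s'] .
        obtain e where e: "e \<in> edges X" "f (Inr e) = x" "\<exists>v\<in>ends X e. f (Inl v) \<in> labels t"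
          using inner[OF Node.prems(1)] t(1) by force
        then obtain v where v: "v \<in> ends X e" "f (Inl v) \<in> labels t" by blast
        have s: "s = Inr e" using e Node.prems by (intro cell_eqI) auto
        have vX: "v \<in> verts X" "f (Inl v) < x" using ends_less[OF e(1) v(1)] e(2) by auto
        have "(s, Inl v) \<in> incident (sublevel X f (f s))"
          using s e v vX by (simp add: incident_sublevel incident_Inr)
        then have "Inl v \<in> lower X f s"
          using lower_self[OF Node.prems(2)] component_cells_incident unfolding lower_def by metis
        then have "component_cells (sublevel X f (f s)) (Inl v) = lower X f s"
          unfolding lower_def by (rule component_cells_eq)
        moreover have "Inl v \<in> lower X f s'" "r \<in> lower X f s'" using low v vX r t by auto
        then have "r \<in> component_cells (sublevel X f (f s')) (Inl v)"
          unfolding lower_def using component_cells_eq by metis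
        moreover have "f s' \<le> f s"
          using merge_tree_children_less[OF mp t(1) lab_in_labels] s' Node.prems by simp
        ultimately show ?thesis using component_sublevel_mono by blast
      qed
    qed
  qed
qed

lemma lower_image:
  assumes "p \<in> set (subtrees T)" "s \<in> cells X" "f s = lab p"
  shows "f ` lower X f s = labels p"
proof
  show "f ` lower X f s \<subseteq> labels p" using lower_eq[OF assms] by auto
  show "labels p \<subseteq> f ` lower X f s"
  proof
    fix y assume y: "y \<in> labels p"
    then obtain q where "q \<in> set (subtrees T)" "lab q = y"
      using assms(1) subtrees_trans by (auto simp: labels_def)
    then obtain t where "t \<in> cells X" "f t = y" using node_cell by blast
    then show "y \<in> f ` lower X f s" using lower_eq[OF assms] y by auto
  qed
qed

lemma merge_family_eq: "merge_family X f = tree_family T"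
proof
  show "merge_family X f \<subseteq> tree_family T"
  proof
    fix A assume "A \<in> merge_family X f"
    then obtain s where s: "s \<in> cells X" "A = f ` lower X f s" by (auto simp: merge_family_def)
    then have "f s \<in> labels T" using vals by auto
    then obtain p where "p \<in> set (subtrees T)" "lab p = f s" by (auto simp: labels_def)
    then show "A \<in> tree_family T" using lower_image[of p s] s by (simp add: tree_family_def)
  qed
  show "tree_family T \<subseteq> merge_family X f"
  proof
    fix A assume "A \<in> tree_family T"
    then obtain p where p: "p \<in> set (subtrees T)" "A = labels p" by (auto simp: tree_family_def)
    obtain s where "s \<in> cells X" "f s = lab p" using node_cell[OF p(1)] by blast
    then show "A \<in> merge_family X f" using lower_image[of p s] p by (auto simp: merge_family_def)
  qed
qed

lemma connected: "connected_graph X"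
proof -
  obtain r where r: "r \<in> cells X" "f r = lab T" using node_cell[OF subtrees_self] by blast
  then have "lower X f r = cells X" using lower_eq[OF subtrees_self] vals by auto
  moreover have "incident (sublevel X f (f r)) \<subseteq> incident X" by (auto simp: incident_sublevel)
  ultimately have reach: "(r, s) \<in> (incident X)\<^sup>*" if "s \<in> cells X" for s
    using that rtrancl_mono unfolding lower_def component_cells_def by blast
  then show ?thesis
    unfolding connected_graph_def using r reach_sym rtrancl_trans by (metis empty_iff)
qed

end

section \<open>The word of a merge tree\<close>

lemma chir_remove_cycle_nodes: "merge_tree T \<Longrightarrow> chir (remove_cycle_nodes T) = chir T"
  by (induction rule: merge_tree.induct) auto

lemma merge_tree_branch_word:
  assumes "merge_tree l" "merge_tree r" "chir l = Lft" "chir r = Rgt" and "ts = [l, r] \<or> ts = [r, l]"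
  shows "phi_word (Node c x ts) = phi_word l @ x # phi_word r"
    and "phi_length (Node c x ts) = Suc (phi_length l + phi_length r)"
  using assms chir_remove_cycle_nodes by (auto simp: phi_word_def phi_length_def inner_nodes_def)

text \<open>The word orders children by chirality, \<open>merge_tree\<close> by minima. This rule
  names them left and right and absorbs the case split on the chirality of the node.\<close>

lemma merge_tree_phi_induct [consumes 1, case_names leaf cycle branch]:
  assumes "merge_tree T"
    and "\<And>c x. phi_word (Node c x []) = [x] \<Longrightarrow> phi_length (Node c x []) = 0 \<Longrightarrow> P (Node c x [])"
    and "\<And>c x t. merge_tree (Node c x [t]) \<Longrightarrow> merge_tree t \<Longrightarrow> P t \<Longrightarrow>
      phi_word (Node c x [t]) = phi_word t \<Longrightarrow> phi_length (Node c x [t]) = phi_length t \<Longrightarrow> P (Node c x [t])"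
    and "\<And>c x ts l r. merge_tree (Node c x ts) \<Longrightarrow> merge_tree l \<Longrightarrow> merge_tree r \<Longrightarrow> P l \<Longrightarrow> P r \<Longrightarrow>
      length ts = 2 \<Longrightarrow> set ts = {l, r} \<Longrightarrow> labels l \<inter> labels r = {} \<Longrightarrow>
      phi_word (Node c x ts) = phi_word l @ x # phi_word r \<Longrightarrow>
      phi_length (Node c x ts) = Suc (phi_length l + phi_length r) \<Longrightarrow> P (Node c x ts)"
  shows "P T"
  using assms(1)
proof (induction rule: merge_tree.induct)
  case (leaf c x)
  show ?case by (rule assms(2)) (simp_all add: phi_word_def phi_length_def inner_nodes_def)
next
  case (cycle t c x)
  show ?case
    by (rule assms(3)) (use cycle in \<open>auto simp: phi_word_def phi_length_def intro: merge_tree.cycle\<close>)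
next
  case (merge t u c x ts)
  have T: "merge_tree (Node c x ts)" using merge.hyps by (rule merge_tree.merge)
  show ?case
  proof (cases c)
    case Lft
    then have ch: "chir t = Lft" "chir u = Rgt" using merge.hyps by auto
    show ?thesis
      by (rule assms(4)[OF T merge.hyps(1,2) merge.IH])
        (use merge.hyps ch merge_tree_branch_word[of t u ts] in auto)
  next
    case Rgt
    then have ch: "chir u = Lft" "chir t = Rgt" using merge.hyps by auto
    show ?thesis
      by (rule assms(4)[OF T merge.hyps(2,1) merge.IH(2,1)])
        (use merge.hyps ch merge_tree_branch_word[of u t ts] in auto)
  qed
qed

lemma length_phi_word: "merge_tree T \<Longrightarrow> length (phi_word T) = 2 * phi_length T + 1"
  by (induction rule: merge_tree_phi_induct) auto

text \<open>Nodes with one child contribute no letter, which later separates the values on the path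
  from those of the cycle edges.\<close>

lemma set_phi_word:
  "merge_tree T \<Longrightarrow> set (phi_word T) \<subseteq> lab ` {p \<in> set (subtrees T). length (children p) \<noteq> 1}"
proof (induction rule: merge_tree_phi_induct)
  case (branch c x ts l r)
  let ?N = "\<lambda>T. {p \<in> set (subtrees T). length (children p) \<noteq> 1}"
  have "?N l \<subseteq> ?N (Node c x ts)" "?N r \<subseteq> ?N (Node c x ts)" "Node c x ts \<in> ?N (Node c x ts)"
    using branch.hyps by auto
  then have "lab ` ?N l \<subseteq> lab ` ?N (Node c x ts)" "lab ` ?N r \<subseteq> lab ` ?N (Node c x ts)"
    "x \<in> lab ` ?N (Node c x ts)" by (blast, blast, force)
  then show ?case using branch.hyps(7) branch.IH by auto
qed auto

lemma set_phi_word_labels: "merge_tree T \<Longrightarrow> set (phi_word T) \<subseteq> labels T"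
  using set_phi_word by (auto simp: labels_def)

lemma distinct_phi_word: "merge_tree T \<Longrightarrow> distinct (phi_word T)"
proof (induction rule: merge_tree_phi_induct)
  case (branch c x ts l r)
  have "x \<notin> labels l" "x \<notin> labels r"
    using merge_tree_children_less[OF branch.hyps(1)] branch.hyps by blast+
  then show ?case using branch set_phi_word_labels[of l] set_phi_word_labels[of r] by auto
qed simp_all

text \<open>The word of a right child is shifted by \<open>2 * Suc (phi_length l)\<close>, an even
  number, so leaves stay at even positions.\<close>

lemma phi_word_leaf:
  "merge_tree T \<Longrightarrow> p \<in> set (subtrees T) \<Longrightarrow> children p = [] \<Longrightarrow>
    \<exists>i\<le>phi_length T. phi_word T ! (2 * i) = lab p"
proof (induction rule: merge_tree_phi_induct)
  case (branch c x ts l r)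
  have "p \<in> set (subtrees l) \<or> p \<in> set (subtrees r)" using branch.prems branch.hyps by auto
  then show ?case
  proof
    assume "p \<in> set (subtrees l)"
    then obtain i where i: "i \<le> phi_length l" "phi_word l ! (2 * i) = lab p" using branch by blast
    then have "phi_word (Node c x ts) ! (2 * i) = lab p"
      using branch.hyps by (simp add: nth_append length_phi_word)
    then show ?thesis using i branch.hyps by (intro exI[of _ i]) simp
  next
    assume "p \<in> set (subtrees r)"
    then obtain i where i: "i \<le> phi_length r" "phi_word r ! (2 * i) = lab p" using branch by blast
    have "phi_word (Node c x ts) ! (2 * (Suc (phi_length l) + i)) = lab p"
      using branch.hyps i by (simp add: nth_append length_phi_word)
    then show ?thesis using i branch.hyps by (intro exI[of _ "Suc (phi_length l) + i"]) simp
  qed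
qed auto

text \<open>The neighbours of the letter of a branching node are the last letter of its left word
  and the first of its right word, so the path edge has one end below each child.\<close>

lemma phi_word_branch:
  "merge_tree T \<Longrightarrow> p \<in> set (subtrees T) \<Longrightarrow> length (children p) = 2 \<Longrightarrow>
    \<exists>i<phi_length T. phi_word T ! (2 * i + 1) = lab p \<and>
      (\<exists>t u. set (children p) = {t, u} \<and> phi_word T ! (2 * i) \<in> labels t \<and> phi_word T ! (2 * Suc i) \<in> labels u)"
proof (induction rule: merge_tree_phi_induct)
  case (branch c x ts l r)
  note len = length_phi_word[OF branch.hyps(2)] length_phi_word[OF branch.hyps(3)]
  consider "p = Node c x ts" | "p \<in> set (subtrees l)" | "p \<in> set (subtrees r)"
    using branch.prems branch.hyps by auto
  then show ?case
  proof cases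
    case 1
    \<comment> \<open>Counting from 0, the left word ends at position \<open>2 * ?i\<close>, and the
      letter of the node follows at \<open>2 * ?i + 1\<close>.\<close>
    let ?i = "phi_length l"
    have "phi_word l ! (2 * ?i) \<in> labels l"
      using set_phi_word_labels[OF branch.hyps(2)] len by (auto intro!: subsetD[OF _ nth_mem])
    moreover have "phi_word r ! 0 \<in> labels r"
      using set_phi_word_labels[OF branch.hyps(3)] len by (auto intro!: subsetD[OF _ nth_mem])
    ultimately show ?thesis using branch.hyps len 1
      by (intro exI[of _ ?i] conjI exI[of _ l] exI[of _ r]) (simp_all add: nth_append)
  next
    case 2
    then obtain i t u where i: "i < phi_length l" "phi_word l ! (2 * i + 1) = lab p" "set (children p) = {t, u}"
      "phi_word l ! (2 * i) \<in> labels t" "phi_word l ! (2 * Suc i) \<in> labels u"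
      using branch by blast
    then show ?thesis using branch.hyps len
      by (intro exI[of _ i] conjI exI[of _ t] exI[of _ u]) (simp_all add: nth_append)
  next
    case 3
    then obtain i t u where i: "i < phi_length r" "phi_word r ! (2 * i + 1) = lab p" "set (children p) = {t, u}"
      "phi_word r ! (2 * i) \<in> labels t" "phi_word r ! (2 * Suc i) \<in> labels u"
      using branch by blast
    then show ?thesis using branch.hyps len
      by (intro exI[of _ "Suc (phi_length l) + i"] conjI exI[of _ t] exI[of _ u]) (simp_all add: nth_append)
  qed
qed auto

section \<open>The induced function realizes its tree\<close>

definition siblings_of_leaves :: "ltree \<Rightarrow> bool" where
  "siblings_of_leaves T \<longleftrightarrow>
     (\<forall>p\<in>set (subtrees T). \<forall>q\<in>set (children p). children q = [] \<longrightarrow> length (children p) \<noteq> 1)"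

text \<open>A chain of nodes with one child cannot end in a leaf, as that leaf would have no
  sibling.\<close>

lemma oldest_branching_branches:
  "merge_tree p \<Longrightarrow> siblings_of_leaves p \<Longrightarrow> children p \<noteq> [] \<Longrightarrow>
    oldest_branching p \<in> set (subtrees p) \<and> length (children (oldest_branching p)) = 2"
proof (induction rule: merge_tree.induct)
  case (cycle t c x)
  have "siblings_of_leaves t" using cycle.prems(1) by (auto simp: siblings_of_leaves_def)
  moreover have "children t \<noteq> []" using cycle.prems(1) by (auto simp: siblings_of_leaves_def)
  ultimately show ?case using cycle by simp
qed auto

lemma oldest_branching_cycle: "children p = [t] \<Longrightarrow> oldest_branching p = oldest_branching t"
  by (cases p) simp

locale gML =
  fixes T assumes gML: "gML_tree T"
begin

lemma tree: "merge_tree T"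
  using gML gML_tree_merge_tree by blast

text \<open>The branching node whose path edge is doubled lies in the subtree of the only child
  \<open>t\<close>, and hence so do the leaves at the ends of that edge. This is what
  \<open>realization\<close> demands for a node with one child.\<close>

lemma cycle_edge_index:
  assumes p: "p \<in> cycle_nodes T"
  obtains t i where "children p = [t]" "i < phi_length T" "parallel_index T (lab p) = i"
    "phi_word T ! (2 * i) \<in> labels t" "phi_word T ! (2 * Suc i) \<in> labels t"
proof -
  have pT: "p \<in> set (subtrees T)" and "length (children p) = 1" using p by (auto simp: cycle_nodes_def)
  then obtain t where t: "children p = [t]" by (metis length_0_conv length_Suc_conv One_nat_def)
  have sib: "siblings_of_leaves T"
    using gML by (auto simp: gML_tree_def generalized_merge_tree_def siblings_of_leaves_def)
  have tp: "t \<in> set (subtrees p)" using t by (intro child_subtree) simp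
  then have tT: "t \<in> set (subtrees T)" using pT by (rule subtrees_trans)
  have "siblings_of_leaves t" using sib subtrees_trans[OF _ tT] by (auto simp: siblings_of_leaves_def)
  moreover have "children t \<noteq> []" using sib pT t by (auto simp: siblings_of_leaves_def)
  ultimately have q: "oldest_branching p \<in> set (subtrees t)" "length (children (oldest_branching p)) = 2"
    using oldest_branching_branches[OF merge_tree_subtree[OF tree tT]] oldest_branching_cycle[OF t] by auto
  then have qT: "oldest_branching p \<in> set (subtrees T)" using tT subtrees_trans by blast
  obtain i u w where i: "i < phi_length T" "phi_word T ! (2 * i + 1) = lab (oldest_branching p)"
    "set (children (oldest_branching p)) = {u, w}"
    "phi_word T ! (2 * i) \<in> labels u" "phi_word T ! (2 * Suc i) \<in> labels w"
    using phi_word_branch[OF tree qT q(2)] by blast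
  have "labels u \<subseteq> labels t" "labels w \<subseteq> labels t"
    using labels_subtree[OF child_subtree[of _ "oldest_branching p"]] labels_subtree[OF q(1)] i(3) by blast+
  \<comment> \<open>The description is unique: a label determines its cycle node, and a letter
    occurs only once in the word.\<close>
  moreover have "parallel_index T (lab p) = i"
    unfolding parallel_index_def
  proof (rule the_equality)
    show "i < phi_length T \<and> (\<exists>c\<in>cycle_nodes T. lab c = lab p \<and> phi_word T ! (2 * i + 1) = lab (oldest_branching c))"
      using i p by blast
    fix j assume "j < phi_length T \<and> (\<exists>c\<in>cycle_nodes T. lab c = lab p \<and> phi_word T ! (2 * j + 1) = lab (oldest_branching c))"
    then obtain c where j: "j < phi_length T" "c \<in> cycle_nodes T" "lab c = lab p"
      "phi_word T ! (2 * j + 1) = lab (oldest_branching c)" by blast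
    then have "c = p" using merge_tree_lab_inj[OF tree _ pT] by (simp add: cycle_nodes_def)
    then have "phi_word T ! (2 * j + 1) = phi_word T ! (2 * i + 1)" using i j by simp
    then have "2 * j + 1 = 2 * i + 1"
      using distinct_phi_word[OF tree] i j length_phi_word[OF tree] by (simp add: nth_eq_iff_index_eq)
    then show "j = i" by simp
  qed
  ultimately show ?thesis using that[OF t i(1)] i(4,5) by blast
qed

lemma Phi_edge_cases:
  assumes "e \<in> edges (Phi_graph T)"
  obtains (path) i where "e = PathEdge i" "i < phi_length T"
  | (cycle) p where "e = CycleEdge (lab p)" "p \<in> cycle_nodes T"
  using assms by (auto simp: Phi_graph_def)

lemma Phi_ends:
  assumes e: "e \<in> edges (Phi_graph T)"
  obtains i where "i < phi_length T" "ends (Phi_graph T) e = {i, Suc i}"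
  using e
proof (cases rule: Phi_edge_cases)
  case (path i)
  then show ?thesis using that[of i] by (simp add: Phi_graph_def)
next
  case (cycle p)
  obtain i where "i < phi_length T" "parallel_index T (lab p) = i"
    using cycle_edge_index[OF cycle(2)] by metis
  then show ?thesis using cycle that[of i] by (simp add: Phi_graph_def)
qed

lemma finite_cycle_nodes: "finite (cycle_nodes T)"
  by (simp add: cycle_nodes_def)

lemma multigraph_Phi: "multigraph (Phi_graph T)"
  unfolding multigraph_def
proof (intro conjI ballI)
  show "finite (verts (Phi_graph T))" "finite (edges (Phi_graph T))"
    using finite_cycle_nodes by (simp_all add: Phi_graph_def)
  fix e assume "e \<in> edges (Phi_graph T)"
  then obtain i where "i < phi_length T" "ends (Phi_graph T) e = {i, Suc i}" by (rule Phi_ends)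
  then show "ends (Phi_graph T) e \<subseteq> verts (Phi_graph T)" "card (ends (Phi_graph T) e) \<in> {1, 2}"
    by (auto simp: Phi_graph_def)
qed

text \<open>Vertices and path edges are treated alike, as positions in the word; this reduces
  injectivity on the path to distinctness of the letters.\<close>

lemma Phi_cell_cases:
  assumes "s \<in> cells (Phi_graph T)"
  obtains (word) j where "j < length (phi_word T)" "Phi_fun T s = phi_word T ! j"
      "s = (if even j then Inl (j div 2) else Inr (PathEdge (j div 2)))"
  | (cycle) p where "p \<in> cycle_nodes T" "s = Inr (CycleEdge (lab p))" "Phi_fun T s = lab p"
proof (cases s)
  case (Inl i)
  then have "i \<le> phi_length T" using assms by (simp add: Phi_graph_def)
  then show ?thesis using Inl word[of "2 * i"] length_phi_word[OF tree] by simp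
next
  case (Inr e)
  then have "e \<in> edges (Phi_graph T)" using assms by simp
  then show ?thesis
  proof (cases rule: Phi_edge_cases)
    case (path i)
    then show ?thesis using Inr word[of "2 * i + 1"] length_phi_word[OF tree] by simp
  next
    case (cycle p)
    then show ?thesis using Inr that(2)[of p] by simp
  qed
qed

lemma inj_Phi: "inj_on (Phi_fun T) (cells (Phi_graph T))"
proof (rule inj_onI)
  fix s t assume s: "s \<in> cells (Phi_graph T)" and t: "t \<in> cells (Phi_graph T)" and eq: "Phi_fun T s = Phi_fun T t"
  \<comment> \<open>Letters come from nodes with no child or two, cycle edges from nodes with one,
    and different nodes have different labels.\<close>
  have sep: "phi_word T ! j \<noteq> lab p" if j: "j < length (phi_word T)" and p: "p \<in> cycle_nodes T" for j p
  proof
    assume *: "phi_word T ! j = lab p"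
    obtain q where "q \<in> set (subtrees T)" "length (children q) \<noteq> 1" "phi_word T ! j = lab q"
      using set_phi_word[OF tree] nth_mem[OF j] by blast
    then show False using * p merge_tree_lab_inj[OF tree, of p q] by (auto simp: cycle_nodes_def)
  qed
  from s show "s = t"
  proof (cases rule: Phi_cell_cases)
    case s: (word j)
    from t show ?thesis
    proof (cases rule: Phi_cell_cases)
      case (word k)
      then have "j = k" using s eq distinct_phi_word[OF tree] by (simp add: nth_eq_iff_index_eq)
      then show ?thesis using s word by simp
    next
      case (cycle p)
      then show ?thesis using s eq sep[of j p] by simp
    qed
  next
    case s: (cycle p)
    from t show ?thesis
    proof (cases rule: Phi_cell_cases)
      case (word k)
      then show ?thesis using s eq sep[of k p] by simp
    next
      case (cycle q)
      then show ?thesis using s eq by simp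
    qed
  qed
qed

sublocale realization "Phi_graph T" "Phi_fun T" T
proof
  show "multigraph (Phi_graph T)" by (rule multigraph_Phi)
  show "inj_on (Phi_fun T) (cells (Phi_graph T))" by (rule inj_Phi)
  show "merge_tree T" by (rule tree)
  show "Phi_fun T ` cells (Phi_graph T) \<subseteq> labels T"
  proof
    fix y assume "y \<in> Phi_fun T ` cells (Phi_graph T)"
    then obtain s where "s \<in> cells (Phi_graph T)" and y: "y = Phi_fun T s" by blast
    from this(1) show "y \<in> labels T"
    proof (cases rule: Phi_cell_cases)
      case (word j)
      then show ?thesis using y set_phi_word_labels[OF tree] nth_mem by fastforce
    next
      case (cycle p)
      then show ?thesis using y by (auto simp: cycle_nodes_def labels_def)
    qed
  qed
  show "\<exists>v\<in>verts (Phi_graph T). Phi_fun T (Inl v) = lab p" if "p \<in> set (subtrees T)" "children p = []" for p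
    using phi_word_leaf[OF tree that] by (auto simp: Phi_graph_def)
  fix p assume p: "p \<in> set (subtrees T)" "children p \<noteq> []"
  have "length (children p) \<le> 2" using merge_tree_binary_chiral[OF tree] p by (auto simp: binary_tree_def)
  moreover have "length (children p) \<noteq> 0" using p by simp
  ultimately consider "length (children p) = 2" | "length (children p) = 1" by linarith
  then show "\<exists>e\<in>edges (Phi_graph T). Phi_fun T (Inr e) = lab p \<and>
      (\<forall>v\<in>ends (Phi_graph T) e. \<exists>t\<in>set (children p). Phi_fun T (Inl v) \<in> labels t) \<and>
      (\<forall>t\<in>set (children p). \<exists>v\<in>ends (Phi_graph T) e. Phi_fun T (Inl v) \<in> labels t)"
  proof cases
    case 1
    obtain i t u where "i < phi_length T" "phi_word T ! (2 * i + 1) = lab p" "set (children p) = {t, u}"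
      "phi_word T ! (2 * i) \<in> labels t" "phi_word T ! (2 * Suc i) \<in> labels u"
      using phi_word_branch[OF tree p(1) 1] by blast
    then show ?thesis by (intro bexI[of _ "PathEdge i"]) (auto simp: Phi_graph_def)
  next
    case 2
    then have c: "p \<in> cycle_nodes T" using p by (simp add: cycle_nodes_def)
    then obtain t i where "children p = [t]" "i < phi_length T" "parallel_index T (lab p) = i"
      "phi_word T ! (2 * i) \<in> labels t" "phi_word T ! (2 * Suc i) \<in> labels t"
      by (rule cycle_edge_index)
    then show ?thesis using c by (intro bexI[of _ "CycleEdge (lab p)"]) (auto simp: Phi_graph_def)
  qed
qed

lemma Phi_critical_dMfs: "(Phi_graph T, Phi_fun T) \<in> critical_dMfs"
  using multigraph_Phi connected critical_dMf by (simp add: critical_dMfs_def)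

text \<open>Every edge joins some \<open>i\<close> to \<open>Suc i\<close>, so there are no
  self-loops.\<close>

lemma Phi_no_initial_loops: "no_initial_loops (Phi_graph T) (Phi_fun T)"
  unfolding no_initial_loops_def
proof (intro ballI allI impI)
  fix e v assume "e \<in> edges (Phi_graph T)" "ends (Phi_graph T) e = {v}"
  then obtain i where "{v} = {i, Suc i}" by (metis Phi_ends)
  then show "edges (component (sublevel_less (Phi_graph T) (Phi_fun T) (Phi_fun T (Inr e))) (Inl v)) \<noteq> {}" by auto
qed

end

section \<open>The correspondence\<close>

lemma equiv_CM_rel: "equiv critical_dMfs CM_rel"
proof (rule equivI)
  have iff: "((X, f), (X', f')) \<in> CM_rel \<longleftrightarrow>
    (X, f) \<in> critical_dMfs \<and> (X', f') \<in> critical_dMfs \<and> merge_family X f = merge_family X' f'"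
    for X X' :: "('v, 'e) multigraph" and f f'
    using CM_equivalent_iff_merge_family[of X f X' f'] by (auto simp: CM_rel_def)
  show "(CM_rel :: ((('v, 'e) multigraph \<times> _) \<times> _) set) \<subseteq> critical_dMfs \<times> critical_dMfs"
    by (auto simp: CM_rel_def)
  show "refl_on critical_dMfs (CM_rel :: ((('v, 'e) multigraph \<times> _) \<times> _) set)"
    by (auto simp: refl_on_def iff)
  show "sym (CM_rel :: ((('v, 'e) multigraph \<times> _) \<times> _) set)"
    by (auto simp: sym_def iff)
  show "trans (CM_rel :: ((('v, 'e) multigraph \<times> _) \<times> _) set)"
    by (auto simp: trans_def iff)
qed

lemma critical_dMfs_morse_graph: "(X, f) \<in> critical_dMfs \<Longrightarrow> morse_graph X f \<and> connected_graph X"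
  by (simp add: critical_dMfs_def morse_graph_def)

lemma induced_tree_critical_dMfs:
  assumes "(X, f) \<in> critical_dMfs"
  shows "merge_tree (induced_tree X f)" "chir (induced_tree X f) = Lft"
    "tree_family (induced_tree X f) = merge_family X f"
  using morse_graph.induced_tree_family critical_dMfs_morse_graph[OF assms] by blast+

lemma induced_tree_gML:
  assumes "(X, f) \<in> critical_dMfs" "no_initial_loops X f"
  shows "gML_tree (induced_tree X f)"
proof (rule merge_tree_gML_tree)
  have "\<forall>A\<in>merge_family X f. card A \<noteq> 2"
    using assms morse_graph.no_initial_loops_iff critical_dMfs_morse_graph by blast
  then show "card A \<noteq> 2" if "A \<in> tree_family (induced_tree X f)" for A
    using that induced_tree_critical_dMfs[OF assms(1)] by simp
qed (rule induced_tree_critical_dMfs[OF assms(1)])+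

text \<open>The condition on loops is a condition on the family, and the family together with the
  root chirality determines the tree up to isomorphism.\<close>

lemma CM_equivalent_invariance:
  assumes "(X, f) \<in> critical_dMfs" "(X', f') \<in> critical_dMfs" "CM_equivalent X f X' f'"
  shows "no_initial_loops X f \<longleftrightarrow> no_initial_loops X' f'"
    and "ltree_iso (induced_tree X f) (induced_tree X' f')"
proof -
  have F: "merge_family X f = merge_family X' f'"
    using CM_equivalent_iff_merge_family[OF assms(1,2)] assms(3) by simp
  then show "no_initial_loops X f \<longleftrightarrow> no_initial_loops X' f'"
    using assms morse_graph.no_initial_loops_iff critical_dMfs_morse_graph by metis
  show "ltree_iso (induced_tree X f) (induced_tree X' f')"
    using F induced_tree_critical_dMfs[OF assms(1)] induced_tree_critical_dMfs[OF assms(2)]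
    by (intro ltree_iso_if_family_eq) simp_all
qed

lemma Phi_family:
  assumes "gML_tree T"
  shows "(Phi_graph T, Phi_fun T) \<in> critical_dMfs" "no_initial_loops (Phi_graph T) (Phi_fun T)"
    "merge_family (Phi_graph T) (Phi_fun T) = tree_family T"
proof -
  interpret gML T using assms by unfold_locales
  show "(Phi_graph T, Phi_fun T) \<in> critical_dMfs" "no_initial_loops (Phi_graph T) (Phi_fun T)"
    "merge_family (Phi_graph T) (Phi_fun T) = tree_family T"
    by (rule Phi_critical_dMfs Phi_no_initial_loops merge_family_eq)+
qed

text \<open>Two equivalence relations, two maps that respect them, and the two inversions. On the
  side of functions the correspondence is restricted to those without initial loops; this condition
  is invariant under CM equivalence, so it singles out a set of classes.\<close>

theorem theorem3p1:
  shows
    "equiv (critical_dMfs :: (('v, 'e) multigraph \<times> ('v + 'e \<Rightarrow> real)) set) CM_rel \<and>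
     equiv gML_trees gML_iso_rel \<and>
     (\<forall>(X :: ('v, 'e) multigraph) f.
        (X, f) \<in> critical_dMfs \<and> no_initial_loops X f \<longrightarrow> induced_tree X f \<in> gML_trees) \<and>
     (\<forall>(X :: ('v, 'e) multigraph) f (X' :: ('w, 'd) multigraph) f'.
        (X, f) \<in> critical_dMfs \<and> (X', f') \<in> critical_dMfs \<and> CM_equivalent X f X' f' \<longrightarrow>
        (no_initial_loops X f \<longleftrightarrow> no_initial_loops X' f') \<and>
        ltree_iso (induced_tree X f) (induced_tree X' f')) \<and>
     (\<forall>T\<in>gML_trees.
        (Phi_graph T, Phi_fun T) \<in> critical_dMfs \<and> no_initial_loops (Phi_graph T) (Phi_fun T)) \<and>
     (\<forall>(T, T')\<in>gML_iso_rel.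
        CM_equivalent (Phi_graph T) (Phi_fun T) (Phi_graph T') (Phi_fun T')) \<and>
     (\<forall>(X :: ('v, 'e) multigraph) f.
        (X, f) \<in> critical_dMfs \<and> no_initial_loops X f \<longrightarrow>
        CM_equivalent (Phi_graph (induced_tree X f)) (Phi_fun (induced_tree X f)) X f) \<and>
     (\<forall>T\<in>gML_trees. ltree_iso (induced_tree (Phi_graph T) (Phi_fun T)) T)"
proof (intro conjI)
  show "equiv (critical_dMfs :: (('v, 'e) multigraph \<times> ('v + 'e \<Rightarrow> real)) set) CM_rel"
    by (rule equiv_CM_rel)
  show "equiv gML_trees gML_iso_rel" by (rule equiv_gML_iso_rel)
  show "\<forall>(X :: ('v, 'e) multigraph) f.
      (X, f) \<in> critical_dMfs \<and> no_initial_loops X f \<longrightarrow> induced_tree X f \<in> gML_trees"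
    using induced_tree_gML by (auto simp: gML_trees_def)
  show "\<forall>(X :: ('v, 'e) multigraph) f (X' :: ('w, 'd) multigraph) f'.
      (X, f) \<in> critical_dMfs \<and> (X', f') \<in> critical_dMfs \<and> CM_equivalent X f X' f' \<longrightarrow>
      (no_initial_loops X f \<longleftrightarrow> no_initial_loops X' f') \<and>
      ltree_iso (induced_tree X f) (induced_tree X' f')"
    using CM_equivalent_invariance by blast
  show "\<forall>T\<in>gML_trees.
      (Phi_graph T, Phi_fun T) \<in> critical_dMfs \<and> no_initial_loops (Phi_graph T) (Phi_fun T)"
    using Phi_family(1,2) by (simp add: gML_trees_def)
  show "\<forall>(T, T')\<in>gML_iso_rel.
      CM_equivalent (Phi_graph T) (Phi_fun T) (Phi_graph T') (Phi_fun T')"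
  proof (clarify)
    fix T T' assume "(T, T') \<in> gML_iso_rel"
    then have T: "gML_tree T" "gML_tree T'" "ltree_iso T T'" by (auto simp: gML_iso_rel_def gML_trees_def)
    then show "CM_equivalent (Phi_graph T) (Phi_fun T) (Phi_graph T') (Phi_fun T')"
      by (simp add: CM_equivalent_iff_merge_family Phi_family ltree_iso_family)
  qed
  show "\<forall>(X :: ('v, 'e) multigraph) f.
      (X, f) \<in> critical_dMfs \<and> no_initial_loops X f \<longrightarrow>
      CM_equivalent (Phi_graph (induced_tree X f)) (Phi_fun (induced_tree X f)) X f"
    by (simp add: CM_equivalent_iff_merge_family Phi_family induced_tree_gML induced_tree_critical_dMfs)
  show "\<forall>T\<in>gML_trees. ltree_iso (induced_tree (Phi_graph T) (Phi_fun T)) T"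
  proof
    fix T assume "T \<in> gML_trees"
    then have T: "gML_tree T" by (simp add: gML_trees_def)
    note tree = induced_tree_critical_dMfs[OF Phi_family(1)[OF T]]
    show "ltree_iso (induced_tree (Phi_graph T) (Phi_fun T)) T"
      using tree gML_tree_merge_tree[OF T] Phi_family(3)[OF T]
      by (intro ltree_iso_if_family_eq) simp_all
  qed
qed

end
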